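(* Let $(M,g)$ be a generalized gravitational wave spacetime (see context) with least action $S:E\times E\to[-\infty,+\infty]$. For an event $x=(t_x,q_x,y_x)\in M$ with projection $e_x=(t_x,q_x)$, the following are equivalent: (i) $(M,g)$ is strongly causal at $x$; (ii) $(M,g)$ is strongly causal at every event $z$ on the same time slice, i.e. with $t(z)=t(x)$; (iii) $S$ is lower semi-continuous at $(e_x,e_x)$. In particular, $(M,g)$ is strongly causal if and only if $S$ is lower semi-continuous on the diagonal $\{(e,e):e\in E\}$ (i.e. at every point of it).
   Context: Setting. $r\ge 2$; $Q$ is a connected $d$-dimensional ($C^{r+1}$, Hausdorff, paracompact, boundaryless) manifold; $T\subset\mathbb{R}$ is a connected interval, open because spacetimes are without boundary; $E=T\times Q$ with points $e=(t,q)$. On $Q$ there are given a time-dependent Riemannian metric $a_t$, a time-dependent 1-form $b_t$ and a function $V(t,q)$, all $C^r$ in $(t,q)\in E$. The Lagrangian is $L(t,q,v)=\frac12 a_t(v,v)+b_t(v)-V(t,q)$. The generalized gravitational wave spacetime is $M=T\times Q\times\mathbb{R}$ with points $x=(t,q,y)$ and Lorentzian metric (signature $(-,+,\dots,+)$) $g=a_t-dt\otimes(dy-b_t)-(dy-b_t)\otimes dt-2V\,dt^2$, time oriented by the timelike vector field $W=\partial_t-(V-\tfrac12)\partial_y$. Least action. For $e_0=(t_0,q_0)$, $e_1=(t_1,q_1)$ with $t_0<t_1$, $S(e_0,e_1)$ is the infimum of $\int_{t_0}^{t_1}L(t,q(t),\dot q(t))\,dt$ over the $C^1$ curves $q:[t_0,t_1]\to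 Q$ with $q(t_0)=q_0$, $q(t_1)=q_1$; $S(e_0,e_1)=0$ if $e_0=e_1$; $S(e_0,e_1)=+\infty$ otherwise. A spacetime is strongly causal at $x$ if $x$ has arbitrarily small neighborhoods which no causal curve intersects in a disconnected set, and strongly causal if this holds at every point. *)

theory Defs
  imports "HOL-Analysis.Analysis"
begin

subsection \<open>Functions of class \<open>C\<^sup>k\<close> on open sets and \<open>C\<^sup>1\<close> functions on intervals\<close>

text \<open>Directional derivatives in all directions; intended for open \<open>S\<close> in a finite-dimensional space.\<close>

primrec Ck_on :: "nat \<Rightarrow> 'a::real_normed_vector set \<Rightarrow> ('a \<Rightarrow> 'b::real_normed_vector) \<Rightarrow> bool" where
  "Ck_on 0 S f \<longleftrightarrow> continuous_on S f"
| "Ck_on (Suc k) S f \<longleftrightarrow>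
     (\<forall>x\<in>S. f differentiable (at x)) \<and> (\<forall>v. Ck_on k S (\<lambda>x. frechet_derivative f (at x) v))"

text \<open>The derivative is one-sided at end points belonging to \<open>J\<close>.\<close>

definition C1_on :: "real set \<Rightarrow> (real \<Rightarrow> 'b::real_normed_vector) \<Rightarrow> bool" where
  "C1_on J f \<longleftrightarrow>
     (\<exists>f'. continuous_on J f' \<and> (\<forall>s\<in>J. (f has_vector_derivative f' s) (at s within J)))"

subsection \<open>Manifolds\<close>

definition paracompact_UNIV :: "'q::topological_space itself \<Rightarrow> bool" where
  "paracompact_UNIV _ \<longleftrightarrow>
     (\<forall>\<C> :: 'q set set. (\<forall>C\<in>\<C>. open C) \<and> \<Union>\<C> = UNIV \<longrightarrow>
        (\<exists>\<D>. (\<forall>D\<in>\<D>. open D) \<and> \<Union>\<D> = UNIV \<and> (\<forall>D\<in>\<D>. \<exists>C\<in>\<C>. D \<subseteq> C) \<and>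
             locally_finite_in euclidean \<D>))"

text \<open>A chart is a coordinate domain with a coordinate map, whose values off the domain are irrelevant.\<close>

type_synonym ('q, 'm) chart = "'q set \<times> ('q \<Rightarrow> 'm)"

definition is_chart :: "('q::topological_space, 'm::euclidean_space) chart \<Rightarrow> bool" where
  "is_chart c \<longleftrightarrow> (case c of (U, \<phi>) \<Rightarrow>
     open U \<and> open (\<phi> ` U) \<and> homeomorphism U (\<phi> ` U) \<phi> (inv_into U \<phi>))"

definition Ck_atlas :: "nat \<Rightarrow> ('q::topological_space, 'm::euclidean_space) chart set \<Rightarrow> bool" where
  "Ck_atlas k A \<longleftrightarrow>
     (\<forall>c\<in>A. is_chart c) \<and> (\<Union>c\<in>A. fst c) = UNIV \<and>
     (\<forall>(U, \<phi>)\<in>A. \<forall>(U', \<psi>)\<in>A. Ck_on k (\<phi> ` (U \<inter> U')) (\<psi> \<circ> inv_into U \<phi>))"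

text \<open>
  A tangent vector at \<open>p\<close> is represented by the family of its coordinate vectors in all charts of
  the atlas around \<open>p\<close> (and \<open>0\<close> at all other charts). The vector with coordinates \<open>u\<close> in
  the chart \<open>(U, \<phi>)\<close> is \<open>tangent_vector A p (U, \<phi>) u\<close>.
\<close>

type_synonym ('q, 'm) tvec = "('q, 'm) chart \<Rightarrow> 'm"

definition tangent_vector ::
  "('q, 'm::euclidean_space) chart set \<Rightarrow> 'q \<Rightarrow> ('q, 'm) chart \<Rightarrow> 'm \<Rightarrow> ('q, 'm) tvec" where
  "tangent_vector A p c u =
     (\<lambda>c'. if c' \<in> A \<and> p \<in> fst c'
           then frechet_derivative (snd c' \<circ> inv_into (fst c) (snd c)) (at (snd c p)) u
           else 0)"

definition C1_curve ::
  "('q::topological_space, 'm::euclidean_space) chart set \<Rightarrow> real set \<Rightarrow> (real \<Rightarrow> 'q) \<Rightarrow> bool" where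
  "C1_curve A J q \<longleftrightarrow>
     continuous_on J q \<and> (\<forall>(U, \<phi>)\<in>A. C1_on {s\<in>J. q s \<in> U} (\<phi> \<circ> q))"

definition velocity ::
  "('q, 'm::euclidean_space) chart set \<Rightarrow> real set \<Rightarrow> (real \<Rightarrow> 'q) \<Rightarrow> real \<Rightarrow> ('q, 'm) tvec" where
  "velocity A J q s =
     (\<lambda>c. if c \<in> A \<and> q s \<in> fst c then vector_derivative (snd c \<circ> q) (at s within J) else 0)"

subsection \<open>Generalized gravitational wave spacetimes\<close>

text \<open>
  \<open>a t q\<close> and \<open>b t q\<close> act on tangent vectors of \<open>Q\<close> at \<open>q\<close>. Only their values for
  \<open>t \<in> T\<close> and on actual tangent vectors at \<open>q\<close> matter. The manifold \<open>Q\<close> is the type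
  \<open>'q\<close> with the atlas \<open>A\<close>, and \<open>d = DIM('m)\<close>.
\<close>

type_synonym ('q, 'm) tmetric = "real \<Rightarrow> 'q \<Rightarrow> ('q, 'm) tvec \<Rightarrow> ('q, 'm) tvec \<Rightarrow> real"
type_synonym ('q, 'm) tform = "real \<Rightarrow> 'q \<Rightarrow> ('q, 'm) tvec \<Rightarrow> real"

locale gravitational_wave =
  fixes r :: nat
    and A :: "('q::t2_space, 'm::euclidean_space) chart set"
    and T :: "real set"
    and a :: "('q, 'm) tmetric"
    and b :: "('q, 'm) tform"
    and V :: "real \<Rightarrow> 'q \<Rightarrow> real"
  assumes r_ge_2: "r \<ge> 2"
    and connected_Q: "connected (UNIV :: 'q set)"
    and paracompact_Q: "paracompact_UNIV TYPE('q)"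
    and atlas: "Ck_atlas (r + 1) A"
    and T_interval: "is_interval T" "open T" "T \<noteq> {}"
    and a_bilinear: "\<And>t p c. t \<in> T \<Longrightarrow> c \<in> A \<Longrightarrow> p \<in> fst c \<Longrightarrow>
          bilinear (\<lambda>u v. a t p (tangent_vector A p c u) (tangent_vector A p c v))"
    and a_symmetric: "\<And>t p c u v. t \<in> T \<Longrightarrow> c \<in> A \<Longrightarrow> p \<in> fst c \<Longrightarrow>
          a t p (tangent_vector A p c u) (tangent_vector A p c v) =
          a t p (tangent_vector A p c v) (tangent_vector A p c u)"
    and a_positive: "\<And>t p c u. t \<in> T \<Longrightarrow> c \<in> A \<Longrightarrow> p \<in> fst c \<Longrightarrow> u \<noteq> 0 \<Longrightarrow>
          a t p (tangent_vector A p c u) (tangent_vector A p c u) > 0"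
    and b_linear: "\<And>t p c. t \<in> T \<Longrightarrow> c \<in> A \<Longrightarrow> p \<in> fst c \<Longrightarrow>
          linear (\<lambda>u. b t p (tangent_vector A p c u))"
    and a_Ck: "\<And>U \<phi> u v. (U, \<phi>) \<in> A \<Longrightarrow> Ck_on r (T \<times> \<phi> ` U)
          (\<lambda>(t, z). let p = inv_into U \<phi> z
             in a t p (tangent_vector A p (U, \<phi>) u) (tangent_vector A p (U, \<phi>) v))"
    and b_Ck: "\<And>U \<phi> u. (U, \<phi>) \<in> A \<Longrightarrow> Ck_on r (T \<times> \<phi> ` U)
          (\<lambda>(t, z). let p = inv_into U \<phi> z in b t p (tangent_vector A p (U, \<phi>) u))"
    and V_Ck: "\<And>U \<phi>. (U, \<phi>) \<in> A \<Longrightarrow> Ck_on r (T \<times> \<phi> ` U)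
          (\<lambda>(t, z). V t (inv_into U \<phi> z))"

subsection \<open>Least action\<close>

definition lagrangian ::
  "('q, 'm) tmetric \<Rightarrow> ('q, 'm) tform \<Rightarrow> (real \<Rightarrow> 'q \<Rightarrow> real)
    \<Rightarrow> real \<Rightarrow> 'q \<Rightarrow> ('q, 'm) tvec \<Rightarrow> real" where
  "lagrangian a b V t q v = a t q v v / 2 + b t q v - V t q"

definition action ::
  "('q, 'm::euclidean_space) chart set \<Rightarrow> ('q, 'm) tmetric \<Rightarrow> ('q, 'm) tform
    \<Rightarrow> (real \<Rightarrow> 'q \<Rightarrow> real) \<Rightarrow> real \<Rightarrow> real \<Rightarrow> (real \<Rightarrow> 'q) \<Rightarrow> real" where
  "action A a b V t\<^sub>0 t\<^sub>1 q =
     integral {t\<^sub>0..t\<^sub>1} (\<lambda>t. lagrangian a b V t (q t) (velocity A {t\<^sub>0..t\<^sub>1} q t))"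

definition least_action ::
  "('q::topological_space, 'm::euclidean_space) chart set \<Rightarrow> ('q, 'm) tmetric \<Rightarrow> ('q, 'm) tform
    \<Rightarrow> (real \<Rightarrow> 'q \<Rightarrow> real) \<Rightarrow> real \<times> 'q \<Rightarrow> real \<times> 'q \<Rightarrow> ereal" where
  "least_action A a b V e\<^sub>0 e\<^sub>1 = (case (e\<^sub>0, e\<^sub>1) of ((t\<^sub>0, q\<^sub>0), (t\<^sub>1, q\<^sub>1)) \<Rightarrow>
     if t\<^sub>0 < t\<^sub>1
     then INF q \<in> {q. C1_curve A {t\<^sub>0..t\<^sub>1} q \<and> q t\<^sub>0 = q\<^sub>0 \<and> q t\<^sub>1 = q\<^sub>1}. ereal (action A a b V t\<^sub>0 t\<^sub>1 q)
     else if e\<^sub>0 = e\<^sub>1 then 0 else \<infinity>)"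

definition lsc_at_within ::
  "'a::topological_space \<Rightarrow> 'a set \<Rightarrow> ('a \<Rightarrow> ereal) \<Rightarrow> bool" where
  "lsc_at_within x X f \<longleftrightarrow> (\<forall>c < f x. \<forall>\<^sub>F x' in at x within X. c < f x')"

definition classical_spacetime :: "real set \<Rightarrow> (real \<times> 'q) set" where
  "classical_spacetime T = T \<times> UNIV"

subsection \<open>The spacetime and its causality\<close>

definition spacetime :: "real set \<Rightarrow> (real \<times> 'q \<times> real) set" where
  "spacetime T = T \<times> UNIV \<times> UNIV"

text \<open>
  The tangent space of \<open>M = T \<times> Q \<times> \<real>\<close> at \<open>(t, q, y)\<close> is identified with \<open>\<real> \<times> T\<^sub>qQ \<times> \<real>\<close>,
  so that the components of a tangent vector are its images under \<open>dt\<close>, the differential of the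
  projection to \<open>Q\<close>, and \<open>dy\<close>.
\<close>

type_synonym ('q, 'm) Mtvec = "real \<times> ('q, 'm) tvec \<times> real"

definition gw_metric ::
  "('q, 'm) tmetric \<Rightarrow> ('q, 'm) tform \<Rightarrow> (real \<Rightarrow> 'q \<Rightarrow> real)
    \<Rightarrow> real \<times> 'q \<times> real \<Rightarrow> ('q, 'm) Mtvec \<Rightarrow> ('q, 'm) Mtvec \<Rightarrow> real" where
  "gw_metric a b V x X X' =
     (case (x, X, X') of ((t, q, y), (\<tau>, v, \<eta>), (\<tau>', v', \<eta>')) \<Rightarrow>
        a t q v v' - \<tau> * (\<eta>' - b t q v') - (\<eta> - b t q v) * \<tau>' - 2 * V t q * \<tau> * \<tau>')"

text \<open>The time orientation is given by \<open>W = \<partial>\<^sub>t - (V - 1/2) \<partial>\<^sub>y\<close>.\<close>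

definition gw_orientation ::
  "(real \<Rightarrow> 'q \<Rightarrow> real) \<Rightarrow> real \<times> 'q \<times> real \<Rightarrow> ('q, 'm::zero) Mtvec" where
  "gw_orientation V x = (case x of (t, q, y) \<Rightarrow> (1, (\<lambda>_. 0), - (V t q - 1/2)))"

definition future_causal ::
  "('q, 'm::zero) tmetric \<Rightarrow> ('q, 'm) tform \<Rightarrow> (real \<Rightarrow> 'q \<Rightarrow> real)
    \<Rightarrow> real \<times> 'q \<times> real \<Rightarrow> ('q, 'm) Mtvec \<Rightarrow> bool" where
  "future_causal a b V x X \<longleftrightarrow>
     X \<noteq> (0, (\<lambda>_. 0), 0) \<and> gw_metric a b V x X X \<le> 0 \<and>
     gw_metric a b V x X (gw_orientation V x) < 0"

definition Mvelocity ::
  "('q, 'm::euclidean_space) chart set \<Rightarrow> real set \<Rightarrow> (real \<Rightarrow> real \<times> 'q \<times> real)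
    \<Rightarrow> real \<Rightarrow> ('q, 'm) Mtvec" where
  "Mvelocity A J \<gamma> s =
     (vector_derivative (fst \<circ> \<gamma>) (at s within J),
      velocity A J (fst \<circ> snd \<circ> \<gamma>) s,
      vector_derivative (snd \<circ> snd \<circ> \<gamma>) (at s within J))"

definition C1_causal_curve ::
  "('q::topological_space, 'm::euclidean_space) chart set \<Rightarrow> real set \<Rightarrow> ('q, 'm) tmetric
    \<Rightarrow> ('q, 'm) tform \<Rightarrow> (real \<Rightarrow> 'q \<Rightarrow> real) \<Rightarrow> real set \<Rightarrow> (real \<Rightarrow> real \<times> 'q \<times> real) \<Rightarrow> bool" where
  "C1_causal_curve A T a b V J \<gamma> \<longleftrightarrow>
     \<gamma> ` J \<subseteq> spacetime T \<and>
     C1_on J (fst \<circ> \<gamma>) \<and> C1_curve A J (fst \<circ> snd \<circ> \<gamma>) \<and> C1_on J (snd \<circ> snd \<circ> \<gamma>) \<and>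
     (\<forall>s\<in>J. future_causal a b V (\<gamma> s) (Mvelocity A J \<gamma> s))"

text \<open>
  Causal curves are piecewise \<open>C\<^sup>1\<close>, with break points in \<open>F\<close>, and parametrized on a
  nondegenerate interval. They are traversed towards the future; a past-directed causal curve is
  one of these traversed backwards and has the same image.
\<close>

definition causal_curve ::
  "('q::topological_space, 'm::euclidean_space) chart set \<Rightarrow> real set \<Rightarrow> ('q, 'm) tmetric
    \<Rightarrow> ('q, 'm) tform \<Rightarrow> (real \<Rightarrow> 'q \<Rightarrow> real) \<Rightarrow> real set \<Rightarrow> (real \<Rightarrow> real \<times> 'q \<times> real) \<Rightarrow> bool" where
  "causal_curve A T a b V I \<gamma> \<longleftrightarrow>
     is_interval I \<and> interior I \<noteq> {} \<and> continuous_on I \<gamma> \<and>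
     (\<exists>F. finite F \<and>
        (\<forall>J. is_interval J \<and> interior J \<noteq> {} \<and> J \<subseteq> I \<and> interior J \<inter> F = {} \<longrightarrow>
             C1_causal_curve A T a b V J \<gamma>))"

definition strongly_causal_at ::
  "('q::topological_space, 'm::euclidean_space) chart set \<Rightarrow> real set \<Rightarrow> ('q, 'm) tmetric
    \<Rightarrow> ('q, 'm) tform \<Rightarrow> (real \<Rightarrow> 'q \<Rightarrow> real) \<Rightarrow> real \<times> 'q \<times> real \<Rightarrow> bool" where
  "strongly_causal_at A T a b V x \<longleftrightarrow>
     (\<forall>N. open N \<and> x \<in> N \<longrightarrow>
        (\<exists>U. open U \<and> x \<in> U \<and> U \<subseteq> N \<inter> spacetime T \<and>
             (\<forall>I \<gamma>. causal_curve A T a b V I \<gamma> \<longrightarrow> connected (\<gamma> ` I \<inter> U))))"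

definition strongly_causal ::
  "('q::topological_space, 'm::euclidean_space) chart set \<Rightarrow> real set \<Rightarrow> ('q, 'm) tmetric
    \<Rightarrow> ('q, 'm) tform \<Rightarrow> (real \<Rightarrow> 'q \<Rightarrow> real) \<Rightarrow> bool" where
  "strongly_causal A T a b V \<longleftrightarrow> (\<forall>x\<in>spacetime T. strongly_causal_at A T a b V x)"

end

theory Submission
  imports Defs
begin

text \<open>
  Along a causal curve \<open>t\<close> is nondecreasing and, where \<open>t\<close> increases, \<open>y\<close> grows at least as fast as
  the action; conversely a curve in \<open>Q\<close> lifts to a null curve on which the increment of \<open>y\<close> is the
  action. So strong causality fails at \<open>(t, q, y)\<close> when curves of short duration near
  \<open>(t, q)\<close> have action bounded away from \<open>0\<close> from below: since the Lagrangian is locally bounded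
  below, such curves leave a fixed ball around \<open>q\<close>, which is expensive if done quickly. Leaving the
  ball more slowly saves so much action that there are short loops at \<open>q\<close> with arbitrarily negative
  action, whose null lifts are closed up by a vertical segment to an almost closed causal curve. In
  the other direction, by the same estimate lower semi-continuity prevents causal curves that start
  and end near \<open>(t, q', y)\<close> from leaving a chart, for all \<open>q'\<close> and \<open>y\<close>, as \<open>q'\<close> and \<open>q\<close> can be joined in
  a short fixed time at a bounded cost.
\<close>

subsection \<open>Velocities of curves in charts\<close>

text \<open>Two obstacles shape the proof. A causal curve may be vertical, with
  \<open>dt = 0\<close>, on part of its parameter interval and is then no graph over time; and the
  least action admits only C1 curves, while pieces of curves have to be concatenated. Both are met
  by delaying time a little: the projected curve has finite speed in the delayed time and can be
  brought to rest at both ends, so that pieces join without corners. The relation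
  \<open>reach\<close> records what survives this with arbitrarily small errors in time and action,
  and it is transitive.

  The estimates compare two costs for a short duration e: up to small errors, leaving a coordinate
  ball costs at least a constant over e, and joining two points of a small set costs at most another
  constant over e. For one implication the connections are given m times the duration, with m
  offsetting the ratio of the constants. For the other the connections are fixed before the
  neighborhood, whose slope l is then taken large enough to exceed their cost.\<close>

abbreviation nondeg :: "real set \<Rightarrow> bool" where
  "nondeg J \<equiv> is_interval J \<and> interior J \<noteq> {}"

lemma nondeg_Icc: "a < b \<Longrightarrow> nondeg {a..b::real}"
  by (auto simp: is_interval_cc)

text \<open>Makes one-sided derivatives at end points of \<open>J\<close> unique, so that
  \<open>vector_derivative\<close> computes them.\<close>

lemma nondeg_not_bot:
  assumes "nondeg J" "s \<in> J"
  shows "at s within J \<noteq> bot"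
proof -
  have "J \<noteq> {x}" for x
    using assms(1) by (auto simp: interior_singleton)
  moreover have "connected J"
    using assms(1) is_interval_connected_1 by blast
  ultimately have "s islimpt J"
    using assms(2) connected_imp_perfect by blast
  then show ?thesis
    by (simp add: trivial_limit_within)
qed

text \<open>\<open>C1_curve\<close> differentiates within the parameters at which the curve lies in
  a chart domain, \<open>velocity\<close> within all of \<open>J\<close>; as \<open>U\<close> is
  open, the two filters agree.\<close>

lemma at_within_preimage:
  assumes "continuous_on J q" "open U" "s \<in> J" "q s \<in> U"
  shows "at s within {s \<in> J. q s \<in> U} = at s within J"
proof -
  obtain W where W: "open W" "W \<inter> J = q -` U \<inter> J"
    using assms(1,2) continuous_on_open_invariant by metis
  show ?thesis
    by (rule at_within_nhd[of s W]) (use W assms in auto)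
qed

lemma has_vector_derivative_within_Un:
  fixes f :: "real \<Rightarrow> 'b::real_normed_vector"
  assumes "(f has_vector_derivative D) (at s within S)" "(f has_vector_derivative D) (at s within S')"
  shows "(f has_vector_derivative D) (at s within S \<union> S')"
  using assms unfolding has_vector_derivative_def has_derivative_within
  by (auto simp: Lim_within_Un)

context gravitational_wave
begin

section \<open>Charts, transition maps and coordinate vectors\<close>

lemma chartD:
  assumes "(U, \<phi>) \<in> A"
  shows "open U" "open (\<phi> ` U)" "inj_on \<phi> U" "continuous_on U \<phi>"
    "continuous_on (\<phi> ` U) (inv_into U \<phi>)" "p \<in> U \<Longrightarrow> inv_into U \<phi> (\<phi> p) = p"
proof -
  have c: "open U" "open (\<phi> ` U)" "homeomorphism U (\<phi> ` U) \<phi> (inv_into U \<phi>)"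
    using atlas assms unfolding Ck_atlas_def is_chart_def by auto
  then show "open U" "open (\<phi> ` U)" "inj_on \<phi> U" "continuous_on U \<phi>"
    "continuous_on (\<phi> ` U) (inv_into U \<phi>)" "p \<in> U \<Longrightarrow> inv_into U \<phi> (\<phi> p) = p"
    by (auto simp: homeomorphism_def intro!: inj_on_inverseI[of _ "inv_into U \<phi>"])
qed

lemma chart_cover: obtains U \<phi> where "(U, \<phi>) \<in> A" "p \<in> U"
proof -
  have "p \<in> (\<Union>c\<in>A. fst c)"
    using atlas unfolding Ck_atlas_def by auto
  then show ?thesis
    using that by auto
qed

lemma open_chart_image:
  assumes "(U, \<phi>) \<in> A" "open W"
  shows "open (\<phi> ` (U \<inter> W))"
proof -
  have "\<phi> ` (U \<inter> W) = (\<phi> ` U) \<inter> inv_into U \<phi> -` W"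
  proof (intro equalityI subsetI)
    fix z assume "z \<in> \<phi> ` (U \<inter> W)"
    then show "z \<in> (\<phi> ` U) \<inter> inv_into U \<phi> -` W"
      using chartD(6)[OF assms(1)] by auto
  next
    fix z assume "z \<in> (\<phi> ` U) \<inter> inv_into U \<phi> -` W"
    then show "z \<in> \<phi> ` (U \<inter> W)"
      by (metis IntE IntI f_inv_into_f imageI inv_into_into vimageD)
  qed
  then show ?thesis
    using continuous_open_preimage[OF chartD(5,2)[OF assms(1)] assms(2)] by simp
qed

text \<open>Continuity of the derivative is stated direction by direction, the form in which
  \<open>Ck_on\<close> provides it.\<close>

lemma transition:
  assumes "(U, \<phi>) \<in> A" "(U', \<psi>) \<in> A" "p \<in> U" "p \<in> U'"
  shows transition_deriv: "(\<psi> \<circ> inv_into U \<phi> has_derivative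
        frechet_derivative (\<psi> \<circ> inv_into U \<phi>) (at (\<phi> p))) (at (\<phi> p))"
    and transition_cont: "isCont (\<lambda>z. frechet_derivative (\<psi> \<circ> inv_into U \<phi>) (at z) v) (\<phi> p)"
proof -
  have ck: "Ck_on (Suc r) (\<phi> ` (U \<inter> U')) (\<psi> \<circ> inv_into U \<phi>)"
    using atlas assms(1,2) unfolding Ck_atlas_def Suc_eq_plus1 by (fast dest: bspec)
  have p: "\<phi> p \<in> \<phi> ` (U \<inter> U')"
    using assms by auto
  show "(\<psi> \<circ> inv_into U \<phi> has_derivative
        frechet_derivative (\<psi> \<circ> inv_into U \<phi>) (at (\<phi> p))) (at (\<phi> p))"
    using ck p frechet_derivative_works by (metis Ck_on.simps(2))
  have "Ck_on r (\<phi> ` (U \<inter> U')) (\<lambda>z. frechet_derivative (\<psi> \<circ> inv_into U \<phi>) (at z) v)"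
    using ck by simp
  then have "(\<lambda>z. frechet_derivative (\<psi> \<circ> inv_into U \<phi>) (at z) v) differentiable (at (\<phi> p))"
    using p r_ge_2 by (cases r) auto
  then show "isCont (\<lambda>z. frechet_derivative (\<psi> \<circ> inv_into U \<phi>) (at z) v) (\<phi> p)"
    using differentiable_imp_continuous_within by blast
qed

lemma transition_linear:
  assumes "(U, \<phi>) \<in> A" "(U', \<psi>) \<in> A" "p \<in> U" "p \<in> U'"
  shows "linear (frechet_derivative (\<psi> \<circ> inv_into U \<phi>) (at (\<phi> p)))"
  using transition_deriv[OF assms] has_derivative_linear by blast

lemma tangent_vector_scale:
  assumes "(U, \<phi>) \<in> A" "p \<in> U"
  shows "tangent_vector A p (U, \<phi>) (k *\<^sub>R u) = (\<lambda>c. k *\<^sub>R tangent_vector A p (U, \<phi>) u c)"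
proof
  fix c :: "('q, 'm) chart"
  obtain U' \<psi> where c: "c = (U', \<psi>)" by fastforce
  show "tangent_vector A p (U, \<phi>) (k *\<^sub>R u) c = k *\<^sub>R tangent_vector A p (U, \<phi>) u c"
    using transition_linear[OF assms(1) _ assms(2)] 
    by (auto simp: tangent_vector_def c linear_cmul)
qed

lemma tangent_vector_0:
  assumes "(U, \<phi>) \<in> A" "p \<in> U"
  shows "tangent_vector A p (U, \<phi>) 0 = (\<lambda>c. 0)"
  using tangent_vector_scale[OF assms, of 0 0] by simp

text \<open>A relational substitute for \<open>velocity\<close>: it passes to subsets, unions and
  reparametrizations without any uniqueness condition on \<open>J\<close>, and it leaves
  \<open>X\<close> free at charts that do not contain the point.\<close>

definition has_velocity :: "real set \<Rightarrow> (real \<Rightarrow> 'q) \<Rightarrow> (real \<Rightarrow> ('q, 'm) tvec) \<Rightarrow> bool" where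
  "has_velocity J q X \<longleftrightarrow> continuous_on J q \<and>
     (\<forall>s\<in>J. \<forall>U \<phi>. (U, \<phi>) \<in> A \<and> q s \<in> U \<longrightarrow>
        (\<phi> \<circ> q has_vector_derivative X s (U, \<phi>)) (at s within J) \<and>
        continuous (at s within J) (\<lambda>s. X s (U, \<phi>)))"

lemma C1_curve_has_velocity:
  assumes "C1_curve A J q" "nondeg J"
  shows "has_velocity J q (velocity A J q)"
proof -
  have q: "continuous_on J q"
    using assms(1) unfolding C1_curve_def by auto
  have "(\<phi> \<circ> q has_vector_derivative velocity A J q s (U, \<phi>)) (at s within J) \<and>
        continuous (at s within J) (\<lambda>s. velocity A J q s (U, \<phi>))"
    if c: "(U, \<phi>) \<in> A" "q s \<in> U" "s \<in> J" for s U \<phi>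
  proof -
    let ?J = "{s \<in> J. q s \<in> U}"
    obtain f' where f': "continuous_on ?J f'" 
      "\<And>s. s \<in> ?J \<Longrightarrow> (\<phi> \<circ> q has_vector_derivative f' s) (at s within ?J)"
      using assms(1) c unfolding C1_curve_def C1_on_def by fast
    have at: "at s within ?J = at s within J" if "s \<in> J" "q s \<in> U" for s
      using at_within_preimage[OF q chartD(1)[OF c(1)] that] .
    have d: "(\<phi> \<circ> q has_vector_derivative f' s) (at s within J)" if "s \<in> J" "q s \<in> U" for s
      using f'(2)[of s] at[OF that] that by auto
    have v: "velocity A J q s (U, \<phi>) = f' s" if "s \<in> J" "q s \<in> U" for s
      using vector_derivative_within[OF nondeg_not_bot[OF assms(2)] d[OF that]] that c
      by (simp add: velocity_def)
    have "continuous_on ?J (\<lambda>s. velocity A J q s (U, \<phi>))"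
      using f'(1) by (rule continuous_on_eq) (use v in auto)
    then have "continuous (at s within ?J) (\<lambda>s. velocity A J q s (U, \<phi>))"
      using c continuous_on_eq_continuous_within by blast
    then show ?thesis
      using d[of s] v[of s] at[of s] c by auto
  qed
  then show ?thesis
    using q unfolding has_velocity_def by blast
qed

lemma has_velocity_C1_curve:
  assumes "has_velocity J q X"
  shows "C1_curve A J q"
proof -
  have q: "continuous_on J q"
    using assms unfolding has_velocity_def by auto
  have "C1_on {s \<in> J. q s \<in> U} (\<phi> \<circ> q)" if c: "(U, \<phi>) \<in> A" for U \<phi>
    unfolding C1_on_def
  proof (intro exI conjI ballI)
    let ?J = "{s \<in> J. q s \<in> U}"
    have at: "at s within ?J = at s within J" if "s \<in> ?J" for s
      using at_within_preimage[OF q chartD(1)[OF c]] that by auto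
    show "(\<phi> \<circ> q has_vector_derivative X s (U, \<phi>)) (at s within ?J)" if "s \<in> ?J" for s
      using at[OF that] that assms c unfolding has_velocity_def by auto
    show "continuous_on ?J (\<lambda>s. X s (U, \<phi>))"
      unfolding continuous_on_eq_continuous_within
      using at assms c unfolding has_velocity_def by auto
  qed
  then show ?thesis
    using q unfolding C1_curve_def by auto
qed

lemma has_velocity_unique:
  assumes "has_velocity J q X" "nondeg J" "s \<in> J" "c \<in> A" "q s \<in> fst c"
  shows "velocity A J q s c = X s c"
proof -
  obtain U \<phi> where c: "c = (U, \<phi>)" by fastforce
  show ?thesis
    using vector_derivative_within[OF nondeg_not_bot[OF assms(2,3)], of "\<phi> \<circ> q" "X s c"] assms
    unfolding has_velocity_def velocity_def by (auto simp: c)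
qed

lemma has_velocity_eq_velocity:
  assumes "has_velocity J q X" "nondeg J" "s \<in> J"
    and "\<And>c. \<not> (c \<in> A \<and> q s \<in> fst c) \<Longrightarrow> X s c = 0"
  shows "velocity A J q s = X s"
  using has_velocity_unique[OF assms(1-3)] assms(4) by (auto simp: velocity_def fun_eq_iff)

text \<open>The chain rule through the transition maps. The assumptions on \<open>a\<close> and
  \<open>b\<close> concern vectors given by \<open>tangent_vector\<close>, and this brings
  velocities into that form.\<close>

lemma velocity_tangent:
  assumes "C1_curve A J q" "nondeg J" "s \<in> J" "(U, \<phi>) \<in> A" "q s \<in> U"
  shows "velocity A J q s = tangent_vector A (q s) (U, \<phi>) (velocity A J q s (U, \<phi>))"
proof
  fix c :: "('q, 'm) chart"
  obtain U' \<psi> where c: "c = (U', \<psi>)" by fastforce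
  note hv = C1_curve_has_velocity[OF assms(1,2)]
  show "velocity A J q s c = tangent_vector A (q s) (U, \<phi>) (velocity A J q s (U, \<phi>)) c"
  proof (cases "c \<in> A \<and> q s \<in> U'")
    case False
    then show ?thesis
      by (auto simp: velocity_def tangent_vector_def c)
  next
    case True
    let ?D = "frechet_derivative (\<psi> \<circ> inv_into U \<phi>) (at (\<phi> (q s)))"
    let ?J = "{s \<in> J. q s \<in> U}"
    have q: "continuous_on J q"
      using assms(1) unfolding C1_curve_def by auto
    have at: "at s within ?J = at s within J"
      using at_within_preimage[OF q chartD(1)[OF assms(4)] assms(3,5)] .
    have 1: "(\<phi> \<circ> q has_vector_derivative velocity A J q s (U, \<phi>)) (at s within ?J)"
      using hv assms at unfolding has_velocity_def by auto
    have "(\<psi> \<circ> inv_into U \<phi> has_derivative ?D) (at ((\<phi> \<circ> q) s))"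
      using transition_deriv[OF assms(4) _ assms(5)] True c by auto
    then have "((\<psi> \<circ> inv_into U \<phi>) \<circ> (\<phi> \<circ> q) has_vector_derivative ?D (velocity A J q s (U, \<phi>))) 
        (at s within ?J)"
      by (rule vector_derivative_diff_chain_within[OF 1 has_derivative_at_withinI])
    then have "(\<psi> \<circ> q has_vector_derivative ?D (velocity A J q s (U, \<phi>))) (at s within ?J)"
      by (rule has_vector_derivative_transform[rotated -1])
         (use assms chartD(6)[OF assms(4)] in auto)
    then have "vector_derivative (\<psi> \<circ> q) (at s within J) = ?D (velocity A J q s (U, \<phi>))"
      using vector_derivative_within[OF nondeg_not_bot[OF assms(2,3)]] at by metis
    then show ?thesis
      using True by (auto simp: velocity_def tangent_vector_def c)
  qed
qed

lemma has_velocity_subset: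
  assumes "has_velocity J q X" "J' \<subseteq> J"
  shows "has_velocity J' q X"
  using assms unfolding has_velocity_def
  by (meson continuous_on_subset continuous_within_subset has_vector_derivative_within_subset subsetD)

lemma velocity_subset:
  assumes "C1_curve A J q" "nondeg J" "J' \<subseteq> J" "nondeg J'" "s \<in> J'"
  shows "velocity A J' q s = velocity A J q s"
  by (rule has_velocity_eq_velocity[OF has_velocity_subset[OF C1_curve_has_velocity[OF assms(1,2)]
        assms(3)] assms(4,5)]) (auto simp: velocity_def)

lemma C1_curve_subset:
  assumes "C1_curve A J q" "nondeg J" "J' \<subseteq> J"
  shows "C1_curve A J' q"
  using has_velocity_C1_curve has_velocity_subset[OF C1_curve_has_velocity[OF assms(1,2)] assms(3)] 
  by blast

lemma has_velocity_reparam: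
  assumes q: "has_velocity J q X" and k: "k ` J' \<subseteq> J"
    and k': "\<And>s. s \<in> J' \<Longrightarrow> (k has_real_derivative k' s) (at s within J')"
    and ck': "continuous_on J' k'"
  shows "has_velocity J' (q \<circ> k) (\<lambda>s c. k' s *\<^sub>R X (k s) c)"
  unfolding has_velocity_def
proof (intro conjI ballI allI impI; (elim conjE)?)
  have ck: "continuous_on J' k"
    using k' DERIV_continuous_on by blast
  show "continuous_on J' (q \<circ> k)"
    using q k ck unfolding has_velocity_def by (meson continuous_on_compose continuous_on_subset)
  fix s U \<phi> assume s: "s \<in> J'" "(U, \<phi>) \<in> A" "(q \<circ> k) s \<in> U"
  have ks: "k s \<in> J"
    using s k by auto
  have "(\<phi> \<circ> q has_vector_derivative X (k s) (U, \<phi>)) (at (k s) within k ` J')"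
    using q ks s has_vector_derivative_within_subset[OF _ k] unfolding has_velocity_def 
    by (metis comp_apply)
  then have "((\<phi> \<circ> q) \<circ> k has_vector_derivative k' s *\<^sub>R X (k s) (U, \<phi>)) (at s within J')"
    using k'[OF s(1)] vector_diff_chain_within has_real_derivative_iff_has_vector_derivative by metis
  then show "(\<phi> \<circ> (q \<circ> k) has_vector_derivative k' s *\<^sub>R X (k s) (U, \<phi>)) (at s within J')"
    by (simp add: comp_assoc)
  have "continuous (at (k s) within J) (\<lambda>s. X s (U, \<phi>))"
    using q ks s unfolding has_velocity_def by auto
  then have "continuous (at (k s) within k ` J') (\<lambda>s. X s (U, \<phi>))"
    using k continuous_within_subset by blast
  moreover have "continuous (at s within J') k"
    using ck s by (simp add: continuous_on_eq_continuous_within)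
  ultimately have "continuous (at s within J') (\<lambda>s. X (k s) (U, \<phi>))"
    using continuous_within_compose2 by blast
  then show "continuous (at s within J') (\<lambda>s. k' s *\<^sub>R X (k s) (U, \<phi>))"
    using ck' s by (auto simp: continuous_on_eq_continuous_within intro!: continuous_intros)
qed

lemma has_velocity_glue:
  assumes 1: "has_velocity S q X" and 2: "has_velocity S' q X" and cl: "closed S" "closed S'"
  shows "has_velocity (S \<union> S') q X"
  unfolding has_velocity_def
proof (intro conjI ballI allI impI; (elim conjE)?)
  show q: "continuous_on (S \<union> S') q"
    using 1 2 cl unfolding has_velocity_def by (auto intro: continuous_on_closed_Un)
  fix s U \<phi> assume s: "s \<in> S \<union> S'" "(U, \<phi>) \<in> A" "q s \<in> U"
  \<comment> \<open>Outside a closed set the filter within it is trivial and both conditions are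
    vacuous, so only the pieces that contain \<open>s\<close> count.\<close>
  have bot: "at s within S'' = bot" if "s \<notin> S''" "closed S''" for S''
    using that by (metis at_within_eq_bot_iff closed_limpt closure_closed trivial_limit_within)
  have "(\<phi> \<circ> q has_vector_derivative X s (U, \<phi>)) (at s within S'') 
      \<and> continuous (at s within S'') (\<lambda>s. X s (U, \<phi>))" if "S'' = S \<or> S'' = S'" for S''
  proof (cases "s \<in> S''")
    case True
    then show ?thesis
      using that 1 2 s unfolding has_velocity_def by auto
  next
    case False
    then have "at s within S'' = bot"
      using that cl bot by auto
    then show ?thesis
      by (simp add: has_vector_derivative_def has_derivative_def continuous_def bounded_linear_scaleR_left)
  qed
  then show "(\<phi> \<circ> q has_vector_derivative X s (U, \<phi>)) (at s within S \<union> S')"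
    "continuous (at s within S \<union> S') (\<lambda>s. X s (U, \<phi>))"
    by (auto intro: has_vector_derivative_within_Un simp: continuous_within Lim_within_Un)
qed

lemma has_velocity_cong:
  assumes "has_velocity J q X" "\<And>s. s \<in> J \<Longrightarrow> q s = q' s" 
    "\<And>s c. s \<in> J \<Longrightarrow> c \<in> A \<Longrightarrow> q s \<in> fst c \<Longrightarrow> X s c = X' s c"
  shows "has_velocity J q' X'"
  unfolding has_velocity_def
proof (intro conjI ballI allI impI; (elim conjE)?)
  have q: "continuous_on J q"
    using assms unfolding has_velocity_def by auto
  then show "continuous_on J q'"
    using assms(2) continuous_on_cong by (metis (no_types, lifting))
  fix s U \<phi> assume s: "s \<in> J" "(U, \<phi>) \<in> A" "q' s \<in> U"
  then have qs: "q s \<in> U"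
    using assms(2) by auto
  have h: "(\<phi> \<circ> q has_vector_derivative X s (U, \<phi>)) (at s within J)" 
    "continuous (at s within J) (\<lambda>s. X s (U, \<phi>))"
    using assms(1) s qs unfolding has_velocity_def by auto
  show "(\<phi> \<circ> q' has_vector_derivative X' s (U, \<phi>)) (at s within J)"
    using has_vector_derivative_transform[OF s(1) _ h(1), of "\<phi> \<circ> q'"] assms(2,3) s qs by auto
  let ?J = "{s \<in> J. q s \<in> U}"
  have at: "at s within ?J = at s within J"
    using at_within_preimage[OF q chartD(1)[OF s(2)] s(1) qs] .
  have "continuous (at s within ?J) (\<lambda>s. X' s (U, \<phi>))"
    using continuous_transform_within[of s ?J "\<lambda>s. X s (U, \<phi>)" 1 "\<lambda>s. X' s (U, \<phi>)"] 
      h(2) at s qs assms(3) by auto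
  then show "continuous (at s within J) (\<lambda>s. X' s (U, \<phi>))"
    by (simp add: at)
qed

lemma has_velocity_chart:
  assumes c: "(U, \<phi>) \<in> A" and x: "x ` J \<subseteq> \<phi> ` U"
    and x': "\<And>s. s \<in> J \<Longrightarrow> (x has_vector_derivative x' s) (at s within J)"
    and cx': "continuous_on J x'"
  shows "has_velocity J (inv_into U \<phi> \<circ> x) (\<lambda>s. tangent_vector A (inv_into U \<phi> (x s)) (U, \<phi>) (x' s))"
  unfolding has_velocity_def
proof (intro conjI ballI allI impI; (elim conjE)?)
  have cx: "continuous_on J x"
    using x' continuous_on_vector_derivative by blast
  show cq: "continuous_on J (inv_into U \<phi> \<circ> x)"
    using chartD(5)[OF c] cx x by (meson continuous_on_compose continuous_on_subset)
  fix s U' \<psi> assume s: "s \<in> J" "(U', \<psi>) \<in> A" "(inv_into U \<phi> \<circ> x) s \<in> U'"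
  let ?q = "inv_into U \<phi> \<circ> x"
  let ?D = "\<lambda>z. frechet_derivative (\<psi> \<circ> inv_into U \<phi>) (at z)"
  have qU: "?q s \<in> U" and pq: "\<phi> (?q s) = x s" if "s \<in> J" for s
    using x that by (auto simp: inv_into_into f_inv_into_f image_subset_iff)
  have tv: "tangent_vector A (?q s) (U, \<phi>) u (U', \<psi>) = ?D (x s) u" if "s \<in> J" "?q s \<in> U'" for s u
    using pq that s by (simp add: tangent_vector_def)
  have "(\<psi> \<circ> inv_into U \<phi> has_derivative ?D (x s)) (at (x s))"
    using transition_deriv[OF c s(2) qU[OF s(1)] s(3)] pq[OF s(1)] by simp
  then have "((\<psi> \<circ> inv_into U \<phi>) \<circ> x has_vector_derivative ?D (x s) (x' s)) (at s within J)"
    by (rule vector_derivative_diff_chain_within[OF x'[OF s(1)] has_derivative_at_withinI])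
  then show "(\<psi> \<circ> ?q has_vector_derivative 
      tangent_vector A (inv_into U \<phi> (x s)) (U, \<phi>) (x' s) (U', \<psi>)) (at s within J)"
    using tv[OF s(1,3)] by (simp add: comp_assoc)
  let ?J = "{s \<in> J. ?q s \<in> U'}"
  have at: "at s within ?J = at s within J"
    using at_within_preimage[OF cq chartD(1)[OF s(2)] s(1,3)] .
  have Dc: "continuous (at s within ?J) (\<lambda>s. ?D (x s) v)" for v
  proof -
    have "isCont (\<lambda>z. ?D z v) (x s)"
      using transition_cont[OF c s(2) qU[OF s(1)] s(3)] pq[OF s(1)] by simp
    moreover have "continuous (at s within ?J) x"
      unfolding at using cx s by (simp add: continuous_on_eq_continuous_within)
    ultimately show ?thesis
      using isCont_o2 continuous_within_compose3 by blast
  qed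
  have cx's: "continuous (at s within ?J) x'"
    unfolding at using cx' s by (simp add: continuous_on_eq_continuous_within)
  \<comment> \<open>Continuity is known for the derivative applied to a fixed vector; expanding
    \<open>x' s\<close> in the basis extends it to a moving one.\<close>
  have "continuous (at s within ?J) (\<lambda>s. \<Sum>b\<in>Basis. (x' s \<bullet> b) *\<^sub>R ?D (x s) b)"
    using Dc cx's by (intro continuous_intros)
  moreover have "(\<Sum>b\<in>Basis. (x' s \<bullet> b) *\<^sub>R ?D (x s) b) = 
      tangent_vector A (inv_into U \<phi> (x s)) (U, \<phi>) (x' s) (U', \<psi>)" if "s \<in> ?J" for s
  proof -
    have "linear (?D (x s))"
      using transition_linear[OF c s(2) qU, of s] pq[of s] that by simp
    then have "(\<Sum>b\<in>Basis. (x' s \<bullet> b) *\<^sub>R ?D (x s) b) = ?D (x s) (\<Sum>b\<in>Basis. (x' s \<bullet> b) *\<^sub>R b)"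
      by (simp add: linear_sum linear_cmul)
    then show ?thesis
      using tv[of s] that by (simp add: euclidean_representation)
  qed
  ultimately have "continuous (at s within ?J) 
      (\<lambda>s. tangent_vector A (inv_into U \<phi> (x s)) (U, \<phi>) (x' s) (U', \<psi>))"
    using continuous_transform_within[of s ?J _ 1] s by fastforce
  then show "continuous (at s within J) 
      (\<lambda>s. tangent_vector A (inv_into U \<phi> (x s)) (U, \<phi>) (x' s) (U', \<psi>))"
    by (simp only: at)
qed

end

subsection \<open>The metric and the potentials in coordinates\<close>

lemma Ck_on_imp_continuous_on: "Ck_on k S f \<Longrightarrow> continuous_on S f"
  by (cases k) (auto simp: continuous_at_imp_continuous_on differentiable_imp_continuous_within)

context gravitational_wave
begin

text \<open>Only the quadratic form is kept: the Lagrangian and the squared length of a tangent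
  vector of M involve \<open>a\<close> on equal arguments.\<close>

definition acoord :: "'q set \<Rightarrow> ('q \<Rightarrow> 'm) \<Rightarrow> real \<Rightarrow> 'm \<Rightarrow> 'm \<Rightarrow> real" where
  "acoord U \<phi> t z u = (let p = inv_into U \<phi> z; v = tangent_vector A p (U, \<phi>) u in a t p v v)"

definition bcoord :: "'q set \<Rightarrow> ('q \<Rightarrow> 'm) \<Rightarrow> real \<Rightarrow> 'm \<Rightarrow> 'm \<Rightarrow> real" where
  "bcoord U \<phi> t z u = (let p = inv_into U \<phi> z in b t p (tangent_vector A p (U, \<phi>) u))"

definition Vcoord :: "'q set \<Rightarrow> ('q \<Rightarrow> 'm) \<Rightarrow> real \<Rightarrow> 'm \<Rightarrow> real" where
  "Vcoord U \<phi> t z = V t (inv_into U \<phi> z)"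

text \<open>The smoothness assumptions fix the vectors to which \<open>a\<close> is applied. The
  basis expansion turns \<open>u\<close> into polynomial coefficients and so gives joint continuity
  in \<open>(t, z, u)\<close>.\<close>

lemma acoord_expand:
  assumes "(U, \<phi>) \<in> A" "t \<in> T" "z \<in> \<phi> ` U"
  shows "acoord U \<phi> t z u = (\<Sum>(i,j)\<in>Basis\<times>Basis. (u \<bullet> i) * (u \<bullet> j) * 
     (let p = inv_into U \<phi> z in a t p (tangent_vector A p (U, \<phi>) i) (tangent_vector A p (U, \<phi>) j)))"
proof -
  let ?p = "inv_into U \<phi> z"
  let ?h = "\<lambda>u v. a t ?p (tangent_vector A ?p (U, \<phi>) u) (tangent_vector A ?p (U, \<phi>) v)"
  have bil: "bilinear ?h"
    using a_bilinear[OF assms(2,1)] assms(3) inv_into_into by (metis fst_conv)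
  have "acoord U \<phi> t z u = ?h (\<Sum>i\<in>Basis. (u \<bullet> i) *\<^sub>R i) (\<Sum>j\<in>Basis. (u \<bullet> j) *\<^sub>R j)"
    by (simp add: acoord_def euclidean_representation Let_def)
  also have "\<dots> = (\<Sum>(i,j)\<in>Basis\<times>Basis. ?h ((u \<bullet> i) *\<^sub>R i) ((u \<bullet> j) *\<^sub>R j))"
    by (rule bilinear_sum[OF bil])
  also have "\<dots> = (\<Sum>(i,j)\<in>Basis\<times>Basis. (u \<bullet> i) * (u \<bullet> j) * ?h i j)"
    by (rule sum.cong) (auto simp: bilinear_lmul[OF bil] bilinear_rmul[OF bil])
  finally show ?thesis
    by (simp add: Let_def)
qed

lemma bcoord_expand:
  assumes "(U, \<phi>) \<in> A" "t \<in> T" "z \<in> \<phi> ` U"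
  shows "bcoord U \<phi> t z u = (\<Sum>i\<in>Basis. (u \<bullet> i) * 
     (let p = inv_into U \<phi> z in b t p (tangent_vector A p (U, \<phi>) i)))"
proof -
  let ?p = "inv_into U \<phi> z"
  let ?h = "\<lambda>u. b t ?p (tangent_vector A ?p (U, \<phi>) u)"
  have lin: "linear ?h"
    using b_linear[OF assms(2,1)] assms(3) inv_into_into by (metis fst_conv)
  have "bcoord U \<phi> t z u = ?h (\<Sum>i\<in>Basis. (u \<bullet> i) *\<^sub>R i)"
    by (simp add: bcoord_def euclidean_representation Let_def)
  also have "\<dots> = (\<Sum>i\<in>Basis. (u \<bullet> i) * ?h i)"
    by (subst linear_sum[OF lin]) (simp add: linear_cmul[OF lin])
  finally show ?thesis
    by (simp add: Let_def)
qed

lemma acoord_continuous_on: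
  assumes "(U, \<phi>) \<in> A"
  shows "continuous_on (T \<times> \<phi> ` U \<times> UNIV) (\<lambda>(t, z, u). acoord U \<phi> t z u)"
proof -
  let ?S = "T \<times> \<phi> ` U \<times> (UNIV :: 'm set)"
  let ?f = "\<lambda>i j x. (let p = inv_into U \<phi> (snd x) in 
      a (fst x) p (tangent_vector A p (U, \<phi>) i) (tangent_vector A p (U, \<phi>) j))"
  have "continuous_on (T \<times> \<phi> ` U) (?f i j)" for i j
    using Ck_on_imp_continuous_on[OF a_Ck[OF assms, of i j]] by (simp add: case_prod_beta')
  then have c: "continuous_on ?S (\<lambda>x. ?f i j (fst x, fst (snd x)))" for i j
    by (rule continuous_on_compose2) (auto intro!: continuous_intros)
  have "continuous_on ?S (\<lambda>x. \<Sum>(i,j)\<in>Basis\<times>Basis. (snd (snd x) \<bullet> i) * (snd (snd x) \<bullet> j) * 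
      ?f i j (fst x, fst (snd x)))"
    unfolding case_prod_beta' by (intro continuous_intros c)
  then show ?thesis
    by (rule continuous_on_eq) (auto simp: acoord_expand[OF assms])
qed

lemma bcoord_continuous_on:
  assumes "(U, \<phi>) \<in> A"
  shows "continuous_on (T \<times> \<phi> ` U \<times> UNIV) (\<lambda>(t, z, u). bcoord U \<phi> t z u)"
proof -
  let ?S = "T \<times> \<phi> ` U \<times> (UNIV :: 'm set)"
  let ?f = "\<lambda>i x. (let p = inv_into U \<phi> (snd x) in b (fst x) p (tangent_vector A p (U, \<phi>) i))"
  have "continuous_on (T \<times> \<phi> ` U) (?f i)" for i
    using Ck_on_imp_continuous_on[OF b_Ck[OF assms, of i]] by (simp add: case_prod_beta')
  then have c: "continuous_on ?S (\<lambda>x. ?f i (fst x, fst (snd x)))" for i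
    by (rule continuous_on_compose2) (auto intro!: continuous_intros)
  have "continuous_on ?S (\<lambda>x. \<Sum>i\<in>Basis. (snd (snd x) \<bullet> i) * ?f i (fst x, fst (snd x)))"
    by (intro continuous_intros c)
  then show ?thesis
    by (rule continuous_on_eq) (auto simp: bcoord_expand[OF assms])
qed

lemma Vcoord_continuous_on:
  assumes "(U, \<phi>) \<in> A"
  shows "continuous_on (T \<times> \<phi> ` U) (\<lambda>(t, z). Vcoord U \<phi> t z)"
  using Ck_on_imp_continuous_on[OF V_Ck[OF assms]] by (simp add: Vcoord_def)

lemma acoord_scale:
  assumes "(U, \<phi>) \<in> A" "t \<in> T" "z \<in> \<phi> ` U"
  shows "acoord U \<phi> t z (k *\<^sub>R u) = k\<^sup>2 * acoord U \<phi> t z u"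
  by (simp add: acoord_expand[OF assms] sum_distrib_left case_prod_beta' power2_eq_square ac_simps)

lemma bcoord_scale:
  assumes "(U, \<phi>) \<in> A" "t \<in> T" "z \<in> \<phi> ` U"
  shows "bcoord U \<phi> t z (k *\<^sub>R u) = k * bcoord U \<phi> t z u"
  by (simp add: bcoord_expand[OF assms] sum_distrib_left ac_simps)

lemma acoord_pos:
  assumes "(U, \<phi>) \<in> A" "t \<in> T" "z \<in> \<phi> ` U" "u \<noteq> 0"
  shows "acoord U \<phi> t z u > 0"
  using a_positive[OF assms(2,1) _ assms(4), of "inv_into U \<phi> z"] inv_into_into[OF assms(3)]
  by (simp add: acoord_def Let_def)

text \<open>By homogeneity, bounds on the unit sphere give bounds for all vectors.\<close>

lemma acoord_unit: 
  assumes "(U, \<phi>) \<in> A" "t \<in> T" "z \<in> \<phi> ` U"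
  obtains e where "norm e = 1" "u = norm u *\<^sub>R e" 
    "acoord U \<phi> t z u = (norm u)\<^sup>2 * acoord U \<phi> t z e" "bcoord U \<phi> t z u = norm u * bcoord U \<phi> t z e"
    "\<And>t'. t' \<in> T \<Longrightarrow> acoord U \<phi> t' z u = (norm u)\<^sup>2 * acoord U \<phi> t' z e"
    "\<And>t'. t' \<in> T \<Longrightarrow> bcoord U \<phi> t' z u = norm u * bcoord U \<phi> t' z e"
proof -
  obtain e :: 'm where e: "norm e = 1" "u = norm u *\<^sub>R e"
  proof (cases "u = 0")
    case True
    then show ?thesis
      using that[of "SOME i. i \<in> Basis"] by (simp add: some_in_eq)
  next
    case False
    then show ?thesis
      using that[of "u /\<^sub>R norm u"] by simp
  qed
  then show ?thesis
    using that[of e] acoord_scale[OF assms(1) _ assms(3), of _ "norm u" e] 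
      bcoord_scale[OF assms(1) _ assms(3), of _ "norm u" e] assms(2) by metis
qed

lemma coord_bounds:
  assumes c: "(U, \<phi>) \<in> A" and K1: "compact K1" "K1 \<subseteq> T" and K2: "compact K2" "K2 \<subseteq> \<phi> ` U"
  obtains k C where "k > 0" "C \<ge> 0" 
    "\<And>t z u. t \<in> K1 \<Longrightarrow> z \<in> K2 \<Longrightarrow> k * (norm u)\<^sup>2 \<le> acoord U \<phi> t z u"
    "\<And>t z u. t \<in> K1 \<Longrightarrow> z \<in> K2 \<Longrightarrow> acoord U \<phi> t z u \<le> C * (norm u)\<^sup>2"
    "\<And>t z u. t \<in> K1 \<Longrightarrow> z \<in> K2 \<Longrightarrow> \<bar>bcoord U \<phi> t z u\<bar> \<le> C * norm u"
    "\<And>t z. t \<in> K1 \<Longrightarrow> z \<in> K2 \<Longrightarrow> \<bar>Vcoord U \<phi> t z\<bar> \<le> C"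
proof -
  let ?K = "K1 \<times> K2 \<times> sphere (0::'m) 1"
  have K: "compact ?K" "?K \<subseteq> T \<times> \<phi> ` U \<times> UNIV"
    using K1 K2 by (auto intro!: compact_Times compact_sphere)
  have ca: "continuous_on ?K (\<lambda>(t, z, u). acoord U \<phi> t z u)"
    using acoord_continuous_on[OF c] K continuous_on_subset by blast
  have cb: "continuous_on ?K (\<lambda>(t, z, u). bcoord U \<phi> t z u)"
    using bcoord_continuous_on[OF c] K continuous_on_subset by blast
  have cV: "continuous_on (K1 \<times> K2) (\<lambda>(t, z). Vcoord U \<phi> t z)"
    using Vcoord_continuous_on[OF c] K1 K2 by (meson continuous_on_subset Sigma_mono)
  have bd: "\<exists>B>0. \<forall>x\<in>S. norm (f x) \<le> B" if "compact S" "continuous_on S f" 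
    for S and f :: "'z::topological_space \<Rightarrow> real"
    using compact_imp_bounded[OF compact_continuous_image[OF that(2,1)]] 
    unfolding bounded_pos by auto
  have pos: "acoord U \<phi> t z u > 0" if "(t, z, u) \<in> ?K" for t z u
  proof -
    have "u \<noteq> 0" "t \<in> T" "z \<in> \<phi> ` U"
      using that K1 K2 by auto
    then show ?thesis
      using acoord_pos[OF c] by blast
  qed
  have nz: "\<forall>x\<in>?K. (case x of (t, z, u) \<Rightarrow> acoord U \<phi> t z u) \<noteq> 0"
  proof
    fix x assume x: "x \<in> ?K"
    obtain t z u where "x = (t, z, u)"
      by (rule prod_cases3)
    then show "(case x of (t, z, u) \<Rightarrow> acoord U \<phi> t z u) \<noteq> 0"
      using pos[of t z u] x by simp
  qed
  \<comment> \<open>An upper bound \<open>B0\<close> for \<open>1 / acoord\<close> on the compact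
    set gives the lower bound \<open>1 / B0\<close> for \<open>acoord\<close>.\<close>
  have "continuous_on ?K (\<lambda>x. 1 / (case x of (t, z, u) \<Rightarrow> acoord U \<phi> t z u))"
    by (rule continuous_on_divide[OF continuous_on_const ca nz])
  then obtain B0 where B0: "B0 > 0" "\<And>x. x \<in> ?K \<Longrightarrow> norm (1 / (case x of (t, z, u) \<Rightarrow> acoord U \<phi> t z u)) \<le> B0"
    using bd[OF K(1)] by meson
  obtain B1 where B1: "B1 > 0" "\<And>x. x \<in> ?K \<Longrightarrow> norm (case x of (t, z, u) \<Rightarrow> acoord U \<phi> t z u) \<le> B1"
    using bd[OF K(1) ca] by meson
  obtain B2 where B2: "B2 > 0" "\<And>x. x \<in> ?K \<Longrightarrow> norm (case x of (t, z, u) \<Rightarrow> bcoord U \<phi> t z u) \<le> B2"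
    using bd[OF K(1) cb] by meson
  obtain B3 where B3: "B3 > 0" "\<And>x. x \<in> K1 \<times> K2 \<Longrightarrow> norm (case x of (t, z) \<Rightarrow> Vcoord U \<phi> t z) \<le> B3"
    using bd[OF compact_Times[OF K1(1) K2(1)] cV] by meson
  let ?C = "B1 + B2 + B3"
  show ?thesis
  proof (rule that[of "1 / B0" ?C])
    show "1 / B0 > 0" "?C \<ge> 0"
      using B0(1) B1(1) B2(1) B3(1) by auto
    fix t z assume tz: "t \<in> K1" "z \<in> K2"
    then have tz': "t \<in> T" "z \<in> \<phi> ` U"
      using K1 K2 by auto
    show "\<bar>Vcoord U \<phi> t z\<bar> \<le> ?C"
      using B3(2)[of "(t, z)"] tz B1(1) B2(1) by auto
    fix u
    obtain e where e: "norm e = 1" "u = norm u *\<^sub>R e" 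
      "acoord U \<phi> t z u = (norm u)\<^sup>2 * acoord U \<phi> t z e" "bcoord U \<phi> t z u = norm u * bcoord U \<phi> t z e"
      using acoord_unit[OF c tz'] by metis
    have m: "(t, z, e) \<in> ?K"
      using tz e by auto
    have "acoord U \<phi> t z e \<ge> 1 / B0"
      using B0(2)[OF m] pos[OF m] B0(1) by (simp add: field_simps)
    then have "(norm u)\<^sup>2 * (1 / B0) \<le> (norm u)\<^sup>2 * acoord U \<phi> t z e"
      by (intro mult_left_mono) auto
    then show "1 / B0 * (norm u)\<^sup>2 \<le> acoord U \<phi> t z u"
      using e(3) by (simp add: mult.commute)
    have "acoord U \<phi> t z e \<le> ?C"
      using B1(2)[OF m] B2(1) B3(1) by simp
    then have "(norm u)\<^sup>2 * acoord U \<phi> t z e \<le> (norm u)\<^sup>2 * ?C"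
      by (intro mult_left_mono) auto
    then show "acoord U \<phi> t z u \<le> ?C * (norm u)\<^sup>2"
      using e(3) by (simp add: mult.commute)
    have "\<bar>bcoord U \<phi> t z e\<bar> \<le> ?C"
      using B2(2)[OF m] B1(1) B3(1) by simp
    then have "norm u * \<bar>bcoord U \<phi> t z e\<bar> \<le> norm u * ?C"
      by (intro mult_left_mono) auto
    then show "\<bar>bcoord U \<phi> t z u\<bar> \<le> ?C * norm u"
      using e(4) by (simp add: abs_mult mult.commute)
  qed
qed

lemma chart_box:
  assumes c: "(U, \<phi>) \<in> A" and "t0 \<in> T" "z0 \<in> \<phi> ` U"
  obtains \<rho> where "\<rho> > 0" "cball t0 \<rho> \<subseteq> T" "cball z0 \<rho> \<subseteq> \<phi> ` U"
proof -
  obtain r1 r2 where "r1 > 0" "cball t0 r1 \<subseteq> T" "r2 > 0" "cball z0 r2 \<subseteq> \<phi> ` U"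
    using open_contains_cball T_interval(2) chartD(2)[OF c] assms by metis
  moreover have "cball t0 (min r1 r2) \<subseteq> cball t0 r1" "cball z0 (min r1 r2) \<subseteq> cball z0 r2"
    by auto
  ultimately show ?thesis
    using that[of "min r1 r2"] by (meson min_less_iff_conj order_trans)
qed

text \<open>The change of the coefficients in time is bounded in terms of \<open>acoord\<close>
  itself, the quantity that the causality condition controls along a curve. The bounds come from
  uniform continuity on unit vectors and the lower bound of \<open>coord_bounds\<close>.\<close>

lemma coord_local_ratio:
  assumes c: "(U, \<phi>) \<in> A" and t0: "t0 \<in> T" and z0: "z0 \<in> \<phi> ` U" and \<kappa>: "\<kappa> > 0"
  obtains d where "d > 0" "ball t0 d \<subseteq> T" "ball z0 d \<subseteq> \<phi> ` U"
    "\<And>t t' z u. t \<in> ball t0 d \<Longrightarrow> t' \<in> ball t0 d \<Longrightarrow> z \<in> ball z0 d \<Longrightarrow> 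
        acoord U \<phi> t' z u \<le> (1 + \<kappa>) * acoord U \<phi> t z u \<and>
        \<bar>bcoord U \<phi> t' z u - bcoord U \<phi> t z u\<bar> \<le> \<kappa> * (1 + acoord U \<phi> t z u) \<and>
        \<bar>Vcoord U \<phi> t' z - Vcoord U \<phi> t z\<bar> \<le> \<kappa>"
proof -
  obtain \<rho> where \<rho>: "\<rho> > 0" "cball t0 \<rho> \<subseteq> T" "cball z0 \<rho> \<subseteq> \<phi> ` U"
    using chart_box[OF c t0 z0] .
  let ?K1 = "cball t0 \<rho>" and ?K2 = "cball z0 \<rho>"
  obtain k C where k: "k > 0" "\<And>t z u. t \<in> ?K1 \<Longrightarrow> z \<in> ?K2 \<Longrightarrow> k * (norm u)\<^sup>2 \<le> acoord U \<phi> t z u"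
    using coord_bounds[OF c compact_cball \<rho>(2) compact_cball \<rho>(3)] by metis
  \<comment> \<open>The factor \<open>k\<close> turns an error proportional to the square of
    \<open>norm u\<close> into \<open>\<kappa>\<close> times \<open>acoord\<close>; the
    \<open>1\<close> serves the terms free of \<open>u\<close>.\<close>
  define \<kappa>' where "\<kappa>' = \<kappa> * min 1 k"
  have \<kappa>': "\<kappa>' > 0" "\<kappa>' \<le> \<kappa> * k" "\<kappa>' \<le> \<kappa>"
    using \<kappa> k(1) by (auto simp: \<kappa>'_def)
  let ?K = "?K1 \<times> ?K2 \<times> sphere (0::'m) 1"
  have K: "compact ?K" "?K \<subseteq> T \<times> \<phi> ` U \<times> UNIV"
    using \<rho> by (auto intro!: compact_Times compact_sphere)
  have "uniformly_continuous_on ?K (\<lambda>(t, z, u). acoord U \<phi> t z u)"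
    using acoord_continuous_on[OF c] K continuous_on_subset compact_uniformly_continuous by blast
  then obtain d1 where d1: "d1 > 0" "\<And>x x'. x \<in> ?K \<Longrightarrow> x' \<in> ?K \<Longrightarrow> dist x' x < d1 \<Longrightarrow>
      dist (case x' of (t, z, u) \<Rightarrow> acoord U \<phi> t z u) (case x of (t, z, u) \<Rightarrow> acoord U \<phi> t z u) < \<kappa>'"
    unfolding uniformly_continuous_on_def using \<kappa>'(1) by meson
  have "uniformly_continuous_on ?K (\<lambda>(t, z, u). bcoord U \<phi> t z u)"
    using bcoord_continuous_on[OF c] K continuous_on_subset compact_uniformly_continuous by blast
  then obtain d2 where d2: "d2 > 0" "\<And>x x'. x \<in> ?K \<Longrightarrow> x' \<in> ?K \<Longrightarrow> dist x' x < d2 \<Longrightarrow>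
      dist (case x' of (t, z, u) \<Rightarrow> bcoord U \<phi> t z u) (case x of (t, z, u) \<Rightarrow> bcoord U \<phi> t z u) < \<kappa>'"
    unfolding uniformly_continuous_on_def using \<kappa>'(1) by meson
  have "?K1 \<times> ?K2 \<subseteq> T \<times> \<phi> ` U" "compact (?K1 \<times> ?K2)"
    using \<rho> by (auto intro: compact_Times)
  then have "uniformly_continuous_on (?K1 \<times> ?K2) (\<lambda>(t, z). Vcoord U \<phi> t z)"
    using Vcoord_continuous_on[OF c] continuous_on_subset compact_uniformly_continuous by blast
  then obtain d3 where d3: "d3 > 0" "\<And>x x'. x \<in> ?K1 \<times> ?K2 \<Longrightarrow> x' \<in> ?K1 \<times> ?K2 \<Longrightarrow> dist x' x < d3 \<Longrightarrow>
      dist (case x' of (t, z) \<Rightarrow> Vcoord U \<phi> t z) (case x of (t, z) \<Rightarrow> Vcoord U \<phi> t z) < \<kappa>'"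
    unfolding uniformly_continuous_on_def using \<kappa>'(1) by meson
  \<comment> \<open>The halves appear because two times in a ball of radius \<open>d\<close> differ
    by less than \<open>2 * d\<close>.\<close>
  define d where "d = Min {\<rho>, d1/2, d2/2, d3/2}"
  have d: "d > 0" "d \<le> \<rho>" "2 * d \<le> d1" "2 * d \<le> d2" "2 * d \<le> d3"
    using \<rho>(1) d1(1) d2(1) d3(1) by (auto simp: d_def)
  show ?thesis
  proof (rule that[of d])
    show "d > 0" "ball t0 d \<subseteq> T" "ball z0 d \<subseteq> \<phi> ` U"
      using d \<rho> by auto
    fix t t' z u assume tz: "t \<in> ball t0 d" "t' \<in> ball t0 d" "z \<in> ball z0 d"
    then have K': "t \<in> ?K1" "t' \<in> ?K1" "z \<in> ?K2"
      using d(2) by auto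
    then have tz': "t \<in> T" "t' \<in> T" "z \<in> \<phi> ` U"
      using \<rho> by auto
    have tt': "dist t' t < 2 * d"
      using tz dist_triangle3[of t' t t0] by simp
    obtain e where e: "norm e = 1" "u = norm u *\<^sub>R e" 
      "\<And>t'. t' \<in> T \<Longrightarrow> acoord U \<phi> t' z u = (norm u)\<^sup>2 * acoord U \<phi> t' z e"
      "\<And>t'. t' \<in> T \<Longrightarrow> bcoord U \<phi> t' z u = norm u * bcoord U \<phi> t' z e"
      using acoord_unit[OF c tz'(1,3), of u] by metis
    have m: "(t, z, e) \<in> ?K" "(t', z, e) \<in> ?K"
      using K' e by auto
    have 1: "\<bar>acoord U \<phi> t' z e - acoord U \<phi> t z e\<bar> < \<kappa>'"
      using d1(2)[OF m(1,2)] tt' d(3) by (simp add: dist_Pair_Pair dist_real_def)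
    have 2: "\<bar>bcoord U \<phi> t' z e - bcoord U \<phi> t z e\<bar> < \<kappa>'"
      using d2(2)[OF m(1,2)] tt' d(4) by (simp add: dist_Pair_Pair dist_real_def)
    have 3: "\<bar>Vcoord U \<phi> t' z - Vcoord U \<phi> t z\<bar> < \<kappa>'"
      using d3(2)[of "(t, z)" "(t', z)"] K' tt' d(5) by (simp add: dist_Pair_Pair dist_real_def)
    have lower: "k * (norm u)\<^sup>2 \<le> acoord U \<phi> t z u"
      using k(2) K' by blast
    have "(norm u)\<^sup>2 * acoord U \<phi> t' z e \<le> (norm u)\<^sup>2 * (acoord U \<phi> t z e + \<kappa>')"
      using 1 by (intro mult_left_mono) auto
    then have "acoord U \<phi> t' z u \<le> acoord U \<phi> t z u + \<kappa>' * (norm u)\<^sup>2"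
      using e(3) tz' by (simp add: algebra_simps)
    also have "\<kappa>' * (norm u)\<^sup>2 \<le> \<kappa> * k * (norm u)\<^sup>2"
      using \<kappa>' by (intro mult_right_mono) auto
    also have "\<kappa> * k * (norm u)\<^sup>2 \<le> \<kappa> * acoord U \<phi> t z u"
      using lower \<kappa> by (simp add: mult.assoc)
    finally have A1: "acoord U \<phi> t' z u \<le> (1 + \<kappa>) * acoord U \<phi> t z u"
      by (simp add: algebra_simps)
    have "\<bar>bcoord U \<phi> t' z u - bcoord U \<phi> t z u\<bar> = norm u * \<bar>bcoord U \<phi> t' z e - bcoord U \<phi> t z e\<bar>"
      using e(4) tz' by (simp flip: right_diff_distrib add: abs_mult)
    also have "\<dots> \<le> norm u * \<kappa>'"
      using 2 by (intro mult_left_mono) auto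
    \<comment> \<open>A linear term is dominated by a constant plus a quadratic term, which the
      lower bound then converts into \<open>1 + acoord\<close>.\<close>
    also have "\<dots> \<le> (1 + (norm u)\<^sup>2) * \<kappa>'"
    proof (rule mult_right_mono)
      have "2 * norm u \<le> 1 + (norm u)\<^sup>2"
        using zero_le_power2[of "norm u - 1"] by (simp add: power2_diff)
      then show "norm u \<le> 1 + (norm u)\<^sup>2"
        using norm_ge_zero[of u] by linarith
    qed (use \<kappa>' in auto)
    also have "\<dots> \<le> \<kappa> * (1 + acoord U \<phi> t z u)"
    proof -
      have "(norm u)\<^sup>2 * \<kappa>' \<le> (norm u)\<^sup>2 * (\<kappa> * k)"
        using \<kappa>' by (intro mult_left_mono) auto
      also have "\<dots> = \<kappa> * (k * (norm u)\<^sup>2)"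
        by simp
      also have "\<dots> \<le> \<kappa> * acoord U \<phi> t z u"
        using lower \<kappa> by (intro mult_left_mono) auto
      finally show ?thesis
        using \<kappa>'(3) by (simp add: algebra_simps)
    qed
    finally show "acoord U \<phi> t' z u \<le> (1 + \<kappa>) * acoord U \<phi> t z u \<and>
        \<bar>bcoord U \<phi> t' z u - bcoord U \<phi> t z u\<bar> \<le> \<kappa> * (1 + acoord U \<phi> t z u) \<and>
        \<bar>Vcoord U \<phi> t' z - Vcoord U \<phi> t z\<bar> \<le> \<kappa>"
      using A1 3 \<kappa>' by auto
  qed
qed

text \<open>In terms of \<open>\<sigma>\<close> the squared length of the vector is
  \<open>a t p v v - 2 * \<tau> * \<sigma>\<close>, and its product with W is
  \<open>- (\<tau> / 2 + \<sigma>)\<close>. The last inequality thus says that the vector is future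
  directed, and in particular nonzero.\<close>

lemma future_causal_iff:
  assumes c: "(U, \<phi>) \<in> A" "p \<in> U" "t \<in> T" and v: "v = tangent_vector A p (U, \<phi>) u"
  shows "future_causal a b V (t, p, y) (\<tau>, v, \<eta>) \<longleftrightarrow>
    (let \<sigma> = \<eta> - b t p v + V t p * \<tau> in a t p v v \<le> 2 * \<tau> * \<sigma> \<and> 0 \<le> \<tau> \<and> 0 \<le> \<sigma> \<and> 0 < \<tau> + 2 * \<sigma>)"
proof -
  let ?\<sigma> = "\<eta> - b t p v + V t p * \<tau>"
  have bil: "bilinear (\<lambda>u v. a t p (tangent_vector A p (U, \<phi>) u) (tangent_vector A p (U, \<phi>) v))"
    using a_bilinear[OF c(3,1)] c by simp
  have lin: "linear (\<lambda>u. b t p (tangent_vector A p (U, \<phi>) u))"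
    using b_linear[OF c(3,1)] c by simp
  have a0: "a t p v (\<lambda>_. 0) = 0"
    using bilinear_rzero[OF bil, of u] tangent_vector_0[OF c(1,2)] v by simp
  have b0: "b t p (\<lambda>_. 0) = 0"
    using linear_0[OF lin] tangent_vector_0[OF c(1,2)] by simp
  have a00: "a t p v v \<ge> 0"
  proof (cases "u = 0")
    case True
    then show ?thesis
      using a0 v tangent_vector_0[OF c(1,2)] by simp
  next
    case False
    then show ?thesis
      using a_positive[OF c(3,1) _ False, of p] c v by simp
  qed
  have 1: "gw_metric a b V (t, p, y) (\<tau>, v, \<eta>) (\<tau>, v, \<eta>) = a t p v v - 2 * \<tau> * ?\<sigma>"
    by (simp add: gw_metric_def algebra_simps)
  have 2: "gw_metric a b V (t, p, y) (\<tau>, v, \<eta>) (gw_orientation V (t, p, y)) = - (\<tau> / 2 + ?\<sigma>)"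
    by (simp add: gw_metric_def gw_orientation_def a0 b0 algebra_simps)
  have 3: "(\<tau>, v, \<eta>) \<noteq> (0, \<lambda>_. 0, 0)" if "\<tau> / 2 + ?\<sigma> > 0"
    using that b0 by auto
  \<comment> \<open>The product of \<open>\<tau>\<close> and \<open>\<sigma>\<close> is nonnegative
    and a positive combination of them is positive, so neither is negative.\<close>
  have 4: "0 \<le> \<tau> \<and> 0 \<le> ?\<sigma>" if "a t p v v \<le> 2 * \<tau> * ?\<sigma>" "\<tau> / 2 + ?\<sigma> > 0"
  proof -
    have "0 \<le> \<tau> * ?\<sigma>"
      using that(1) a00 by linarith
    then show ?thesis
      using that(2) by (auto simp: zero_le_mult_iff)
  qed
  show ?thesis
  proof
    assume "future_causal a b V (t, p, y) (\<tau>, v, \<eta>)"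
    then have "a t p v v \<le> 2 * \<tau> * ?\<sigma>" "\<tau> / 2 + ?\<sigma> > 0"
      unfolding future_causal_def 1 2 by auto
    with 4[OF this] show "let \<sigma> = ?\<sigma> in a t p v v \<le> 2 * \<tau> * \<sigma> \<and> 0 \<le> \<tau> \<and> 0 \<le> \<sigma> \<and> 0 < \<tau> + 2 * \<sigma>"
      unfolding Let_def by simp
  next
    assume "let \<sigma> = ?\<sigma> in a t p v v \<le> 2 * \<tau> * \<sigma> \<and> 0 \<le> \<tau> \<and> 0 \<le> \<sigma> \<and> 0 < \<tau> + 2 * \<sigma>"
    then have h: "a t p v v \<le> 2 * \<tau> * ?\<sigma>" "0 < \<tau> + 2 * ?\<sigma>"
      unfolding Let_def by blast+
    have *: "a t p v v - 2 * \<tau> * ?\<sigma> \<le> 0"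
      using h(1) by linarith
    have **: "\<tau> / 2 + ?\<sigma> > 0"
      using h(2) by simp
    have "- (\<tau> / 2 + ?\<sigma>) < 0"
      using ** by simp
    with * 3[OF **] show "future_causal a b V (t, p, y) (\<tau>, v, \<eta>)"
      unfolding future_causal_def 1 2 by blast
  qed
qed

section \<open>Metric and potentials along curves\<close>

lemma coord_curve:
  assumes "C1_curve A J q" "nondeg J" "s \<in> J" "(U, \<phi>) \<in> A" "q s \<in> U"
  shows "a t (q s) (velocity A J q s) (velocity A J q s) = acoord U \<phi> t (\<phi> (q s)) (velocity A J q s (U, \<phi>))"
    "b t (q s) (velocity A J q s) = bcoord U \<phi> t (\<phi> (q s)) (velocity A J q s (U, \<phi>))"
    "V t (q s) = Vcoord U \<phi> t (\<phi> (q s))"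
  using velocity_tangent[OF assms] chartD(6)[OF assms(4,5)]
  by (simp_all add: acoord_def bcoord_def Vcoord_def Let_def)

text \<open>The time \<open>f s\<close> is decoupled from the parameter \<open>s\<close>: actions
  need \<open>f s = s\<close>, causal curves their own time component.\<close>

lemma curve_continuous_on:
  assumes q: "C1_curve A J q" "nondeg J" and f: "continuous_on J f" "f ` J \<subseteq> T"
  shows "continuous_on J (\<lambda>s. a (f s) (q s) (velocity A J q s) (velocity A J q s))"
    "continuous_on J (\<lambda>s. b (f s) (q s) (velocity A J q s))"
    "continuous_on J (\<lambda>s. V (f s) (q s))"
proof -
  have "continuous (at s within J) (\<lambda>s. a (f s) (q s) (velocity A J q s) (velocity A J q s)) \<and>
    continuous (at s within J) (\<lambda>s. b (f s) (q s) (velocity A J q s)) \<and>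
    continuous (at s within J) (\<lambda>s. V (f s) (q s))" if s: "s \<in> J" for s
  proof -
    obtain U \<phi> where c: "(U, \<phi>) \<in> A" "q s \<in> U"
      using chart_cover .
    let ?J = "{s \<in> J. q s \<in> U}"
    have cq: "continuous_on J q"
      using q unfolding C1_curve_def by auto
    have at: "at s within ?J = at s within J"
      using at_within_preimage[OF cq chartD(1)[OF c(1)] s c(2)] .
    let ?z = "\<lambda>s. \<phi> (q s)" and ?u = "\<lambda>s. velocity A J q s (U, \<phi>)"
    have cz: "continuous_on ?J ?z"
      using chartD(4)[OF c(1)] by (rule continuous_on_compose2)
        (auto intro: continuous_on_subset[OF cq])
    have cu: "continuous_on ?J ?u"
      using C1_curve_has_velocity[OF q] c(1) at_within_preimage[OF cq chartD(1)[OF c(1)]]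
      unfolding has_velocity_def continuous_on_eq_continuous_within by auto
    have cf: "continuous_on ?J f"
      by (rule continuous_on_subset[OF f(1)]) auto
    have triple: "continuous_on ?J (\<lambda>s. (f s, ?z s, ?u s))" "continuous_on ?J (\<lambda>s. (f s, ?z s))"
      by (intro continuous_intros cz cu cf)+
    have 1: "continuous_on ?J (\<lambda>s. acoord U \<phi> (f s) (?z s) (?u s))"
      using continuous_on_compose2[OF acoord_continuous_on[OF c(1)] triple(1)] f by auto
    have 2: "continuous_on ?J (\<lambda>s. bcoord U \<phi> (f s) (?z s) (?u s))"
      using continuous_on_compose2[OF bcoord_continuous_on[OF c(1)] triple(1)] f by auto
    have 3: "continuous_on ?J (\<lambda>s. Vcoord U \<phi> (f s) (?z s))"
      using continuous_on_compose2[OF Vcoord_continuous_on[OF c(1)] triple(2)] f by auto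
    have "continuous_on ?J (\<lambda>s. a (f s) (q s) (velocity A J q s) (velocity A J q s))"
      using 1 by (rule continuous_on_eq) (simp add: coord_curve(1)[OF q _ c(1)])
    moreover have "continuous_on ?J (\<lambda>s. b (f s) (q s) (velocity A J q s))"
      using 2 by (rule continuous_on_eq) (simp add: coord_curve(2)[OF q _ c(1)])
    moreover have "continuous_on ?J (\<lambda>s. V (f s) (q s))"
      using 3 by (rule continuous_on_eq) (simp add: coord_curve(3)[OF q _ c(1)])
    ultimately show ?thesis
      using s c unfolding continuous_on_eq_continuous_within by (auto simp: at)
  qed
  then show "continuous_on J (\<lambda>s. a (f s) (q s) (velocity A J q s) (velocity A J q s))"
    "continuous_on J (\<lambda>s. b (f s) (q s) (velocity A J q s))"
    "continuous_on J (\<lambda>s. V (f s) (q s))"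
    unfolding continuous_on_eq_continuous_within by auto
qed

end

subsection \<open>Causal curves, null lifts and reparametrizations\<close>

lemma increasing_within:
  fixes f :: "real \<Rightarrow> real"
  assumes "\<And>x. x \<in> {a..b} \<Longrightarrow> (f has_real_derivative f' x) (at x within {a..b})"
    and "\<And>x. x \<in> {a..b} \<Longrightarrow> f' x > 0" "a \<le> x" "x < y" "y \<le> b"
  shows "f x < f y"
proof (rule DERIV_pos_imp_increasing_open[OF assms(4)])
  show "continuous_on {x..y} f"
    using assms DERIV_continuous_on[of "{a..b}" f f'] continuous_on_subset[of "{a..b}" f "{x..y}"] by auto
  fix z assume z: "x < z" "z < y"
  then have "(f has_real_derivative f' z) (at z)"
    using assms(1)[of z] assms(3,5) by (simp add: at_within_Icc_at)
  then show "\<exists>y. DERIV f z :> y \<and> y > 0"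
    using assms(2)[of z] z assms(3,5) by auto
qed

lemma nondecreasing_within:
  fixes f :: "real \<Rightarrow> real"
  assumes "\<And>x. x \<in> {a..b} \<Longrightarrow> (f has_real_derivative f' x) (at x within {a..b})"
    and "\<And>x. x \<in> {a..b} \<Longrightarrow> f' x \<ge> 0" "a \<le> x" "x \<le> y" "y \<le> b"
  shows "f x \<le> f y"
proof (rule DERIV_nonneg_imp_increasing_open[OF assms(4)])
  show "continuous_on {x..y} f"
    using assms DERIV_continuous_on[of "{a..b}" f f'] continuous_on_subset[of "{a..b}" f "{x..y}"] by auto
  fix z assume z: "x < z" "z < y"
  then have "(f has_real_derivative f' z) (at z)"
    using assms(1)[of z] assms(3,5) by (simp add: at_within_Icc_at)
  then show "\<exists>y. DERIV f z :> y \<and> y \<ge> 0"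
    using assms(2)[of z] z assms(3,5) by auto
qed

text \<open>The end points are included because the velocities there have to be known for curves to
  be joined.\<close>

lemma inverse_deriv_within:
  fixes f :: "real \<Rightarrow> real"
  assumes ab: "a < b"
    and f: "\<And>x. x \<in> {a..b} \<Longrightarrow> (f has_real_derivative f' x) (at x within {a..b})"
    and pos: "\<And>x. x \<in> {a..b} \<Longrightarrow> f' x > 0"
  obtains g where "\<And>y. y \<in> {f a..f b} \<Longrightarrow> g y \<in> {a..b} \<and> f (g y) = y" "g (f a) = a" "g (f b) = b"
    "\<And>y. y \<in> {f a..f b} \<Longrightarrow> (g has_real_derivative 1 / f' (g y)) (at y within {f a..f b})"
proof -
  let ?g = "inv_into {a..b} f"
  have inc: "f x < f y" if "a \<le> x" "x < y" "y \<le> b" for x y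
    using increasing_within[OF f pos that] .
  have cf: "continuous_on {a..b} f"
    using f DERIV_continuous_on by blast
  have inj: "inj_on f {a..b}"
    by (auto simp: inj_on_def) (metis inc linorder_neqE less_irrefl)
  have mono: "f x \<le> f y" if "a \<le> x" "x \<le> y" "y \<le> b" for x y
    using inc[of x y] that by (cases "x = y") auto
  have im: "f ` {a..b} = {f a..f b}"
  proof
    show "f ` {a..b} \<subseteq> {f a..f b}"
      using mono by auto
    show "{f a..f b} \<subseteq> f ` {a..b}"
      using IVT'[of f a _ b] cf ab by (force simp: image_iff)
  qed
  have gf: "?g (f x) = x" if "x \<in> {a..b}" for x
    using inv_into_f_f[OF inj that] .
  have g: "?g y \<in> {a..b}" "f (?g y) = y" if "y \<in> {f a..f b}" for y
    using that inv_into_into[of y f "{a..b}"] f_inv_into_f[of y f "{a..b}"] im by auto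
  have cg: "continuous_on {f a..f b} ?g"
    using continuous_on_inv[OF cf compact_Icc] gf im by metis
  have d: "(?g has_real_derivative 1 / f' (?g y)) (at y within {f a..f b})" if y: "y \<in> {f a..f b}" for y
  proof -
    let ?x = "?g y"
    have "((\<lambda>x. (f x - f ?x) / (x - ?x)) \<longlongrightarrow> f' ?x) (at ?x within {a..b})"
      using f[OF g(1)[OF y]] by (simp add: has_field_derivative_iff)
    then have lim: "((\<lambda>x. inverse ((f x - f ?x) / (x - ?x))) \<longlongrightarrow> inverse (f' ?x)) (at ?x within {a..b})"
      by (rule tendsto_inverse) (use pos[OF g(1)[OF y]] in simp)
    \<comment> \<open>Difference quotients of the inverse are reciprocals of those of
      \<open>f\<close> at the points \<open>?g w\<close>; these tend to \<open>?g y\<close> by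
      continuity and differ from it by injectivity.\<close>
    have "filterlim ?g (at ?x within {a..b}) (at y within {f a..f b})"
      unfolding filterlim_at
    proof
      show "\<forall>\<^sub>F w in at y within {f a..f b}. ?g w \<in> {a..b} \<and> ?g w \<noteq> ?g y"
        unfolding eventually_at using g y by (intro exI[of _ 1]) (metis zero_less_one)
      show "(?g \<longlongrightarrow> ?g y) (at y within {f a..f b})"
        using cg y by (simp add: continuous_on_def)
    qed
    from filterlim_compose[OF lim this]
    have "((\<lambda>w. inverse ((f (?g w) - f ?x) / (?g w - ?x))) \<longlongrightarrow> inverse (f' ?x)) (at y within {f a..f b})" .
    moreover have "\<forall>\<^sub>F w in at y within {f a..f b}. inverse ((f (?g w) - f ?x) / (?g w - ?x)) 
        = (?g w - ?g y) / (w - y)"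
      unfolding eventually_at using g y by (intro exI[of _ 1]) auto
    ultimately have "((\<lambda>w. (?g w - ?g y) / (w - y)) \<longlongrightarrow> inverse (f' ?x)) (at y within {f a..f b})"
      using tendsto_cong by fast
    then show ?thesis
      by (simp add: has_field_derivative_iff inverse_eq_divide)
  qed
  show ?thesis
    using that[of ?g] g gf d ab by auto
qed

text \<open>A curve parametrized by \<open>{\<alpha>..\<beta>}\<close> along which \<open>t\<close> is nondecreasing is traversed with the new time
  \<open>x\<close>, which runs slightly faster than \<open>t\<close>, and starts and ends at rest.\<close>

lemma slow_reparam:
  fixes t \<tau> :: "real \<Rightarrow> real" and x0 :: real
  assumes \<alpha>\<beta>: "\<alpha> < \<beta>"
    and t: "\<And>s. s \<in> {\<alpha>..\<beta>} \<Longrightarrow> (t has_real_derivative \<tau> s) (at s within {\<alpha>..\<beta>})"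
    and \<tau>: "continuous_on {\<alpha>..\<beta>} \<tau>" "\<And>s. s \<in> {\<alpha>..\<beta>} \<Longrightarrow> \<tau> s \<ge> 0" and e: "e > 0"
  defines "x1 \<equiv> t \<beta> - t \<alpha> + x0 + e"
  obtains k k' g g' where "x0 < x1" "k x0 = \<alpha>" "k x1 = \<beta>" "k' x0 = 0" "k' x1 = 0" "g x0 = 0" "g x1 = 1"
    "continuous_on {x0..x1} k'"
    "\<And>x. x \<in> {x0..x1} \<Longrightarrow> k x \<in> {\<alpha>..\<beta>} \<and> (k has_real_derivative k' x) (at x within {x0..x1}) \<and>
        (g has_real_derivative g' x) (at x within {x0..x1}) \<and> 0 \<le> k' x \<and> 0 < g' x \<and>
        \<tau> (k x) * k' x + e * g' x = 1 \<and> 0 \<le> x - x0 - (t (k x) - t \<alpha>) \<and> x - x0 - (t (k x) - t \<alpha>) \<le> e"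
proof -
  \<comment> \<open>A nondecreasing cubic from \<open>\<alpha>\<close> to \<open>\<beta>\<close>
    with vanishing derivative at \<open>0\<close> and \<open>1\<close>; this is what brings the
    curve to rest at both ends.\<close>
  define h where "h x = \<alpha> + (\<beta> - \<alpha>) * (3 * x^2 - 2 * x^3)" for x :: real
  define h' where "h' x = (\<beta> - \<alpha>) * (6 * x * (1 - x))" for x :: real
  have h: "(h has_real_derivative h' x) (at x within S)" for x S
    unfolding h_def h'_def by (auto intro!: derivative_eq_intros simp: algebra_simps power2_eq_square)
  have h'0: "h' x \<ge> 0" if "x \<in> {0..1}" for x
    using that \<alpha>\<beta> by (simp add: h'_def)
  have h01: "h 0 = \<alpha>" "h 1 = \<beta>" "h' 0 = 0" "h' 1 = 0"
    by (simp_all add: h_def h'_def)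
  have hm: "h x \<in> {\<alpha>..\<beta>}" if "x \<in> {0..1}" for x
    using nondecreasing_within[of 0 1 h h' 0 x] nondecreasing_within[of 0 1 h h' x 1] h h'0 h01 that by auto
  \<comment> \<open>The term \<open>e * x\<close> makes the delayed time strictly increasing even
    where \<open>\<tau>\<close> or \<open>h'\<close> vanishes. With \<open>g\<close> the inverse of
    \<open>f\<close> and \<open>k\<close> the composition of \<open>h\<close> and \<open>g\<close>,
    the identity \<open>\<tau> (k x) * k' x + e * g' x = 1\<close> is the derivative of
    \<open>f (g x) = x\<close>.\<close>
  define f where "f x = t (h x) - t \<alpha> + x0 + e * x" for x
  define f' where "f' x = \<tau> (h x) * h' x + e" for x
  have f: "(f has_real_derivative f' x) (at x within {0..1})" if "x \<in> {0..1}" for x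
  proof -
    have "(t has_real_derivative \<tau> (h x)) (at (h x) within h ` {0..1})"
      by (rule DERIV_subset[OF t[OF hm[OF that]]]) (use hm in auto)
    then have "((\<lambda>x. t (h x)) has_real_derivative \<tau> (h x) * h' x) (at x within {0..1})"
      using DERIV_image_chain[of t "\<tau> (h x)" h x "{0..1}" "h' x"] h by (simp add: comp_def)
    then show ?thesis
      unfolding f_def f'_def by (auto intro!: derivative_eq_intros)
  qed
  have f'pos: "f' x > 0" if "x \<in> {0..1}" for x
    unfolding f'_def using \<tau>(2)[OF hm[OF that]] h'0[OF that] e by (simp add: add_nonneg_pos)
  have ch: "continuous_on {0..1} h"
    unfolding h_def by (intro continuous_intros)
  have cf': "continuous_on {0..1} f'"
    unfolding f'_def h'_def
    by (intro continuous_intros continuous_on_compose2[OF \<tau>(1) ch]) (use hm in auto)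
  have f01: "f 0 = x0" "f 1 = x1"
    by (simp_all add: f_def x1_def h01)
  obtain g where g: "\<And>y. y \<in> {x0..x1} \<Longrightarrow> g y \<in> {0..1} \<and> f (g y) = y" "g x0 = 0" "g x1 = 1"
    "\<And>y. y \<in> {x0..x1} \<Longrightarrow> (g has_real_derivative 1 / f' (g y)) (at y within {x0..x1})"
    using inverse_deriv_within[OF zero_less_one f f'pos] unfolding f01 by metis
  have cg: "continuous_on {x0..x1} g"
    by (rule DERIV_continuous_on[OF g(4)])
  have cg': "continuous_on {x0..x1} (\<lambda>y. 1 / f' (g y))"
  proof (rule continuous_on_divide[OF continuous_on_const])
    show "continuous_on {x0..x1} (\<lambda>y. f' (g y))"
      by (rule continuous_on_compose2[OF cf' cg]) (use g(1) in auto)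
    show "\<forall>y\<in>{x0..x1}. f' (g y) \<noteq> 0"
      using g(1) f'pos by (metis less_irrefl)
  qed
  define k' where "k' x = h' (g x) * (1 / f' (g x))" for x
  show ?thesis
  proof (rule that[of "h \<circ> g" k' g "\<lambda>x. 1 / f' (g x)"])
    show "x0 < x1"
      using increasing_within[OF f f'pos, of 0 1] f01 by simp
    show "(h \<circ> g) x0 = \<alpha>" "(h \<circ> g) x1 = \<beta>" "k' x0 = 0" "k' x1 = 0" "g x0 = 0" "g x1 = 1"
      by (simp_all add: g h01 k'_def)
    show "continuous_on {x0..x1} k'"
      unfolding k'_def h'_def by (intro continuous_intros cg cg')
    fix x assume x: "x \<in> {x0..x1}"
    have gx: "g x \<in> {0..1}" "f (g x) = x" "f' (g x) > 0"
      using g(1)[OF x] f'pos by auto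
    have "(h \<circ> g has_real_derivative k' x) (at x within {x0..x1})"
      unfolding k'_def by (rule DERIV_image_chain[OF h g(4)[OF x]])
    moreover have "\<tau> (h (g x)) * k' x + e * (1 / f' (g x)) = 1"
    proof -
      have "\<tau> (h (g x)) * k' x + e * (1 / f' (g x)) = (\<tau> (h (g x)) * h' (g x) + e) / f' (g x)"
        by (simp add: k'_def add_divide_distrib)
      then show ?thesis
        using gx(3) by (simp add: f'_def)
    qed
    moreover have "x - x0 - (t (h (g x)) - t \<alpha>) = e * g x"
      using gx(2) by (simp add: f_def)
    ultimately show "(h \<circ> g) x \<in> {\<alpha>..\<beta>} \<and> (h \<circ> g has_real_derivative k' x) (at x within {x0..x1}) \<and>
        (g has_real_derivative 1 / f' (g x)) (at x within {x0..x1}) \<and> 0 \<le> k' x \<and> 0 < 1 / f' (g x) \<and>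
        \<tau> ((h \<circ> g) x) * k' x + e * (1 / f' (g x)) = 1 \<and> 0 \<le> x - x0 - (t ((h \<circ> g) x) - t \<alpha>) \<and> 
        x - x0 - (t ((h \<circ> g) x) - t \<alpha>) \<le> e"
      using g(4)[OF x] hm[OF gx(1)] h'0[OF gx(1)] gx e by (simp add: k'_def mult_left_le)
  qed
qed

text \<open>Compactness: finitely many parameter neighborhoods cover the interval, and the least of
  their radii serves for all \<open>s\<close>.\<close>

lemma uniform_local_property:
  fixes P :: "real \<Rightarrow> real \<Rightarrow> bool"
  assumes "\<And>s. s \<in> {\<alpha>..\<beta>} \<Longrightarrow> \<exists>d>0. \<forall>s'\<in>{\<alpha>..\<beta>}. \<bar>s' - s\<bar> < d \<longrightarrow> (\<forall>x. \<bar>x\<bar> < d \<longrightarrow> P s' x)"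
  shows "\<exists>d>0. \<forall>s\<in>{\<alpha>..\<beta>}. \<forall>x. \<bar>x\<bar> < d \<longrightarrow> P s x"
proof -
  obtain d where d: "\<And>s. s \<in> {\<alpha>..\<beta>} \<Longrightarrow> d s > 0"
    "\<And>s s' x. s \<in> {\<alpha>..\<beta>} \<Longrightarrow> s' \<in> {\<alpha>..\<beta>} \<Longrightarrow> \<bar>s' - s\<bar> < d s \<Longrightarrow> \<bar>x\<bar> < d s \<Longrightarrow> P s' x"
    using assms by metis
  have "{\<alpha>..\<beta>} \<subseteq> (\<Union>s\<in>{\<alpha>..\<beta>}. ball s (d s))"
    using d(1) by auto
  then obtain S where S: "S \<subseteq> {\<alpha>..\<beta>}" "finite S" "{\<alpha>..\<beta>} \<subseteq> (\<Union>s\<in>S. ball s (d s))"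
    by (rule compactE_image[OF compact_Icc, of "{\<alpha>..\<beta>}" "\<lambda>s. ball s (d s)", rotated]) auto
  \<comment> \<open>The \<open>1\<close> keeps \<open>Min\<close> meaningful when the cover is
    empty.\<close>
  define m where "m = Min (insert 1 (d ` S))"
  have m: "m > 0" "\<And>s. s \<in> S \<Longrightarrow> m \<le> d s"
    using S d(1) by (auto simp: m_def)
  have "P s x" if s: "s \<in> {\<alpha>..\<beta>}" "\<bar>x\<bar> < m" for s x
  proof -
    obtain s0 where "s0 \<in> S" "s \<in> ball s0 (d s0)"
      using S(3) s(1) by blast
    then show ?thesis
      using d(2)[of s0 s x] m(2)[of s0] S(1) s by (auto simp: dist_real_def)
  qed
  then show ?thesis
    using m(1) by blast
qed

lemma C1_onD:
  fixes f :: "real \<Rightarrow> real"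
  assumes "C1_on J f" "nondeg J"
  shows "\<And>s. s \<in> J \<Longrightarrow> (f has_real_derivative vector_derivative f (at s within J)) (at s within J)"
    "continuous_on J (\<lambda>s. vector_derivative f (at s within J))"
proof -
  obtain f' where f': "continuous_on J f'" "\<And>s. s \<in> J \<Longrightarrow> (f has_vector_derivative f' s) (at s within J)"
    using assms unfolding C1_on_def by auto
  have eq: "vector_derivative f (at s within J) = f' s" if "s \<in> J" for s
    using vector_derivative_within[OF nondeg_not_bot[OF assms(2) that] f'(2)[OF that]] .
  show "(f has_real_derivative vector_derivative f (at s within J)) (at s within J)" if "s \<in> J" for s
    using f'(2)[OF that] eq[OF that] by (simp add: has_real_derivative_iff_has_vector_derivative)
  show "continuous_on J (\<lambda>s. vector_derivative f (at s within J))"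
    using f'(1) by (rule continuous_on_eq) (simp add: eq)
qed

lemma C1_onI:
  fixes f :: "real \<Rightarrow> real"
  assumes "\<And>s. s \<in> J \<Longrightarrow> (f has_real_derivative f' s) (at s within J)" "continuous_on J f'"
  shows "C1_on J f"
  using assms unfolding C1_on_def has_real_derivative_iff_has_vector_derivative by auto

section \<open>Causal curves in components, null lifts and joins\<close>

context gravitational_wave
begin

text \<open>The components and their derivatives \<open>\<tau>\<close> and \<open>\<eta>\<close> are
  explicit, and the last clause is the condition of \<open>future_causal_iff\<close>. For
  \<open>\<tau> s = 1\<close> it amounts to \<open>\<eta> s\<close> being at least the Lagrangian,
  which is how \<open>y\<close> comes to measure action.\<close>

definition causal_data where
  "causal_data J t q y \<tau> \<eta> \<longleftrightarrow> t ` J \<subseteq> T \<and> C1_curve A J q \<and>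
     (\<forall>s\<in>J. (t has_real_derivative \<tau> s) (at s within J)) \<and> continuous_on J \<tau> \<and>
     (\<forall>s\<in>J. (y has_real_derivative \<eta> s) (at s within J)) \<and> continuous_on J \<eta> \<and>
     (\<forall>s\<in>J. let v = velocity A J q s; \<sigma> = \<eta> s - b (t s) (q s) v + V (t s) (q s) * \<tau> s in
        a (t s) (q s) v v \<le> 2 * \<tau> s * \<sigma> \<and> 0 \<le> \<tau> s \<and> 0 \<le> \<sigma> \<and> 0 < \<tau> s + 2 * \<sigma>)"

lemma causal_data_imp_C1_causal_curve:
  assumes "causal_data J t q y \<tau> \<eta>" "nondeg J"
  shows "C1_causal_curve A T a b V J (\<lambda>s. (t s, q s, y s))"
proof -
  have q: "C1_curve A J q"
    using assms unfolding causal_data_def by auto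
  have d: "vector_derivative t (at s within J) = \<tau> s" "vector_derivative y (at s within J) = \<eta> s" 
    if "s \<in> J" for s
    using assms(1) that vector_derivative_within[OF nondeg_not_bot[OF assms(2) that]] 
    unfolding causal_data_def has_real_derivative_iff_has_vector_derivative by blast+
  have "future_causal a b V (t s, q s, y s) (\<tau> s, velocity A J q s, \<eta> s)" if s: "s \<in> J" for s
  proof -
    obtain U \<phi> where c: "(U, \<phi>) \<in> A" "q s \<in> U"
      using chart_cover .
    show ?thesis
      using assms(1) s
      by (subst future_causal_iff[OF c _ velocity_tangent[OF q assms(2) s c]]) 
         (auto simp: causal_data_def Let_def)
  qed
  moreover have "C1_on J t" "C1_on J y"
    using assms unfolding causal_data_def by (auto intro: C1_onI)
  ultimately show ?thesis
    using assms(1) q unfolding C1_causal_curve_def causal_data_def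
    by (auto simp: comp_def Mvelocity_def d spacetime_def)
qed

lemma C1_causal_curve_imp_causal_data:
  assumes "C1_causal_curve A T a b V J \<gamma>" "nondeg J"
  obtains \<tau> \<eta> where "causal_data J (fst \<circ> \<gamma>) (fst \<circ> snd \<circ> \<gamma>) (snd \<circ> snd \<circ> \<gamma>) \<tau> \<eta>"
proof -
  let ?t = "fst \<circ> \<gamma>" and ?q = "fst \<circ> snd \<circ> \<gamma>" and ?y = "snd \<circ> snd \<circ> \<gamma>"
  let ?\<tau> = "\<lambda>s. vector_derivative ?t (at s within J)" and ?\<eta> = "\<lambda>s. vector_derivative ?y (at s within J)"
  have q: "C1_curve A J ?q"
    using assms unfolding C1_causal_curve_def by auto
  have t: "?t s \<in> T" if "s \<in> J" for s
    using assms(1) that unfolding C1_causal_curve_def spacetime_def by auto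
  have "let v = velocity A J ?q s; \<sigma> = ?\<eta> s - b (?t s) (?q s) v + V (?t s) (?q s) * ?\<tau> s in
        a (?t s) (?q s) v v \<le> 2 * ?\<tau> s * \<sigma> \<and> 0 \<le> ?\<tau> s \<and> 0 \<le> \<sigma> \<and> 0 < ?\<tau> s + 2 * \<sigma>" if s: "s \<in> J" for s
  proof -
    obtain U \<phi> where c: "(U, \<phi>) \<in> A" "?q s \<in> U"
      using chart_cover .
    have "future_causal a b V (?t s, ?q s, ?y s) (?\<tau> s, velocity A J ?q s, ?\<eta> s)"
      using assms(1) s unfolding C1_causal_curve_def Mvelocity_def by auto
    then show ?thesis
      unfolding Let_def future_causal_iff[OF c t[OF s] velocity_tangent[OF q assms(2) s c]] .
  qed
  then have "causal_data J ?t ?q ?y ?\<tau> ?\<eta>"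
    using q t C1_onD[OF _ assms(2)] assms(1) unfolding causal_data_def C1_causal_curve_def by auto
  then show ?thesis
    by (rule that)
qed

lemma causal_data_subset:
  assumes "causal_data J t q y \<tau> \<eta>" "nondeg J" "J' \<subseteq> J" "nondeg J'"
  shows "causal_data J' t q y \<tau> \<eta>"
proof -
  have q: "C1_curve A J q"
    using assms unfolding causal_data_def by auto
  have "velocity A J' q s = velocity A J q s" if "s \<in> J'" for s
    using velocity_subset[OF q assms(2,3,4) that] .
  then show ?thesis
    using assms(1,3) C1_curve_subset[OF q assms(2,3)] unfolding causal_data_def
    by (auto intro: continuous_on_subset DERIV_subset)
qed

lemma velocity_scale:
  assumes q: "C1_curve A J q" "nondeg J" "s \<in> J" and t: "t \<in> T"
  shows "a t (q s) (\<lambda>c. k *\<^sub>R velocity A J q s c) (\<lambda>c. k *\<^sub>R velocity A J q s c) =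
      k\<^sup>2 * a t (q s) (velocity A J q s) (velocity A J q s)"
    "b t (q s) (\<lambda>c. k *\<^sub>R velocity A J q s c) = k * b t (q s) (velocity A J q s)"
proof -
  obtain U \<phi> where c: "(U, \<phi>) \<in> A" "q s \<in> U"
    using chart_cover .
  let ?z = "\<phi> (q s)" and ?u = "velocity A J q s (U, \<phi>)"
  have z: "?z \<in> \<phi> ` U" "inv_into U \<phi> ?z = q s"
    using c chartD(6)[OF c] by auto
  have v: "velocity A J q s = tangent_vector A (q s) (U, \<phi>) ?u"
    using velocity_tangent[OF q c] .
  have "(\<lambda>c. k *\<^sub>R velocity A J q s c) = tangent_vector A (q s) (U, \<phi>) (k *\<^sub>R ?u)"
    by (subst v) (simp add: tangent_vector_scale[OF c])
  then have "a t (q s) (\<lambda>c. k *\<^sub>R velocity A J q s c) (\<lambda>c. k *\<^sub>R velocity A J q s c) = acoord U \<phi> t ?z (k *\<^sub>R ?u)"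
    "b t (q s) (\<lambda>c. k *\<^sub>R velocity A J q s c) = bcoord U \<phi> t ?z (k *\<^sub>R ?u)"
    using z by (simp_all add: acoord_def bcoord_def Let_def)
  then show "a t (q s) (\<lambda>c. k *\<^sub>R velocity A J q s c) (\<lambda>c. k *\<^sub>R velocity A J q s c) =
      k\<^sup>2 * a t (q s) (velocity A J q s) (velocity A J q s)"
    "b t (q s) (\<lambda>c. k *\<^sub>R velocity A J q s c) = k * b t (q s) (velocity A J q s)"
    by (simp_all add: acoord_scale[OF c(1) t z(1)] bcoord_scale[OF c(1) t z(1)] coord_curve[OF q c])
qed

lemma lagrangian_continuous_on:
  assumes "C1_curve A J q" "nondeg J" "continuous_on J f" "f ` J \<subseteq> T"
  shows "continuous_on J (\<lambda>s. lagrangian a b V (f s) (q s) (velocity A J q s))"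
  unfolding lagrangian_def using curve_continuous_on[OF assms] by (intro continuous_intros) auto

text \<open>With \<open>\<tau> = 1\<close> and \<open>\<eta>\<close> equal to the Lagrangian,
  \<open>\<sigma>\<close> is half of the kinetic form, which is the equality case of the causality
  condition.\<close>

lemma null_lift:
  assumes q: "C1_curve A {t0..t1} q" and t: "t0 < t1" "{t0..t1} \<subseteq> T"
  obtains y \<eta> where "y t0 = y0" "y t1 = y0 + action A a b V t0 t1 q" 
    "causal_data {t0..t1} (\<lambda>s. s) q y (\<lambda>_. 1) \<eta>"
proof -
  let ?J = "{t0..t1}"
  let ?\<eta> = "\<lambda>s. lagrangian a b V s (q s) (velocity A ?J q s)"
  let ?y = "\<lambda>s. y0 + integral {t0..s} ?\<eta>"
  have nd: "nondeg ?J"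
    using t nondeg_Icc by blast
  have c\<eta>: "continuous_on ?J ?\<eta>"
    using lagrangian_continuous_on[OF q nd, of "\<lambda>s. s"] t by auto
  have y: "(?y has_real_derivative ?\<eta> s) (at s within ?J)" if "s \<in> ?J" for s
    using integral_has_real_derivative[OF c\<eta> that] by (auto intro!: derivative_eq_intros)
  have nonneg: "a s (q s) (velocity A ?J q s) (velocity A ?J q s) \<ge> 0" if s: "s \<in> ?J" for s
  proof -
    obtain U \<phi> where c: "(U, \<phi>) \<in> A" "q s \<in> U"
      using chart_cover .
    show ?thesis
      using acoord_pos[OF c(1), of s "\<phi> (q s)" "velocity A ?J q s (U, \<phi>)"] 
        acoord_scale[OF c(1), of s "\<phi> (q s)" 0 0] s c t
      by (cases "velocity A ?J q s (U, \<phi>) = 0") (auto simp: coord_curve[OF q nd s c] subset_iff less_le)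
  qed
  have "causal_data ?J (\<lambda>s. s) q ?y (\<lambda>_. 1) ?\<eta>"
    unfolding causal_data_def using t q c\<eta> y nonneg
    by (auto simp: Let_def lagrangian_def intro!: derivative_eq_intros add_pos_nonneg)
  then show ?thesis
    using that[of ?y ?\<eta>] by (simp add: action_def)
qed

text \<open>Two C1 curves meeting at rest have the same one-sided derivative, namely zero, in every
  chart around the common point, so the joined curve is C1 there.\<close>

lemma C1_curve_join:
  assumes t: "t0 < t1" "t1 < t2" "{t0..t2} \<subseteq> T"
    and q1: "C1_curve A {t0..t1} q1" and q2: "C1_curve A {t1..t2} q2" "q1 t1 = q2 t1"
    and v: "velocity A {t0..t1} q1 t1 = (\<lambda>_. 0)" "velocity A {t1..t2} q2 t1 = (\<lambda>_. 0)"
  obtains q where "C1_curve A {t0..t2} q" "q t0 = q1 t0" "q t2 = q2 t2"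
    "velocity A {t0..t2} q t0 = velocity A {t0..t1} q1 t0" 
    "velocity A {t0..t2} q t2 = velocity A {t1..t2} q2 t2"
    "action A a b V t0 t2 q = action A a b V t0 t1 q1 + action A a b V t1 t2 q2"
proof -
  let ?q = "\<lambda>s. if s \<le> t1 then q1 s else q2 s"
  let ?X = "\<lambda>s. if s \<le> t1 then velocity A {t0..t1} q1 s else velocity A {t1..t2} q2 s"
  have nd: "nondeg {t0..t1}" "nondeg {t1..t2}" "nondeg {t0..t2}"
    using t by (auto intro!: nondeg_Icc)
  have eq: "?q s = q2 s" "?X s = velocity A {t1..t2} q2 s" if "s \<in> {t1..t2}" for s
    using that q2(2) v by auto
  have 1: "has_velocity {t0..t1} ?q ?X"
    using C1_curve_has_velocity[OF q1 nd(1)] by (rule has_velocity_cong) auto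
  have 2: "has_velocity {t1..t2} ?q ?X"
    using C1_curve_has_velocity[OF q2(1) nd(2)] by (rule has_velocity_cong) (auto simp: eq)
  have "{t0..t1} \<union> {t1..t2} = {t0..t2}"
    using t by auto
  then have hv: "has_velocity {t0..t2} ?q ?X"
    using has_velocity_glue[OF 1 2] by simp
  have vel: "velocity A {t0..t2} ?q s = ?X s" if "s \<in> {t0..t2}" for s
    by (rule has_velocity_eq_velocity[OF hv nd(3) that]) (auto simp: velocity_def eq)
  have C1: "C1_curve A {t0..t2} ?q"
    using has_velocity_C1_curve[OF hv] .
  let ?L = "\<lambda>s. lagrangian a b V s (?q s) (velocity A {t0..t2} ?q s)"
  have "continuous_on {t0..t2} ?L"
    using lagrangian_continuous_on[OF C1 nd(3), of "\<lambda>s. s"] t by auto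
  then have "integral {t0..t2} ?L = integral {t0..t1} ?L + integral {t1..t2} ?L"
    using Henstock_Kurzweil_Integration.integral_combine[of t0 t1 t2 ?L] t integrable_continuous_real by force
  also have "integral {t0..t1} ?L = action A a b V t0 t1 q1"
    unfolding action_def by (rule integral_cong) (use t vel in auto)
  also have "integral {t1..t2} ?L = action A a b V t1 t2 q2"
    unfolding action_def 
  proof (rule integral_cong)
    fix s assume s: "s \<in> {t1..t2}"
    then show "?L s = lagrangian a b V s (q2 s) (velocity A {t1..t2} q2 s)"
      using eq[OF s] vel[of s] t by simp
  qed
  finally have act: "action A a b V t0 t2 ?q = action A a b V t0 t1 q1 + action A a b V t1 t2 q2"
    unfolding action_def[of A a b V t0 t2] .
  show ?thesis
    by (rule that[OF C1 _ _ _ _ act]) (use t vel in auto)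
qed

end

subsection \<open>Reachability with bounded action\<close>

context gravitational_wave
begin

text \<open>Up to an arbitrarily small delay, and for all slightly delayed starting times, \<open>q1\<close> at time
  \<open>t1\<close> is reached from \<open>q0\<close> at time \<open>t0\<close> with action at most \<open>D\<close>. Starting and ending
  at rest makes \<open>C\<^sup>1\<close> curves composable.\<close>

definition rest_curve :: "real \<Rightarrow> 'q \<Rightarrow> real \<Rightarrow> 'q \<Rightarrow> real \<Rightarrow> bool" where
  "rest_curve t0 q0 t1 q1 D \<longleftrightarrow> t0 < t1 \<and> t0 \<in> T \<and> t1 \<in> T \<and>
     (\<exists>q. C1_curve A {t0..t1} q \<and> q t0 = q0 \<and> q t1 = q1 \<and> velocity A {t0..t1} q t0 = (\<lambda>_. 0) \<and>
        velocity A {t0..t1} q t1 = (\<lambda>_. 0) \<and> action A a b V t0 t1 q \<le> D)"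

definition reach :: "real \<Rightarrow> 'q \<Rightarrow> real \<Rightarrow> 'q \<Rightarrow> real \<Rightarrow> bool" where
  "reach t0 q0 t1 q1 D \<longleftrightarrow> t1 \<in> T \<and> (\<forall>\<epsilon>>0. \<exists>\<delta>>0. \<forall>t0'\<in>{t0..t0+\<delta>}. \<exists>t1'. t1 < t1' \<and> t1' < t1 + \<epsilon> \<and>
     rest_curve t0' q0 t1' q1 (D + \<epsilon>))"

lemma Icc_subset_T: "x \<in> T \<Longrightarrow> y \<in> T \<Longrightarrow> {x..y} \<subseteq> T"
  using T_interval(1) mem_is_interval_1_I[of T x y] by auto

lemma rest_curve_trans:
  assumes "rest_curve t0 q0 t1 q1 D" "rest_curve t1 q1 t2 q2 E"
  shows "rest_curve t0 q0 t2 q2 (D + E)"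
proof -
  obtain p where p: "t0 < t1" "t0 \<in> T" "C1_curve A {t0..t1} p" "p t0 = q0" "p t1 = q1" 
     "velocity A {t0..t1} p t0 = (\<lambda>_. 0)" "velocity A {t0..t1} p t1 = (\<lambda>_. 0)" 
     "action A a b V t0 t1 p \<le> D"
    using assms(1) unfolding rest_curve_def by blast
  obtain p' where p': "t1 < t2" "t2 \<in> T" "C1_curve A {t1..t2} p'" "p' t1 = q1" "p' t2 = q2" 
     "velocity A {t1..t2} p' t1 = (\<lambda>_. 0)" "velocity A {t1..t2} p' t2 = (\<lambda>_. 0)" 
     "action A a b V t1 t2 p' \<le> E"
    using assms(2) unfolding rest_curve_def by blast
  have eq: "p t1 = p' t1"
    using p p' by simp
  obtain q where q: "C1_curve A {t0..t2} q" "q t0 = p t0" "q t2 = p' t2"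
      "velocity A {t0..t2} q t0 = velocity A {t0..t1} p t0" 
      "velocity A {t0..t2} q t2 = velocity A {t1..t2} p' t2"
      "action A a b V t0 t2 q = action A a b V t0 t1 p + action A a b V t1 t2 p'"
    by (rule C1_curve_join[OF p(1) p'(1) Icc_subset_T[OF p(2) p'(2)] p(3) p'(3) eq p(7) p'(6)])
  have "action A a b V t0 t2 q \<le> D + E"
    using q(6) p(8) p'(8) by linarith
  then show ?thesis
    using q p p' unfolding rest_curve_def by (intro conjI exI[of _ q]) auto
qed

lemma rest_curve_mono: "rest_curve t0 q0 t1 q1 D \<Longrightarrow> D \<le> E \<Longrightarrow> rest_curve t0 q0 t1 q1 E"
  unfolding rest_curve_def using order_trans by blast

text \<open>The order of the quantifiers in \<open>reach\<close> is made for this: the delay of the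
  first leg is kept below the late start that the second leg tolerates, and each leg uses at most
  half of the permitted error in the action.\<close>

lemma reach_trans:
  assumes "reach t0 q0 t1 q1 D" "reach t1 q1 t2 q2 E"
  shows "reach t0 q0 t2 q2 (D + E)"
  unfolding reach_def
proof (intro conjI allI impI)
  show "t2 \<in> T"
    using assms unfolding reach_def by auto
  fix \<epsilon> :: real assume \<epsilon>: "\<epsilon> > 0"
  then have "\<epsilon>/2 > 0"
    by simp
  then obtain \<delta>2 where \<delta>2: "\<delta>2 > 0" "\<And>t0'. t0'\<in>{t1..t1+\<delta>2} \<Longrightarrow> \<exists>t1'. t2 < t1' \<and> t1' < t2 + \<epsilon>/2 \<and> 
     rest_curve t0' q1 t1' q2 (E + \<epsilon>/2)"
    using assms(2) unfolding reach_def by meson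
  let ?\<epsilon> = "min (\<epsilon>/2) \<delta>2"
  have "?\<epsilon> > 0"
    using \<epsilon> \<delta>2 by simp
  then obtain \<delta>1 where \<delta>1: "\<delta>1 > 0" "\<And>t0'. t0'\<in>{t0..t0+\<delta>1} \<Longrightarrow> \<exists>t1'. t1 < t1' \<and> t1' < t1 + ?\<epsilon> \<and>
     rest_curve t0' q0 t1' q1 (D + ?\<epsilon>)"
    using assms(1) unfolding reach_def by meson
  have "\<exists>t1'. t2 < t1' \<and> t1' < t2 + \<epsilon> \<and> rest_curve s q0 t1' q2 (D + E + \<epsilon>)" if s: "s \<in> {t0..t0+\<delta>1}" for s
  proof -
    obtain s1 where s1: "t1 < s1" "s1 < t1 + ?\<epsilon>" "rest_curve s q0 s1 q1 (D + ?\<epsilon>)"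
      using \<delta>1(2)[OF s] by blast
    then have "s1 \<in> {t1..t1+\<delta>2}"
      by auto
    then obtain s2 where s2: "t2 < s2" "s2 < t2 + \<epsilon>/2" "rest_curve s1 q1 s2 q2 (E + \<epsilon>/2)"
      using \<delta>2(2) by blast
    have "rest_curve s q0 s2 q2 (D + E + \<epsilon>)"
      by (rule rest_curve_mono[OF rest_curve_trans[OF s1(3) s2(3)]]) simp
    then show ?thesis
      using s2 \<epsilon> by (intro exI[of _ s2]) auto
  qed
  then show "\<exists>\<delta>>0. \<forall>t0'\<in>{t0..t0+\<delta>}. \<exists>t1'. t2 < t1' \<and> t1' < t2 + \<epsilon> \<and> rest_curve t0' q0 t1' q2 (D + E + \<epsilon>)"
    using \<delta>1(1) by blast
qed

text \<open>A margin \<open>d\<close> that is uniform along the curve: any shift of time by less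
  than \<open>d\<close> changes the coefficients only within the bounds of
  \<open>coord_local_ratio\<close>.\<close>

lemma local_ratio_along_curve:
  assumes q: "C1_curve A {\<alpha>..\<beta>} q" and \<alpha>\<beta>: "\<alpha> < \<beta>" and t: "continuous_on {\<alpha>..\<beta>} t" "t ` {\<alpha>..\<beta>} \<subseteq> T"
    and \<kappa>: "\<kappa> > 0"
  shows "\<exists>d>0. \<forall>s\<in>{\<alpha>..\<beta>}. \<forall>x. \<bar>x\<bar> < d \<longrightarrow> (let v = velocity A {\<alpha>..\<beta>} q s; t' = t s + x in
     t' \<in> T \<and> a t' (q s) v v \<le> (1 + \<kappa>) * a (t s) (q s) v v \<and>
     \<bar>b t' (q s) v - b (t s) (q s) v\<bar> \<le> \<kappa> * (1 + a (t s) (q s) v v) \<and>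
     \<bar>V t' (q s) - V (t s) (q s)\<bar> \<le> \<kappa>)" (is "\<exists>d>0. \<forall>s\<in>_. \<forall>x. _ \<longrightarrow> ?P s x")
proof (rule uniform_local_property)
  fix s0 assume s0: "s0 \<in> {\<alpha>..\<beta>}"
  have nd: "nondeg {\<alpha>..\<beta>}"
    using \<alpha>\<beta> nondeg_Icc by blast
  obtain U \<phi> where c: "(U, \<phi>) \<in> A" "q s0 \<in> U"
    using chart_cover .
  have "t s0 \<in> T" "\<phi> (q s0) \<in> \<phi> ` U"
    using t s0 c by auto
  then obtain d where d: "d > 0" "ball (t s0) d \<subseteq> T" "ball (\<phi> (q s0)) d \<subseteq> \<phi> ` U"
    "\<And>t1 t' z u. t1 \<in> ball (t s0) d \<Longrightarrow> t' \<in> ball (t s0) d \<Longrightarrow> z \<in> ball (\<phi> (q s0)) d \<Longrightarrow> 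
        acoord U \<phi> t' z u \<le> (1 + \<kappa>) * acoord U \<phi> t1 z u \<and>
        \<bar>bcoord U \<phi> t' z u - bcoord U \<phi> t1 z u\<bar> \<le> \<kappa> * (1 + acoord U \<phi> t1 z u) \<and>
        \<bar>Vcoord U \<phi> t' z - Vcoord U \<phi> t1 z\<bar> \<le> \<kappa>"
    by (rule coord_local_ratio[OF c(1) _ _ \<kappa>]) blast
  have cq: "continuous_on {\<alpha>..\<beta>} q"
    using q unfolding C1_curve_def by auto
  have at: "at s0 within {s \<in> {\<alpha>..\<beta>}. q s \<in> U} = at s0 within {\<alpha>..\<beta>}"
    using at_within_preimage[OF cq chartD(1)[OF c(1)] s0 c(2)] .
  have "continuous_on {s \<in> {\<alpha>..\<beta>}. q s \<in> U} (\<lambda>s. \<phi> (q s))"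
    using chartD(4)[OF c(1)] by (rule continuous_on_compose2) (auto intro: continuous_on_subset[OF cq])
  then have cz: "((\<lambda>s. \<phi> (q s)) \<longlongrightarrow> \<phi> (q s0)) (at s0 within {\<alpha>..\<beta>})"
    using s0 c(2) at unfolding continuous_on_def by auto
  have ct: "(t \<longlongrightarrow> t s0) (at s0 within {\<alpha>..\<beta>})"
    using t(1) s0 by (auto simp: continuous_on_def)
  have cqs: "(q \<longlongrightarrow> q s0) (at s0 within {\<alpha>..\<beta>})"
    using cq s0 by (auto simp: continuous_on_def)
  have "\<forall>\<^sub>F s in at s0 within {\<alpha>..\<beta>}. dist (\<phi> (q s)) (\<phi> (q s0)) < d \<and> dist (t s) (t s0) < d/2 \<and> q s \<in> U"
    using tendstoD[OF cz d(1)] tendstoD[OF ct half_gt_zero[OF d(1)]] 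
      topological_tendstoD[OF cqs chartD(1)[OF c(1)] c(2)] by eventually_elim auto
  then obtain d' where d': "d' > 0" "\<And>s. s \<in> {\<alpha>..\<beta>} \<Longrightarrow> s \<noteq> s0 \<Longrightarrow> dist s s0 < d' \<Longrightarrow> 
      dist (\<phi> (q s)) (\<phi> (q s0)) < d \<and> dist (t s) (t s0) < d/2 \<and> q s \<in> U"
    unfolding eventually_at by auto
  have near: "dist (\<phi> (q s)) (\<phi> (q s0)) < d \<and> dist (t s) (t s0) < d/2 \<and> q s \<in> U" 
    if "s \<in> {\<alpha>..\<beta>}" "\<bar>s - s0\<bar> < d'" for s
    using d'(2)[of s] that d(1) c(2) by (cases "s = s0") (auto simp: dist_real_def)
  show "\<exists>d>0. \<forall>s'\<in>{\<alpha>..\<beta>}. \<bar>s' - s0\<bar> < d \<longrightarrow> (\<forall>x. \<bar>x\<bar> < d \<longrightarrow> ?P s' x)"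
  \<comment> \<open>Half of \<open>d\<close> is spent on the distance from \<open>t s\<close> to
    \<open>t s0\<close>, the other half on the shift \<open>x\<close>.\<close>
  proof (intro exI[of _ "min d' (d/2)"] conjI ballI allI impI)
    show "0 < min d' (d/2)"
      using d(1) d'(1) by simp
    fix s x assume s: "s \<in> {\<alpha>..\<beta>}" "\<bar>s - s0\<bar> < min d' (d/2)" "\<bar>x\<bar> < min d' (d/2)"
    have n: "dist (\<phi> (q s)) (\<phi> (q s0)) < d" "dist (t s) (t s0) < d/2" "q s \<in> U"
      using near[of s] s by auto
    have mem: "t s \<in> ball (t s0) d" "t s + x \<in> ball (t s0) d" "\<phi> (q s) \<in> ball (\<phi> (q s0)) d"
      using n s d(1) by (auto simp: dist_real_def dist_commute abs_if split: if_splits)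
    show "?P s x"
      using d(4)[OF mem, of "velocity A {\<alpha>..\<beta>} q s (U, \<phi>)"] d(2) mem(2)
      by (auto simp: Let_def coord_curve[OF q nd s(1) c(1) n(3)])
  qed
qed

text \<open>As \<open>\<tau>\<close> may vanish, the curve need not have finite speed with respect to \<open>t\<close>. The delayed
  time \<open>x\<close> repairs this, and the error of evaluating \<open>a\<close> at \<open>x\<close> instead of \<open>t\<close> is controlled because it
  is a small multiple of \<open>a\<close> itself, hence of \<open>\<tau> \<sigma>\<close>.\<close>

lemma reach_C1_causal:
  assumes cd: "causal_data {\<alpha>..\<beta>} t q y \<tau> \<eta>" and \<alpha>\<beta>: "\<alpha> < \<beta>"
  shows "reach (t \<alpha>) (q \<alpha>) (t \<beta>) (q \<beta>) (y \<beta> - y \<alpha>)"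
  unfolding reach_def
proof (intro conjI allI impI)
  let ?J = "{\<alpha>..\<beta>}"
  let ?v = "velocity A ?J q"
  define \<sigma> where "\<sigma> s = \<eta> s - b (t s) (q s) (?v s) + V (t s) (q s) * \<tau> s" for s
  define N where "N s = a (t s) (q s) (?v s) (?v s)" for s
  have nd: "nondeg ?J"
    using \<alpha>\<beta> nondeg_Icc by blast
  have tT: "t ` ?J \<subseteq> T" and q: "C1_curve A ?J q"
    and dt: "\<And>s. s \<in> ?J \<Longrightarrow> (t has_real_derivative \<tau> s) (at s within ?J)" 
    and dy: "\<And>s. s \<in> ?J \<Longrightarrow> (y has_real_derivative \<eta> s) (at s within ?J)" 
    and c\<tau>: "continuous_on ?J \<tau>" and c\<eta>: "continuous_on ?J \<eta>" 
    and caus: "\<And>s. s \<in> ?J \<Longrightarrow> N s \<le> 2 * \<tau> s * \<sigma> s \<and> 0 \<le> \<tau> s \<and> 0 \<le> \<sigma> s"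
    using cd unfolding causal_data_def Let_def \<sigma>_def N_def by auto
  then show "t \<beta> \<in> T"
    using \<alpha>\<beta> by auto
  have ct: "continuous_on ?J t"
    using dt DERIV_continuous_on by blast
  note cc = curve_continuous_on[OF q nd ct tT]
  have c\<sigma>: "continuous_on ?J \<sigma>"
    unfolding \<sigma>_def by (intro continuous_intros c\<eta> c\<tau> cc)
  have cN: "continuous_on ?J N"
    unfolding N_def by (intro cc)
  have bd: "\<exists>B>0. \<forall>x\<in>?J. \<bar>f x\<bar> \<le> B" if "continuous_on ?J f" for f :: "real \<Rightarrow> real"
    using compact_imp_bounded[OF compact_continuous_image[OF that compact_Icc]] 
    unfolding bounded_pos by auto
  obtain C1 C2 C3 where CC: "C1 > 0" "\<And>s. s \<in> ?J \<Longrightarrow> \<bar>\<sigma> s\<bar> \<le> C1" "C2 > 0" "\<And>s. s \<in> ?J \<Longrightarrow> \<bar>N s\<bar> \<le> C2"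
    "C3 > 0" "\<And>s. s \<in> ?J \<Longrightarrow> \<bar>V (t s) (q s)\<bar> \<le> C3"
    using bd[OF c\<sigma>] bd[OF cN] bd[OF cc(3)] by metis
  define C where "C = C1 + C2 + C3"
  have C: "C > 0" "\<And>s. s \<in> ?J \<Longrightarrow> \<bar>\<sigma> s\<bar> \<le> C" "\<And>s. s \<in> ?J \<Longrightarrow> \<bar>N s\<bar> \<le> C" 
    "\<And>s. s \<in> ?J \<Longrightarrow> \<bar>V (t s) (q s)\<bar> \<le> C"
    using CC unfolding C_def by (force intro: add_pos_pos)+
  have tmono: "t \<alpha> \<le> t \<beta>"
    using nondecreasing_within[of \<alpha> \<beta> t \<tau> \<alpha> \<beta>] dt caus \<alpha>\<beta> by auto
  fix \<epsilon> :: real assume \<epsilon>: "\<epsilon> > 0"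
  \<comment> \<open>The total weight of \<open>\<kappa>\<close> in the final bound:
    \<open>2 * C + 1\<close> bounds \<open>\<sigma> + 1 + N\<close>, integrated over the old
    parameter, and the second summand bounds the new duration.\<close>
  define W where "W = (2 * C + 1) * (\<beta> - \<alpha>) + (t \<beta> - t \<alpha> + 1)"
  have W: "W > 0"
    unfolding W_def using C(1) \<alpha>\<beta> tmono by (intro add_pos_pos[OF mult_pos_pos]) auto
  define \<kappa> where "\<kappa> = \<epsilon> / (2 * W)"
  have \<kappa>: "\<kappa> > 0" "\<kappa> * W = \<epsilon> / 2"
    unfolding \<kappa>_def using \<epsilon> W by auto
  obtain d where d: "d > 0" "\<And>s x. s \<in> ?J \<Longrightarrow> \<bar>x\<bar> < d \<Longrightarrow> t s + x \<in> T \<and> 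
     a (t s + x) (q s) (?v s) (?v s) \<le> (1 + \<kappa>) * N s \<and>
     \<bar>b (t s + x) (q s) (?v s) - b (t s) (q s) (?v s)\<bar> \<le> \<kappa> * (1 + N s) \<and>
     \<bar>V (t s + x) (q s) - V (t s) (q s)\<bar> \<le> \<kappa>"
    using local_ratio_along_curve[OF q \<alpha>\<beta> ct tT \<kappa>(1)] unfolding Let_def N_def by blast
  \<comment> \<open>The late start and the added delay are each at most \<open>e\<close>: together
    they must stay below the margin \<open>d\<close> and below \<open>\<epsilon>\<close>. The last
    entry pays for the potential during the delay, and \<open>e \<le> 1\<close> bounds the new
    duration.\<close>
  define e where "e = Min {d/4, \<epsilon>/4, 1, \<epsilon>/(2*C)}"
  have e: "e > 0" "2 * e < d" "2 * e < \<epsilon>" "e \<le> 1" "C * e \<le> \<epsilon> / 2"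
  proof -
    show "e > 0"
      using d(1) \<epsilon> C(1) by (simp add: e_def)
    have "e \<le> d/4" "e \<le> \<epsilon>/4" "e \<le> \<epsilon>/(2*C)"
      by (simp_all add: e_def)
    then show "2 * e < d" "2 * e < \<epsilon>" "C * e \<le> \<epsilon> / 2"
      using d(1) \<epsilon> C(1) by (auto simp: field_simps)
    show "e \<le> 1"
      by (simp add: e_def)
  qed
  show "\<exists>\<delta>>0. \<forall>t0'\<in>{t \<alpha>..t \<alpha> + \<delta>}. \<exists>t1'. t \<beta> < t1' \<and> t1' < t \<beta> + \<epsilon> \<and>
     rest_curve t0' (q \<alpha>) t1' (q \<beta>) (y \<beta> - y \<alpha> + \<epsilon>)"
  proof (rule exI[of _ e], intro conjI ballI)
    show "e > 0"
      by fact
    fix x0 assume x0: "x0 \<in> {t \<alpha>..t \<alpha> + e}"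
    define x1 where "x1 = t \<beta> - t \<alpha> + x0 + e"
    let ?I = "{x0..x1}"
    obtain k k' g g' where r: "x0 < x1" "k x0 = \<alpha>" "k x1 = \<beta>" "k' x0 = 0" "k' x1 = 0" "g x0 = 0" "g x1 = 1"
      "continuous_on ?I k'"
      "\<And>x. x \<in> ?I \<Longrightarrow> k x \<in> {\<alpha>..\<beta>} \<and> (k has_real_derivative k' x) (at x within ?I) \<and>
        (g has_real_derivative g' x) (at x within ?I) \<and> 0 \<le> k' x \<and> 0 < g' x \<and>
        \<tau> (k x) * k' x + e * g' x = 1 \<and> 0 \<le> x - x0 - (t (k x) - t \<alpha>) \<and> x - x0 - (t (k x) - t \<alpha>) \<le> e"
      unfolding x1_def using slow_reparam[OF \<alpha>\<beta> dt c\<tau> _ e(1), of x0] caus by blast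
    have ndI: "nondeg ?I"
      using r(1) nondeg_Icc by blast
    let ?p = "q \<circ> k" and ?X = "\<lambda>x c. k' x *\<^sub>R ?v (k x) c"
    have hv: "has_velocity ?I ?p ?X"
      by (rule has_velocity_reparam[OF C1_curve_has_velocity[OF q nd] _ _ r(8)]) (use r(9) in blast)+
    have vel: "velocity A ?I ?p x = ?X x" if "x \<in> ?I" for x
      by (rule has_velocity_eq_velocity[OF hv ndI that]) (auto simp: velocity_def)
    have C1: "C1_curve A ?I ?p"
      using has_velocity_C1_curve[OF hv] .
    have shift: "\<bar>x - t (k x)\<bar> < d" if "x \<in> ?I" for x
      using r(9)[OF that] x0 e by auto
    have IT: "x \<in> T" if "x \<in> ?I" for x
      using d(2)[of "k x" "x - t (k x)"] shift[OF that] r(9)[OF that] by auto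
    \<comment> \<open>An upper bound for the Lagrangian along the delayed curve. It is the
      derivative of a combination of \<open>y (k x)\<close>, \<open>k x\<close>, \<open>x\<close>
      and \<open>g x\<close>, whose end values are known.\<close>
    define R where "R x = \<eta> (k x) * k' x + \<kappa> * (2 * C + 1) * k' x + \<kappa> + C * e * g' x" for x
    have le: "lagrangian a b V x (?p x) (velocity A ?I ?p x) \<le> R x" if x: "x \<in> ?I" for x
    proof -
      define s where "s = k x"
      have s: "s \<in> ?J"
        using r(9)[OF x] s_def by auto
      have x': "\<bar>x - t s\<bar> < d" "t s + (x - t s) = x"
        using shift[OF x] by (auto simp: s_def)
      have N: "a x (q s) (?v s) (?v s) \<le> (1 + \<kappa>) * N s"
        and B: "b x (q s) (?v s) \<le> b (t s) (q s) (?v s) + \<kappa> * (1 + N s)"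
        and V: "- V x (q s) \<le> - V (t s) (q s) + \<kappa>"
        using d(2)[OF s x'(1)] unfolding x'(2) by auto
      have K: "0 \<le> k' x" "0 < g' x" "\<tau> s * k' x + e * g' x = 1"
        using r(9)[OF x] s_def by auto
      have K1: "\<tau> s * k' x \<le> 1"
        using K(3) mult_pos_pos[OF e(1) K(2)] by linarith
      have \<sigma>s: "0 \<le> \<sigma> s" "\<sigma> s \<le> C" and Ns: "N s \<le> 2 * \<tau> s * \<sigma> s" "N s \<le> C"
        using caus[OF s] C(2)[OF s] C(3)[OF s] by auto
      have "(k' x)\<^sup>2 * a x (q s) (?v s) (?v s) / 2 \<le> (k' x)\<^sup>2 * ((1 + \<kappa>) * N s) / 2"
        using N by (intro divide_right_mono mult_left_mono) auto
      also have "\<dots> \<le> (k' x)\<^sup>2 * ((1 + \<kappa>) * (2 * \<tau> s * \<sigma> s)) / 2"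
        using Ns(1) \<kappa>(1) by (intro divide_right_mono mult_left_mono) auto
      \<comment> \<open>One factor \<open>\<tau> s * k' x \<le> 1\<close> is split off, so that the
        kinetic energy, quadratic in \<open>k'\<close>, is bounded by a term linear in
        \<open>k'\<close>, however small \<open>\<tau>\<close> is.\<close>
      also have "\<dots> = (\<tau> s * k' x) * ((1 + \<kappa>) * \<sigma> s * k' x)"
        by (simp add: power2_eq_square)
      also have "\<dots> \<le> 1 * ((1 + \<kappa>) * \<sigma> s * k' x)"
        using K1 K(1) \<sigma>s \<kappa>(1) by (intro mult_right_mono) auto
      finally have L1: "(k' x)\<^sup>2 * a x (q s) (?v s) (?v s) / 2 \<le> (1 + \<kappa>) * \<sigma> s * k' x"
        by simp
      have L2: "k' x * b x (q s) (?v s) \<le> k' x * (b (t s) (q s) (?v s) + \<kappa> * (1 + N s))"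
        using B K(1) by (intro mult_left_mono) auto
      \<comment> \<open>Splitting \<open>1\<close> as \<open>\<tau> s * k' x + e * g' x\<close>
        separates the part of the potential that recombines with \<open>\<sigma>\<close> and
        \<open>b\<close> to \<open>\<eta>\<close> from the part due to the delay.\<close>
      have L3: "- V (t s) (q s) = - V (t s) (q s) * \<tau> s * k' x - V (t s) (q s) * (e * g' x)"
        using K(3) by (metis (no_types, opaque_lifting) diff_conv_add_uminus distrib_left mult.assoc mult.right_neutral mult_minus_left)
      have L4: "- V (t s) (q s) * (e * g' x) \<le> C * (e * g' x)"
        using C(4)[OF s] e(1) K(2) by (intro mult_right_mono) auto
      have L5: "\<kappa> * k' x * (\<sigma> s + 1 + N s) \<le> \<kappa> * k' x * (2 * C + 1)"
        using \<sigma>s Ns \<kappa>(1) K(1) by (intro mult_left_mono) auto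
      have "lagrangian a b V x (?p x) (velocity A ?I ?p x) = 
          (k' x)\<^sup>2 * a x (q s) (?v s) (?v s) / 2 + k' x * b x (q s) (?v s) - V x (q s)"
        unfolding lagrangian_def vel[OF x] unfolding comp_def s_def[symmetric]
        by (simp add: velocity_scale[OF q nd s IT[OF x]])
      also have "\<dots> \<le> (1 + \<kappa>) * \<sigma> s * k' x + k' x * (b (t s) (q s) (?v s) + \<kappa> * (1 + N s)) 
          + (- V (t s) (q s) * \<tau> s * k' x + C * (e * g' x) + \<kappa>)"
        using L1 L2 L3 L4 V by linarith
      also have "\<dots> = (\<sigma> s + b (t s) (q s) (?v s) - V (t s) (q s) * \<tau> s) * k' x 
          + \<kappa> * k' x * (\<sigma> s + 1 + N s) + \<kappa> + C * e * g' x"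
        by (simp add: algebra_simps)
      also have "\<dots> \<le> \<eta> s * k' x + \<kappa> * k' x * (2 * C + 1) + \<kappa> + C * e * g' x"
        using L5 by (simp add: \<sigma>_def)
      finally show ?thesis
        unfolding R_def s_def by (simp add: mult.commute mult.left_commute)
    qed
    let ?G = "\<lambda>x. y (k x) + \<kappa> * (2 * C + 1) * k x + \<kappa> * x + C * e * g x"
    have G: "(?G has_real_derivative R x) (at x within ?I)" if x: "x \<in> ?I" for x
    proof -
      have "(y has_real_derivative \<eta> (k x)) (at (k x) within k ` ?I)"
        by (rule DERIV_subset[OF dy]) (use r(9) x in blast)+
      then have yk: "((\<lambda>x. y (k x)) has_real_derivative \<eta> (k x) * k' x) (at x within ?I)"
        using DERIV_image_chain[of y "\<eta> (k x)" k x ?I "k' x"] r(9)[OF x] by (simp add: comp_def)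
      have "(k has_real_derivative k' x) (at x within ?I)" "(g has_real_derivative g' x) (at x within ?I)"
        using r(9)[OF x] by auto
      then show ?thesis
        unfolding R_def by (auto intro!: derivative_eq_intros yk)
    qed
    have "(R has_integral ?G x1 - ?G x0) ?I"
      using fundamental_theorem_of_calculus[of x0 x1 ?G R] G r(1)
      by (auto simp: has_real_derivative_iff_has_vector_derivative)
    moreover have "continuous_on ?I (\<lambda>x. lagrangian a b V x (?p x) (velocity A ?I ?p x))"
      by (rule lagrangian_continuous_on[OF C1 ndI]) (use IT in auto)
    ultimately have "action A a b V x0 x1 ?p \<le> ?G x1 - ?G x0"
      unfolding action_def
      by (intro has_integral_le[OF integrable_integral[OF integrable_continuous_real] _ le]) auto
    also have "\<dots> = y \<beta> - y \<alpha> + \<kappa> * ((2 * C + 1) * (\<beta> - \<alpha>) + (x1 - x0)) + C * e"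
      using r by (simp add: algebra_simps)
    also have "\<dots> \<le> y \<beta> - y \<alpha> + \<kappa> * W + C * e"
      using e(4) \<kappa>(1) unfolding W_def x1_def by simp
    also have "\<dots> \<le> y \<beta> - y \<alpha> + \<epsilon>"
      using \<kappa>(2) e(5) by simp
    finally have act: "action A a b V x0 x1 ?p \<le> y \<beta> - y \<alpha> + \<epsilon>" .
    have x1: "t \<beta> < x1" "x1 < t \<beta> + \<epsilon>"
      using x0 e unfolding x1_def by auto
    have "velocity A ?I ?p x0 = (\<lambda>_. 0)" "velocity A ?I ?p x1 = (\<lambda>_. 0)"
      using r(1) by (auto simp: vel r(4,5))
    then have "rest_curve x0 (q \<alpha>) x1 (q \<beta>) (y \<beta> - y \<alpha> + \<epsilon>)"
      using act r(1,2,3) C1 IT unfolding rest_curve_def by (intro conjI exI[of _ ?p]) auto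
    with x1 show "\<exists>t1'. t \<beta> < t1' \<and> t1' < t \<beta> + \<epsilon> \<and> rest_curve x0 (q \<alpha>) t1' (q \<beta>) (y \<beta> - y \<alpha> + \<epsilon>)"
      by blast
  qed
qed

end

subsection \<open>Estimates along causal curves\<close>

text \<open>Induction on the number of break points inside the interval; any of them splits it into
  two intervals with fewer.\<close>

lemma interval_chain:
  fixes P :: "real \<Rightarrow> real \<Rightarrow> bool"
  assumes F: "finite F"
    and trans: "\<And>x y z. s0 \<le> x \<Longrightarrow> x < y \<Longrightarrow> y < z \<Longrightarrow> z \<le> s1 \<Longrightarrow> P x y \<Longrightarrow> P y z \<Longrightarrow> P x z"
    and base: "\<And>x y. s0 \<le> x \<Longrightarrow> x < y \<Longrightarrow> y \<le> s1 \<Longrightarrow> {x<..<y} \<inter> F = {} \<Longrightarrow> P x y"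
    and "s0 \<le> x" "x < y" "y \<le> s1"
  shows "P x y"
  using assms(4-6)
proof (induction "card ({x<..<y} \<inter> F)" arbitrary: x y rule: less_induct)
  case less
  show ?case
  proof (cases "{x<..<y} \<inter> F = {}")
    case True
    then show ?thesis
      using base less by blast
  next
    case False
    then obtain f where f: "f \<in> F" "x < f" "f < y"
      by auto
    have "{x<..<f} \<inter> F \<subset> {x<..<y} \<inter> F" "{f<..<y} \<inter> F \<subset> {x<..<y} \<inter> F"
      using f by auto
    then have "card ({x<..<f} \<inter> F) < card ({x<..<y} \<inter> F)" "card ({f<..<y} \<inter> F) < card ({x<..<y} \<inter> F)"
      using F by (auto intro!: psubset_card_mono)
    then have "P x f" "P f y"
      using less f by auto
    then show ?thesis
      using trans less.prems f by blast
  qed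
qed

context gravitational_wave
begin

text \<open>Reduces a transitive statement about piecewise C1 causal curves to C1 pieces. Break
  points at the ends of a piece are harmless, since only its interior must avoid them.\<close>

lemma causal_curve_chain:
  assumes \<gamma>: "causal_curve A T a b V I \<gamma>" and s: "s0 \<in> I" "s1 \<in> I" "s0 < s1"
    and trans: "\<And>x y z. s0 \<le> x \<Longrightarrow> x < y \<Longrightarrow> y < z \<Longrightarrow> z \<le> s1 \<Longrightarrow> P x y \<Longrightarrow> P y z \<Longrightarrow> P x z"
    and base: "\<And>x y \<tau> \<eta>. s0 \<le> x \<Longrightarrow> x < y \<Longrightarrow> y \<le> s1 \<Longrightarrow> 
       causal_data {x..y} (fst \<circ> \<gamma>) (fst \<circ> snd \<circ> \<gamma>) (snd \<circ> snd \<circ> \<gamma>) \<tau> \<eta> \<Longrightarrow> P x y"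
  shows "P s0 s1"
proof -
  obtain F where F: "finite F" 
    "\<And>J. is_interval J \<Longrightarrow> interior J \<noteq> {} \<Longrightarrow> J \<subseteq> I \<Longrightarrow> interior J \<inter> F = {} \<Longrightarrow> C1_causal_curve A T a b V J \<gamma>"
    using \<gamma> unfolding causal_curve_def by metis
  have I: "{s0..s1} \<subseteq> I"
    using \<gamma> s mem_is_interval_1_I[of I s0 s1] unfolding causal_curve_def by auto
  show ?thesis
  proof (rule interval_chain[OF F(1) trans])
    fix x y assume xy: "s0 \<le> x" "x < y" "y \<le> s1" "{x<..<y} \<inter> F = {}"
    have nd: "nondeg {x..y}"
      using xy nondeg_Icc by blast
    have "C1_causal_curve A T a b V {x..y} \<gamma>"
      using xy I nd by (intro F(2)) auto
    then obtain \<tau> \<eta> where "causal_data {x..y} (fst \<circ> \<gamma>) (fst \<circ> snd \<circ> \<gamma>) (snd \<circ> snd \<circ> \<gamma>) \<tau> \<eta>"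
      using C1_causal_curve_imp_causal_data nd by blast
    then show "P x y"
      using base xy by blast
  qed (use s in auto)
qed

lemma causal_data_time_mono:
  assumes "causal_data {\<alpha>..\<beta>} t q y \<tau> \<eta>" "\<alpha> \<le> \<beta>"
  shows "t \<alpha> \<le> t \<beta>"
  using nondecreasing_within[of \<alpha> \<beta> t \<tau> \<alpha> \<beta>] assms unfolding causal_data_def Let_def by auto

lemma causal_curve_time_mono:
  assumes "causal_curve A T a b V I \<gamma>" "s0 \<in> I" "s1 \<in> I" "s0 \<le> s1"
  shows "fst (\<gamma> s0) \<le> fst (\<gamma> s1)"
proof (cases "s0 = s1")
  case False
  then have "s0 < s1"
    using assms by simp
  show ?thesis
  proof (rule causal_curve_chain[OF assms(1-3) \<open>s0 < s1\<close>, of "\<lambda>x y. fst (\<gamma> x) \<le> fst (\<gamma> y)"])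
    fix x y \<tau> \<eta> assume "x < y" and cd: "causal_data {x..y} (fst \<circ> \<gamma>) (fst \<circ> snd \<circ> \<gamma>) (snd \<circ> snd \<circ> \<gamma>) \<tau> \<eta>"
    show "fst (\<gamma> x) \<le> fst (\<gamma> y)"
      using causal_data_time_mono[OF cd] \<open>x < y\<close> by simp
  qed auto
qed simp

lemma causal_curve_reach:
  assumes "causal_curve A T a b V I \<gamma>" "s0 \<in> I" "s1 \<in> I" "s0 < s1"
  shows "reach (fst (\<gamma> s0)) (fst (snd (\<gamma> s0))) (fst (\<gamma> s1)) (fst (snd (\<gamma> s1))) 
    (snd (snd (\<gamma> s1)) - snd (snd (\<gamma> s0)))"
proof (rule causal_curve_chain[OF assms, of "\<lambda>x y. reach (fst (\<gamma> x)) (fst (snd (\<gamma> x))) (fst (\<gamma> y)) 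
    (fst (snd (\<gamma> y))) (snd (snd (\<gamma> y)) - snd (snd (\<gamma> x)))"])
  fix x y \<tau> \<eta> assume "x < y" and cd: "causal_data {x..y} (fst \<circ> \<gamma>) (fst \<circ> snd \<circ> \<gamma>) (snd \<circ> snd \<circ> \<gamma>) \<tau> \<eta>"
  then show "reach (fst (\<gamma> x)) (fst (snd (\<gamma> x))) (fst (\<gamma> y)) 
    (fst (snd (\<gamma> y))) (snd (snd (\<gamma> y)) - snd (snd (\<gamma> x)))"
    using reach_C1_causal[OF cd] by simp
next
  fix x y z assume "reach (fst (\<gamma> x)) (fst (snd (\<gamma> x))) (fst (\<gamma> y)) 
    (fst (snd (\<gamma> y))) (snd (snd (\<gamma> y)) - snd (snd (\<gamma> x)))" "reach (fst (\<gamma> y)) (fst (snd (\<gamma> y))) (fst (\<gamma> z)) 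
    (fst (snd (\<gamma> z))) (snd (snd (\<gamma> z)) - snd (snd (\<gamma> y)))"
  from reach_trans[OF this] show "reach (fst (\<gamma> x)) (fst (snd (\<gamma> x))) (fst (\<gamma> z)) 
    (fst (snd (\<gamma> z))) (snd (snd (\<gamma> z)) - snd (snd (\<gamma> x)))"
    by simp
qed

text \<open>Completing the square: \<open>\<sigma> + n \<tau> \<ge> 2 \<surd>(n \<tau> \<sigma>)\<close> with \<open>n = (l + C)\<^sup>2 / (2 k)\<close>
  dominates the linear terms in the velocity.\<close>

lemma causal_data_box_estimate:
  assumes cd: "causal_data {\<alpha>..\<beta>} t q y \<tau> \<eta>" and \<alpha>\<beta>: "\<alpha> < \<beta>" and c: "(U, \<phi>) \<in> A"
    and box: "\<And>s. s \<in> {\<alpha>..\<beta>} \<Longrightarrow> t s \<in> K1 \<and> q s \<in> U \<and> \<phi> (q s) \<in> K2"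
    and k: "k > 0" "\<And>t z u. t \<in> K1 \<Longrightarrow> z \<in> K2 \<Longrightarrow> k * (norm u)\<^sup>2 \<le> acoord U \<phi> t z u"
    and C: "C \<ge> 0" "\<And>t z u. t \<in> K1 \<Longrightarrow> z \<in> K2 \<Longrightarrow> \<bar>bcoord U \<phi> t z u\<bar> \<le> C * norm u"
       "\<And>t z. t \<in> K1 \<Longrightarrow> z \<in> K2 \<Longrightarrow> \<bar>Vcoord U \<phi> t z\<bar> \<le> C"
    and l: "l \<ge> 0"
  shows "y \<beta> - y \<alpha> \<ge> l * norm (\<phi> (q \<beta>) - \<phi> (q \<alpha>)) - ((l + C)\<^sup>2 / (2 * k) + C) * (t \<beta> - t \<alpha>)"
proof -
  let ?J = "{\<alpha>..\<beta>}"
  define n where "n = (l + C)\<^sup>2 / (2 * k)"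
  define D where "D = \<phi> (q \<beta>) - \<phi> (q \<alpha>)"
  let ?u = "\<lambda>s. velocity A ?J q s (U, \<phi>)"
  \<comment> \<open>Projecting to the fixed direction \<open>sgn D\<close> replaces the norm of the
    displacement by a differentiable function; at the ends it recovers
    \<open>norm D\<close>.\<close>
  let ?F = "\<lambda>s. y s - l * (\<phi> (q s) \<bullet> sgn D) + (n + C) * t s"
  let ?F' = "\<lambda>s. \<eta> s - l * (?u s \<bullet> sgn D) + (n + C) * \<tau> s"
  have nd: "nondeg ?J"
    using \<alpha>\<beta> nondeg_Icc by blast
  have q: "C1_curve A ?J q"
    and dt: "\<And>s. s \<in> ?J \<Longrightarrow> (t has_real_derivative \<tau> s) (at s within ?J)" 
    and dy: "\<And>s. s \<in> ?J \<Longrightarrow> (y has_real_derivative \<eta> s) (at s within ?J)" 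
    using cd unfolding causal_data_def by auto
  have dF: "(?F has_real_derivative ?F' s) (at s within ?J)" if s: "s \<in> ?J" for s
  proof -
    have "(\<phi> \<circ> q has_vector_derivative ?u s) (at s within ?J)"
      using C1_curve_has_velocity[OF q nd] s c box[OF s] unfolding has_velocity_def by blast
    then have "((\<lambda>s. \<phi> (q s) \<bullet> sgn D) has_real_derivative ?u s \<bullet> sgn D) (at s within ?J)"
      using bounded_linear.has_vector_derivative[OF bounded_linear_inner_left]
      by (fastforce simp: has_real_derivative_iff_has_vector_derivative comp_def)
    then show ?thesis
      by (auto intro!: derivative_eq_intros dy[OF s] dt[OF s])
  qed
  have "?F' s \<ge> 0" if s: "s \<in> ?J" for s
  proof -
    let ?z = "\<phi> (q s)"
    define \<sigma> where "\<sigma> = \<eta> s - b (t s) (q s) (velocity A ?J q s) + V (t s) (q s) * \<tau> s"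
    have bx: "t s \<in> K1" "q s \<in> U" "?z \<in> K2"
      using box[OF s] by auto
    note cc = coord_curve[OF q nd s c bx(2), of "t s"]
    have ca: "a (t s) (q s) (velocity A ?J q s) (velocity A ?J q s) \<le> 2 * \<tau> s * \<sigma>" "0 \<le> \<tau> s" "0 \<le> \<sigma>"
      using cd s unfolding causal_data_def Let_def \<sigma>_def by auto
    have k': "k * (norm (?u s))\<^sup>2 \<le> 2 * \<tau> s * \<sigma>"
      using k(2)[OF bx(1,3), of "?u s"] ca(1) cc(1) by linarith
    have b': "\<bar>b (t s) (q s) (velocity A ?J q s)\<bar> \<le> C * norm (?u s)" and V': "\<bar>V (t s) (q s)\<bar> \<le> C"
      using C(2)[OF bx(1,3), of "?u s"] C(3)[OF bx(1,3)] cc by auto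
    have n: "n \<ge> 0" "2 * n * k = (l + C)\<^sup>2"
      using k(1) by (auto simp: n_def)
    have "((l + C) * norm (?u s))\<^sup>2 = 2 * n * (k * (norm (?u s))\<^sup>2)"
      using n(2) by (simp add: power_mult_distrib flip: mult.assoc)
    also have "\<dots> \<le> 2 * n * (2 * \<tau> s * \<sigma>)"
      using k' n(1) by (intro mult_left_mono) auto
    also have "\<dots> = (\<sigma> + n * \<tau> s)\<^sup>2 - (\<sigma> - n * \<tau> s)\<^sup>2"
      by (simp add: power2_eq_square algebra_simps)
    also have "\<dots> \<le> (\<sigma> + n * \<tau> s)\<^sup>2"
      by simp
    finally have main: "(l + C) * norm (?u s) \<le> \<sigma> + n * \<tau> s"
      by (rule power2_le_imp_le) (use ca n(1) in simp)
    have "?u s \<bullet> sgn D \<le> norm (?u s) * norm (sgn D)"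
      using norm_cauchy_schwarz by blast
    also have "\<dots> \<le> norm (?u s) * 1"
      by (intro mult_left_mono) (auto simp: norm_sgn)
    finally have "l * (?u s \<bullet> sgn D) \<le> l * norm (?u s)"
      using l by (simp add: mult_left_mono)
    moreover have "V (t s) (q s) * \<tau> s \<le> C * \<tau> s"
      using V' ca(2) by (intro mult_right_mono) auto
    moreover have "b (t s) (q s) (velocity A ?J q s) \<ge> - (C * norm (?u s))"
      using b' by linarith
    ultimately show ?thesis
      using main by (simp add: \<sigma>_def algebra_simps)
  qed
  then have "?F \<alpha> \<le> ?F \<beta>"
    using nondecreasing_within[of \<alpha> \<beta> ?F ?F' \<alpha> \<beta>] dF \<alpha>\<beta> by auto
  moreover have "D \<bullet> sgn D = norm D"
    by (cases "D = 0") (simp_all add: sgn_div_norm power2_norm_eq_inner[symmetric] power2_eq_square)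
  ultimately have "y \<beta> - y \<alpha> \<ge> l * norm D - (n + C) * (t \<beta> - t \<alpha>)"
    unfolding D_def by (simp add: inner_diff_left algebra_simps)
  then show ?thesis
    unfolding D_def n_def .
qed

text \<open>The increments of \<open>t\<close> and \<open>y\<close> add up over pieces, and the
  triangle inequality for the displacement points in the right direction.\<close>

lemma causal_curve_box_estimate:
  assumes \<gamma>: "causal_curve A T a b V I \<gamma>" "s0 \<in> I" "s1 \<in> I" "s0 < s1" and c: "(U, \<phi>) \<in> A"
    and box: "\<And>s. s \<in> {s0..s1} \<Longrightarrow> fst (\<gamma> s) \<in> K1 \<and> fst (snd (\<gamma> s)) \<in> U \<and> \<phi> (fst (snd (\<gamma> s))) \<in> K2"
    and k: "k > 0" "\<And>t z u. t \<in> K1 \<Longrightarrow> z \<in> K2 \<Longrightarrow> k * (norm u)\<^sup>2 \<le> acoord U \<phi> t z u"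
    and C: "C \<ge> 0" "\<And>t z u. t \<in> K1 \<Longrightarrow> z \<in> K2 \<Longrightarrow> \<bar>bcoord U \<phi> t z u\<bar> \<le> C * norm u"
       "\<And>t z. t \<in> K1 \<Longrightarrow> z \<in> K2 \<Longrightarrow> \<bar>Vcoord U \<phi> t z\<bar> \<le> C"
    and l: "l \<ge> 0"
  shows "snd (snd (\<gamma> s1)) - snd (snd (\<gamma> s0)) \<ge> l * norm (\<phi> (fst (snd (\<gamma> s1))) - \<phi> (fst (snd (\<gamma> s0)))) 
    - ((l + C)\<^sup>2 / (2 * k) + C) * (fst (\<gamma> s1) - fst (\<gamma> s0))"
proof (rule causal_curve_chain[OF \<gamma>, of "\<lambda>x y. snd (snd (\<gamma> y)) - snd (snd (\<gamma> x)) \<ge> 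
    l * norm (\<phi> (fst (snd (\<gamma> y))) - \<phi> (fst (snd (\<gamma> x)))) 
    - ((l + C)\<^sup>2 / (2 * k) + C) * (fst (\<gamma> y) - fst (\<gamma> x))"])
  fix x y \<tau> \<eta> assume xy: "s0 \<le> x" "x < y" "y \<le> s1" 
    and cd: "causal_data {x..y} (fst \<circ> \<gamma>) (fst \<circ> snd \<circ> \<gamma>) (snd \<circ> snd \<circ> \<gamma>) \<tau> \<eta>"
  have "(fst \<circ> \<gamma>) s \<in> K1 \<and> (fst \<circ> snd \<circ> \<gamma>) s \<in> U \<and> \<phi> ((fst \<circ> snd \<circ> \<gamma>) s) \<in> K2" if "s \<in> {x..y}" for s
    using box[of s] that xy by simp
  from causal_data_box_estimate[OF cd xy(2) c this k C l]
  show "snd (snd (\<gamma> y)) - snd (snd (\<gamma> x)) \<ge> l * norm (\<phi> (fst (snd (\<gamma> y))) - \<phi> (fst (snd (\<gamma> x)))) 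
    - ((l + C)\<^sup>2 / (2 * k) + C) * (fst (\<gamma> y) - fst (\<gamma> x))"
    by simp
next
  fix x y z
  let ?M = "(l + C)\<^sup>2 / (2 * k) + C"
  assume 1: "snd (snd (\<gamma> y)) - snd (snd (\<gamma> x)) \<ge> l * norm (\<phi> (fst (snd (\<gamma> y))) - \<phi> (fst (snd (\<gamma> x)))) 
    - ?M * (fst (\<gamma> y) - fst (\<gamma> x))"
    and 2: "snd (snd (\<gamma> z)) - snd (snd (\<gamma> y)) \<ge> l * norm (\<phi> (fst (snd (\<gamma> z))) - \<phi> (fst (snd (\<gamma> y)))) 
    - ?M * (fst (\<gamma> z) - fst (\<gamma> y))"
  have "norm (\<phi> (fst (snd (\<gamma> z))) - \<phi> (fst (snd (\<gamma> x)))) \<le> 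
      norm (\<phi> (fst (snd (\<gamma> z))) - \<phi> (fst (snd (\<gamma> y)))) + norm (\<phi> (fst (snd (\<gamma> y))) - \<phi> (fst (snd (\<gamma> x))))"
    using norm_triangle_ineq[of "\<phi> (fst (snd (\<gamma> z))) - \<phi> (fst (snd (\<gamma> y)))" 
      "\<phi> (fst (snd (\<gamma> y))) - \<phi> (fst (snd (\<gamma> x)))"] by simp
  then have "l * norm (\<phi> (fst (snd (\<gamma> z))) - \<phi> (fst (snd (\<gamma> x)))) \<le> 
      l * norm (\<phi> (fst (snd (\<gamma> z))) - \<phi> (fst (snd (\<gamma> y)))) + l * norm (\<phi> (fst (snd (\<gamma> y))) - \<phi> (fst (snd (\<gamma> x))))"
    using l by (simp flip: distrib_left add: mult_left_mono)
  moreover have "?M * (fst (\<gamma> z) - fst (\<gamma> x)) = ?M * (fst (\<gamma> z) - fst (\<gamma> y)) + ?M * (fst (\<gamma> y) - fst (\<gamma> x))"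
    unfolding distrib_left[symmetric] by simp
  ultimately show "snd (snd (\<gamma> z)) - snd (snd (\<gamma> x)) \<ge> l * norm (\<phi> (fst (snd (\<gamma> z))) - \<phi> (fst (snd (\<gamma> x)))) 
    - ?M * (fst (\<gamma> z) - fst (\<gamma> x))"
    using 1 2 by linarith
qed

text \<open>The point at issue is that the curve is still in \<open>U\<close> when it reaches the
  sphere. The preimage of the closed ball is compact, hence closed as Q is Hausdorff, so it contains
  the limit at the exit time.\<close>

lemma first_exit:
  fixes q :: "real \<Rightarrow> 'q"
  assumes c: "(U, \<phi>) \<in> A" and ball: "cball z \<rho> \<subseteq> \<phi> ` U" and q: "continuous_on {s0..s1} q"
    and s0: "q s0 \<in> U" "\<phi> (q s0) \<in> ball z \<rho>"
    and ex: "s2 \<in> {s0..s1}" "\<not> (q s2 \<in> U \<and> \<phi> (q s2) \<in> ball z \<rho>)"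
  obtains s where "s0 < s" "s \<le> s2" "\<And>u. u \<in> {s0..s} \<Longrightarrow> q u \<in> U \<and> \<phi> (q u) \<in> cball z \<rho>" 
    "dist z (\<phi> (q s)) = \<rho>"
proof -
  let ?W = "U \<inter> \<phi> -` ball z \<rho>"
  have pre: "closed {u \<in> {s0..s1}. q u \<in> K}" if "closed K" for K
  proof -
    have "closed (q -` K \<inter> {s0..s1})"
      using q that continuous_on_closed_vimage[OF closed_atLeastAtMost, of s0 s1 q] by blast
    moreover have "q -` K \<inter> {s0..s1} = {u \<in> {s0..s1}. q u \<in> K}"
      by auto
    ultimately show ?thesis
      by simp
  qed
  have W: "open ?W"
    using continuous_open_preimage[OF chartD(4,1)[OF c] open_ball] .
  let ?S = "{u \<in> {s0..s1}. q u \<in> - ?W}"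
  have S: "closed ?S"
    by (rule pre[OF closed_Compl[OF W]])
  have s2S: "s2 \<in> ?S"
    using ex by auto
  define s where "s = Inf ?S"
  have bdd: "bdd_below ?S"
    by (rule bdd_belowI[of _ s0]) auto
  have sS: "s \<in> ?S"
    unfolding s_def by (rule closed_contains_Inf[OF _ bdd S]) (use s2S in blast)
  have ss2: "s \<le> s2"
    unfolding s_def using cInf_lower[OF s2S bdd] .
  have s0s: "s0 < s"
  proof -
    have "s \<noteq> s0"
      using s0 sS by auto
    then show ?thesis
      using sS by auto
  qed
  have before: "q u \<in> ?W" if "s0 \<le> u" "u < s" for u
  proof (rule ccontr)
    assume "q u \<notin> ?W"
    then have "u \<in> ?S"
      using that sS by auto
    then show False
      using cInf_lower[OF _ bdd] that unfolding s_def by fastforce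
  qed
  let ?K = "inv_into U \<phi> ` cball z \<rho>"
  have K: "closed ?K"
    using compact_imp_closed[OF compact_continuous_image[OF _ compact_cball]] chartD(5)[OF c] ball
      continuous_on_subset by blast
  have "closed {u \<in> {s0..s1}. q u \<in> ?K}"
    by (rule pre[OF K])
  moreover have "{s0..<s} \<subseteq> {u \<in> {s0..s1}. q u \<in> ?K}"
  proof
    fix u assume u: "u \<in> {s0..<s}"
    then have "q u = inv_into U \<phi> (\<phi> (q u))" "\<phi> (q u) \<in> cball z \<rho>"
      using before[of u] chartD(6)[OF c, of "q u"] by auto
    then show "u \<in> {u \<in> {s0..s1}. q u \<in> ?K}"
      using u sS by auto
  qed
  ultimately have "closure {s0..<s} \<subseteq> {u \<in> {s0..s1}. q u \<in> ?K}"
    using closure_minimal by blast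
  then have all: "q u \<in> ?K" if "u \<in> {s0..s}" for u
    using that s0s by auto
  have KU: "p \<in> U \<and> \<phi> p \<in> cball z \<rho>" if pK: "p \<in> ?K" for p
  proof -
    obtain w where w: "w \<in> cball z \<rho>" "p = inv_into U \<phi> w"
      using pK by blast
    then have "w \<in> \<phi> ` U"
      using ball by blast
    then show ?thesis
      using w inv_into_into f_inv_into_f by metis
  qed
  have fin: "q s \<in> U" "\<phi> (q s) \<in> cball z \<rho>"
    using KU[OF all[of s]] s0s by auto
  then have "dist z (\<phi> (q s)) = \<rho>"
    using sS by auto
  then show ?thesis
    using that[of s] s0s ss2 KU[OF all] by blast
qed

text \<open>A coordinate segment traversed at constant speed in time \<open>h\<close> has kinetic
  energy of order \<open>1 / h^2\<close>, hence action of order \<open>1 / h\<close>. Instead of the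
  exact lift, \<open>y\<close> is given a constant slope large enough for causality.\<close>

lemma reach_local:
  assumes "t0 \<in> T"
  obtains B \<theta> D where "open B" "q0 \<in> B" "\<theta> > 0"
    "\<And>p p' s0 s1. p \<in> B \<Longrightarrow> p' \<in> B \<Longrightarrow> s0 \<in> ball t0 \<theta> \<Longrightarrow> s1 \<in> ball t0 \<theta> \<Longrightarrow> s0 < s1 \<Longrightarrow> 
       reach s0 p s1 p' (D / (s1 - s0))"
proof -
  obtain U \<phi> where c: "(U, \<phi>) \<in> A" "q0 \<in> U"
    using chart_cover .
  have z0: "\<phi> q0 \<in> \<phi> ` U"
    using c by auto
  obtain \<rho> where \<rho>: "\<rho> > 0" "cball t0 \<rho> \<subseteq> T" "cball (\<phi> q0) \<rho> \<subseteq> \<phi> ` U"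
    by (rule chart_box[OF c(1) assms z0])
  obtain C where C: "C \<ge> 0" 
    "\<And>t z u. t \<in> cball t0 \<rho> \<Longrightarrow> z \<in> cball (\<phi> q0) \<rho> \<Longrightarrow> acoord U \<phi> t z u \<le> C * (norm u)\<^sup>2"
    "\<And>t z u. t \<in> cball t0 \<rho> \<Longrightarrow> z \<in> cball (\<phi> q0) \<rho> \<Longrightarrow> \<bar>bcoord U \<phi> t z u\<bar> \<le> C * norm u"
    "\<And>t z. t \<in> cball t0 \<rho> \<Longrightarrow> z \<in> cball (\<phi> q0) \<rho> \<Longrightarrow> \<bar>Vcoord U \<phi> t z\<bar> \<le> C"
    using coord_bounds[OF c(1) compact_cball \<rho>(2) compact_cball \<rho>(3)] by metis
  \<comment> \<open>Radius at most \<open>1/2\<close> makes both the duration \<open>h\<close> and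
    the displacement at most \<open>1\<close>, so that \<open>C / h^2\<close> dominates all three
    terms of the Lagrangian.\<close>
  define \<rho>' where "\<rho>' = min \<rho> (1/2)"
  have \<rho>': "\<rho>' > 0" "\<rho>' \<le> \<rho>" "\<rho>' \<le> 1/2"
    using \<rho>(1) by (auto simp: \<rho>'_def)
  define B where "B = U \<inter> \<phi> -` ball (\<phi> q0) \<rho>'"
  have B: "open B" "q0 \<in> B"
    unfolding B_def using continuous_open_preimage[OF chartD(4,1)[OF c(1)] open_ball] c \<rho>' by auto
  have "reach s0 p s1 p' (3 * C / (s1 - s0))" if p: "p \<in> B" "p' \<in> B" and s: "s0 \<in> ball t0 \<rho>'" 
    "s1 \<in> ball t0 \<rho>'" "s0 < s1" for p p' s0 s1
  proof -
    let ?J = "{s0..s1}"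
    define h where "h = s1 - s0"
    have h: "0 < h" "h \<le> 1"
      using s \<rho>' by (auto simp: h_def dist_real_def)
    have nd: "nondeg ?J"
      using s(3) nondeg_Icc by blast
    define u where "u = (1 / h) *\<^sub>R (\<phi> p' - \<phi> p)"
    define x where "x s = \<phi> p + (s - s0) *\<^sub>R u" for s
    have pz: "\<phi> p \<in> ball (\<phi> q0) \<rho>'" "\<phi> p' \<in> ball (\<phi> q0) \<rho>'" "p \<in> U" "p' \<in> U"
      using p by (auto simp: B_def)
    have xb: "x s \<in> ball (\<phi> q0) \<rho>'" if "s \<in> ?J" for s
    proof -
      let ?r = "(s - s0) / h"
      have "0 \<le> ?r" "?r \<le> 1"
        using that h(1) by (auto simp: h_def)
      then have "(1 - ?r) *\<^sub>R \<phi> p + ?r *\<^sub>R \<phi> p' \<in> ball (\<phi> q0) \<rho>'"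
        using convexD_alt[OF convex_ball pz(1,2)] by blast
      moreover have "x s = (1 - ?r) *\<^sub>R \<phi> p + ?r *\<^sub>R \<phi> p'"
        by (simp add: x_def u_def algebra_simps)
      ultimately show ?thesis
        by simp
    qed
    have xr: "x s \<in> cball (\<phi> q0) \<rho>" if "s \<in> ?J" for s
      using xb[OF that] \<rho>' by auto
    have tr: "s \<in> cball t0 \<rho>" if "s \<in> ?J" for s
      using s that \<rho>' by (auto simp: dist_real_def)
    let ?q = "inv_into U \<phi> \<circ> x"
    have x': "(x has_vector_derivative u) (at s within ?J)" for s
      unfolding x_def has_vector_derivative_def by (auto intro!: derivative_eq_intros)
    have hv: "has_velocity ?J ?q (\<lambda>s. tangent_vector A (inv_into U \<phi> (x s)) (U, \<phi>) u)"
      by (rule has_velocity_chart[OF c(1) _ x']) (use xr \<rho>(3) in auto)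
    have vel: "velocity A ?J ?q s = tangent_vector A (inv_into U \<phi> (x s)) (U, \<phi>) u" if "s \<in> ?J" for s
      by (rule has_velocity_eq_velocity[OF hv nd that]) (auto simp: tangent_vector_def)
    have "dist (\<phi> p) (\<phi> p') < \<rho>' + \<rho>'"
      using dist_triangle_less_add[of "\<phi> p" "\<phi> q0" \<rho>' "\<phi> p'" \<rho>'] pz by (simp add: dist_commute)
    then have "norm (\<phi> p' - \<phi> p) \<le> 1"
      using \<rho>'(3) by (simp add: dist_norm norm_minus_commute)
    then have u: "norm u \<le> 1 / h"
      using h(1) by (simp add: u_def divide_right_mono)
    have u2: "(norm u)\<^sup>2 \<le> 1 / h\<^sup>2"
      using power_mono[OF u, of 2] by (simp add: power_divide)
    have hh: "1 \<le> 1 / h\<^sup>2" "1 / h \<le> 1 / h\<^sup>2"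
      using h by (auto simp: field_simps power2_eq_square mult_le_one)
    \<comment> \<open>Three times the common bound \<open>C / h^2\<close>: after \<open>b\<close>
      and \<open>V\<close> are subtracted one bound is left, and doubling it dominates
      \<open>acoord\<close>.\<close>
    let ?\<eta> = "3 * C / h\<^sup>2"
    have caus: "acoord U \<phi> s (x s) u \<le> 2 * 1 * (?\<eta> - bcoord U \<phi> s (x s) u + Vcoord U \<phi> s (x s) * 1)" 
      if s: "s \<in> ?J" for s
    proof -
      have "acoord U \<phi> s (x s) u \<le> C * (1 / h\<^sup>2)"
        using C(2)[OF tr[OF s] xr[OF s], of u] mult_left_mono[OF u2 C(1)] by linarith
      moreover have "\<bar>bcoord U \<phi> s (x s) u\<bar> \<le> C * (1 / h\<^sup>2)"
        using C(3)[OF tr[OF s] xr[OF s], of u] mult_left_mono[OF u C(1)] mult_left_mono[OF hh(2) C(1)] by linarith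
      moreover have "\<bar>Vcoord U \<phi> s (x s)\<bar> \<le> C * (1 / h\<^sup>2)"
        using C(4)[OF tr[OF s] xr[OF s]] mult_left_mono[OF hh(1) C(1)] by linarith
      ultimately show ?thesis
        by (simp add: abs_le_iff)
    qed
    have apos: "acoord U \<phi> s (x s) u \<ge> 0" if s: "s \<in> ?J" for s
    proof -
      have "s \<in> T" "x s \<in> \<phi> ` U"
        using tr[OF s] xr[OF s] \<rho> by auto
      then show ?thesis
        using acoord_pos[OF c(1), of s "x s" u] acoord_scale[OF c(1), of s "x s" 0 0] by (cases "u = 0") auto
    qed
    have lin: "((\<lambda>s. E * (s - s0)) has_real_derivative E) (at s within ?J)" for E s
      by (auto intro!: derivative_eq_intros)
    have "causal_data ?J (\<lambda>s. s) ?q (\<lambda>s. ?\<eta> * (s - s0)) (\<lambda>_. 1) (\<lambda>_. ?\<eta>)"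
      unfolding causal_data_def
    proof (intro conjI ballI)
      show "(\<lambda>s. s) ` ?J \<subseteq> T"
        using tr \<rho>(2) by auto
      show "C1_curve A ?J ?q"
        using has_velocity_C1_curve[OF hv] .
      fix s assume s: "s \<in> ?J"
      show "let v = velocity A ?J ?q s; \<sigma> = ?\<eta> - b s (?q s) v + V s (?q s) * 1 in
        a s (?q s) v v \<le> 2 * 1 * \<sigma> \<and> (0::real) \<le> 1 \<and> 0 \<le> \<sigma> \<and> 0 < 1 + 2 * \<sigma>"
        using caus[OF s] apos[OF s] unfolding vel[OF s] acoord_def bcoord_def Vcoord_def Let_def by auto
      show "((\<lambda>s. ?\<eta> * (s - s0)) has_real_derivative ?\<eta>) (at s within ?J)"
        by (rule lin)
    qed auto
    from reach_C1_causal[OF this s(3)]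
    have "reach s0 (?q s0) s1 (?q s1) (?\<eta> * h)"
      by (simp add: h_def)
    moreover have "x s0 = \<phi> p" "x s1 = \<phi> p'"
      using h(1) by (auto simp: x_def u_def h_def[symmetric])
    moreover have "?\<eta> * h = 3 * C / h"
      using h(1) by (simp add: power2_eq_square)
    ultimately show ?thesis
      using chartD(6)[OF c(1)] pz by (simp add: h_def[symmetric])
  qed
  then show ?thesis
    using that[OF B \<rho>'(1), of "3 * C"] by blast
qed

text \<open>The property passes between any two points of a set from \<open>reach_local\<close>, so
  connectedness of Q spreads it from \<open>q1\<close> to every \<open>q2\<close>. Radius and
  constant may depend on \<open>q2\<close>.\<close>

lemma reach_global:
  assumes t0: "t0 \<in> T"
  shows "\<exists>B \<theta> D. open B \<and> q2 \<in> B \<and> \<theta> > 0 \<and> (\<forall>p\<in>B. \<forall>s0 s1. s0 \<in> ball t0 \<theta> \<longrightarrow> s1 \<in> ball t0 \<theta> \<longrightarrow> 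
     s0 < s1 \<longrightarrow> reach s0 q1 s1 p (D / (s1 - s0)) \<and> reach s0 p s1 q1 (D / (s1 - s0)))" (is "?P q2")
proof (rule connected_induction_simple[OF connected_Q, of q1 q2 ?P])
  show "?P q1"
    using reach_local[OF t0, of q1] by metis
  fix q
  obtain B \<theta> D where B: "open B" "q \<in> B" "\<theta> > 0"
    "\<And>p p' s0 s1. p \<in> B \<Longrightarrow> p' \<in> B \<Longrightarrow> s0 \<in> ball t0 \<theta> \<Longrightarrow> s1 \<in> ball t0 \<theta> \<Longrightarrow> s0 < s1 \<Longrightarrow> 
       reach s0 p s1 p' (D / (s1 - s0))"
    by (rule reach_local[OF t0, of q]) blast
  have step: "?P x'" if x: "x \<in> B" "x' \<in> B" and P: "?P x" for x x'
  proof -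
    obtain B' \<theta>' D' where B': "x \<in> B'" "\<theta>' > 0" 
      "\<And>p s0 s1. p \<in> B' \<Longrightarrow> s0 \<in> ball t0 \<theta>' \<Longrightarrow> s1 \<in> ball t0 \<theta>' \<Longrightarrow> s0 < s1 \<Longrightarrow> 
       reach s0 q1 s1 p (D' / (s1 - s0)) \<and> reach s0 p s1 q1 (D' / (s1 - s0))"
      using P by blast
    let ?\<theta> = "min \<theta> \<theta>'"
    have "reach s0 q1 s1 p ((2 * D + 2 * D') / (s1 - s0)) \<and> reach s0 p s1 q1 ((2 * D + 2 * D') / (s1 - s0))"
      if p: "p \<in> B" and s: "s0 \<in> ball t0 ?\<theta>" "s1 \<in> ball t0 ?\<theta>" "s0 < s1" for p s0 s1
    proof -
      \<comment> \<open>Each leg gets half of the time, which doubles both constants.\<close>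
      define m where "m = (s0 + s1) / 2"
      have m: "s0 < m" "m < s1" "m - s0 = (s1 - s0) / 2" "s1 - m = (s1 - s0) / 2"
        using s(3) by (auto simp: m_def field_simps)
      have mb: "m \<in> ball t0 ?\<theta>"
        using s m(1,2) by (auto simp: dist_real_def)
      have sum: "D / (m - s0) + D' / (s1 - m) = (2 * D + 2 * D') / (s1 - s0)" 
        "D' / (m - s0) + D / (s1 - m) = (2 * D + 2 * D') / (s1 - s0)"
        unfolding m(3,4) by (simp_all add: add_divide_distrib mult.commute)
      have mem: "s0 \<in> ball t0 \<theta>" "s0 \<in> ball t0 \<theta>'" "s1 \<in> ball t0 \<theta>" "s1 \<in> ball t0 \<theta>'" 
        "m \<in> ball t0 \<theta>" "m \<in> ball t0 \<theta>'"
        using s mb by auto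
      have 1: "reach s0 q1 m x (D' / (m - s0))" "reach m x s1 q1 (D' / (s1 - m))"
        using B'(3)[OF B'(1) mem(2,6) m(1)] B'(3)[OF B'(1) mem(6,4) m(2)] by blast+
      have 2: "reach m x s1 p (D / (s1 - m))" "reach s0 p m x (D / (m - s0))"
        using B(4)[OF x(1) p mem(5,3) m(2)] B(4)[OF p x(1) mem(1,5) m(1)] .
      show ?thesis
        using reach_trans[OF 1(1) 2(1)] reach_trans[OF 2(2) 1(2)] unfolding sum by blast
    qed
    moreover have "?\<theta> > 0"
      using B(3) B'(2) by simp
    ultimately show ?thesis
      using B(1) x(2) by blast
  qed
  show "\<exists>S. openin (top_of_set UNIV) S \<and> q \<in> S \<and> (\<forall>x\<in>S. \<forall>y\<in>S. ?P x \<longrightarrow> ?P y)"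
  proof (rule exI[of _ B], intro conjI ballI impI)
    show "openin (top_of_set UNIV) B"
      unfolding openin_open by (rule exI[of _ B]) (simp add: B(1))
    fix x y assume xy: "x \<in> B" "y \<in> B" "?P x"
    show "?P y"
      using step[OF xy] .
  qed (rule B(2))
qed auto

end

subsection \<open>Short loops of negative action\<close>

text \<open>Serves to meet a finite list of smallness conditions with a single parameter.\<close>

lemma small_multiple:
  fixes S :: "(real \<times> real) set"
  assumes "finite S" "\<And>x y. (x, y) \<in> S \<Longrightarrow> y > 0"
  shows "\<exists>\<eta>>0. \<forall>(x, y)\<in>S. \<bar>x\<bar> * \<eta> \<le> y"
  using assms
proof (induction rule: finite_induct)
  case empty
  then show ?case
    by (intro exI[of _ 1]) auto
next
  case (insert z S)
  obtain x y where z: "z = (x, y)" "y > 0"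
    using insert.prems by (cases z) auto
  obtain \<eta> where \<eta>: "\<eta> > 0" "\<And>x y. (x, y) \<in> S \<Longrightarrow> \<bar>x\<bar> * \<eta> \<le> y"
    using insert by fastforce
  let ?\<eta> = "min \<eta> (y / (\<bar>x\<bar> + 1))"
  have "\<bar>x\<bar> * ?\<eta> \<le> (\<bar>x\<bar> + 1) * (y / (\<bar>x\<bar> + 1))"
    using z \<eta>(1) by (intro mult_mono) auto
  also have "\<dots> = y"
    by simp
  finally have "\<bar>x\<bar> * ?\<eta> \<le> y" .
  moreover have "\<bar>x'\<bar> * ?\<eta> \<le> y'" if "(x', y') \<in> S" for x' y'
    using \<eta>(2)[OF that] mult_left_mono[of ?\<eta> \<eta> "\<bar>x'\<bar>"] by simp
  ultimately have "\<forall>(x, y)\<in>insert z S. \<bar>x\<bar> * ?\<eta> \<le> y"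
    using z(1) by auto
  moreover have "?\<eta> > 0"
    using z(2) \<eta>(1) by (simp add: add_nonneg_pos)
  ultimately show ?case
    by blast
qed

context gravitational_wave
begin

section \<open>Semi-continuity on the diagonal and its failure\<close>

abbreviation "Sact \<equiv> least_action A a b V"

abbreviation lsc_diag :: "real \<Rightarrow> 'q \<Rightarrow> bool" where
  "lsc_diag t q \<equiv> lsc_at_within ((t, q), (t, q)) (classical_spacetime T \<times> classical_spacetime T)
                (\<lambda>(e\<^sub>0, e\<^sub>1). Sact e\<^sub>0 e\<^sub>1)"

lemma rest_curve_least_action:
  assumes "rest_curve x0 p0 x1 p1 E"
  shows "Sact (x0, p0) (x1, p1) \<le> ereal E"
proof -
  obtain q where q: "x0 < x1" "C1_curve A {x0..x1} q" "q x0 = p0" "q x1 = p1" "action A a b V x0 x1 q \<le> E"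
    using assms unfolding rest_curve_def by blast
  have "Sact (x0, p0) (x1, p1) = 
      (INF q \<in> {q. C1_curve A {x0..x1} q \<and> q x0 = p0 \<and> q x1 = p1}. ereal (action A a b V x0 x1 q))"
    using q(1) by (simp add: least_action_def)
  also have "\<dots> \<le> ereal E"
    by (rule INF_lower2[of q]) (use q in auto)
  finally show ?thesis .
qed

text \<open>Any fixed negative level would do; \<open>-1\<close> is below the value \<open>0\<close>
  on the diagonal.\<close>

lemma lsc_diagD:
  assumes lsc: "lsc_diag t q"
  obtains \<theta> where "\<theta> > 0" "\<And>t0 t1. t0 \<in> ball t \<theta> \<Longrightarrow> t1 \<in> ball t \<theta> \<Longrightarrow> t0 \<in> T \<Longrightarrow> t1 \<in> T \<Longrightarrow> t0 < t1 \<Longrightarrow> 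
     Sact (t0, q) (t1, q) > -1"
proof -
  have "Sact (t, q) (t, q) = 0"
    by (simp add: least_action_def)
  then have "\<forall>\<^sub>F x' in at ((t, q), (t, q)) within classical_spacetime T \<times> classical_spacetime T. 
      -1 < (\<lambda>(e\<^sub>0, e\<^sub>1). Sact e\<^sub>0 e\<^sub>1) x'"
    using lsc unfolding lsc_at_within_def by auto
  then obtain N where N: "open N" "((t, q), (t, q)) \<in> N" 
    "\<And>x'. x' \<in> N \<Longrightarrow> x' \<noteq> ((t, q), (t, q)) \<Longrightarrow> x' \<in> classical_spacetime T \<times> classical_spacetime T \<Longrightarrow> 
        -1 < (\<lambda>(e\<^sub>0, e\<^sub>1). Sact e\<^sub>0 e\<^sub>1) x'"
    unfolding eventually_at_topological by blast
  obtain N1 N2 where N12: "open N1" "open N2" "(t, q) \<in> N1" "(t, q) \<in> N2" "N1 \<times> N2 \<subseteq> N"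
    using open_prod_elim[OF N(1,2)] by (metis SigmaD1 SigmaD2)
  obtain A1 B1 where AB1: "open A1" "t \<in> A1" "q \<in> B1" "A1 \<times> B1 \<subseteq> N1"
    using open_prod_elim[OF N12(1,3)] by (metis SigmaD1 SigmaD2)
  obtain A2 B2 where AB2: "open A2" "t \<in> A2" "q \<in> B2" "A2 \<times> B2 \<subseteq> N2"
    using open_prod_elim[OF N12(2,4)] by (metis SigmaD1 SigmaD2)
  obtain \<theta> where \<theta>: "\<theta> > 0" "ball t \<theta> \<subseteq> A1 \<inter> A2"
    using open_contains_ball[of "A1 \<inter> A2"] AB1 AB2 by (metis IntI open_Int)
  show ?thesis
  proof (rule that[OF \<theta>(1)])
    fix t0 t1 assume t: "t0 \<in> ball t \<theta>" "t1 \<in> ball t \<theta>" "t0 \<in> T" "t1 \<in> T" "t0 < t1"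
    have "((t0, q), (t1, q)) \<in> N"
      using t \<theta> AB1 AB2 N12 by blast
    moreover have "((t0, q), (t1, q)) \<noteq> ((t, q), (t, q))"
      using t by auto
    moreover have "((t0, q), (t1, q)) \<in> classical_spacetime T \<times> classical_spacetime T"
      using t by (auto simp: classical_spacetime_def)
    ultimately show "Sact (t0, q) (t1, q) > -1"
      using N(3) by fastforce
  qed
qed

lemma not_lsc_diagD:
  assumes "\<not> lsc_diag t q"
  obtains c where "c < 0" "\<And>\<theta> B. \<theta> > 0 \<Longrightarrow> open B \<Longrightarrow> q \<in> B \<Longrightarrow> \<exists>t0 t1 p. t0 \<in> ball t \<theta> \<and> t1 \<in> ball t \<theta> \<and> 
    t0 \<in> T \<and> t1 \<in> T \<and> t0 < t1 \<and> C1_curve A {t0..t1} p \<and> p t0 \<in> B \<and> p t1 \<in> B \<and> action A a b V t0 t1 p < c"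
proof -
  have "Sact (t, q) (t, q) = 0"
    by (simp add: least_action_def)
  then obtain d where d: "d < 0" "\<not> (\<forall>\<^sub>F x' in at ((t, q), (t, q)) within 
      classical_spacetime T \<times> classical_spacetime T. d < (\<lambda>(e\<^sub>0, e\<^sub>1). Sact e\<^sub>0 e\<^sub>1) x')"
    using assms unfolding lsc_at_within_def by auto
  \<comment> \<open>A level strictly above \<open>d\<close>, so that an infimum at most
    \<open>d\<close> yields an actual curve of action below it; it is real although \<open>d\<close>
    may be minus infinity.\<close>
  obtain c where c: "d < ereal c" "ereal c < 0"
    using ereal_dense2[OF d(1)] by blast
  show ?thesis
  proof (rule that[of c])
    show "c < 0"
      using c(2) by simp
    fix \<theta> B assume \<theta>: "(\<theta>::real) > 0" and B: "open B" "q \<in> B"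
    let ?N = "(ball t \<theta> \<times> B) \<times> (ball t \<theta> \<times> B)"
    have "open ?N" "((t, q), (t, q)) \<in> ?N"
      using \<theta> B by (auto intro!: open_Times)
    then obtain x' where x': "x' \<in> ?N" "x' \<in> classical_spacetime T \<times> classical_spacetime T" 
      "\<not> d < (\<lambda>(e\<^sub>0, e\<^sub>1). Sact e\<^sub>0 e\<^sub>1) x'"
      using d(2) unfolding eventually_at_topological by blast
    obtain t0 p0 t1 p1 where x: "x' = ((t0, p0), (t1, p1))"
      by (metis surj_pair)
    have m: "t0 \<in> ball t \<theta>" "t1 \<in> ball t \<theta>" "p0 \<in> B" "p1 \<in> B" "t0 \<in> T" "t1 \<in> T" "Sact (t0, p0) (t1, p1) < ereal c"
      using x' c(1) unfolding x by (auto simp: classical_spacetime_def)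
    \<comment> \<open>By the conventions for pairs without \<open>t0 < t1\<close> the least action
      there is \<open>0\<close> or infinite, never negative.\<close>
    have lt: "t0 < t1"
    proof (rule ccontr)
      assume "\<not> t0 < t1"
      then have "Sact (t0, p0) (t1, p1) \<ge> 0"
        by (auto simp: least_action_def)
      then show False
        using m(7) c(2) by (meson less_trans not_less)
    qed
    then have "(INF q \<in> {q. C1_curve A {t0..t1} q \<and> q t0 = p0 \<and> q t1 = p1}. ereal (action A a b V t0 t1 q)) < ereal c"
      using m(7) by (simp add: least_action_def)
    then obtain p where "C1_curve A {t0..t1} p" "p t0 = p0" "p t1 = p1" "action A a b V t0 t1 p < c"
      unfolding INF_less_iff by auto
    then show "\<exists>t0 t1 p. t0 \<in> ball t \<theta> \<and> t1 \<in> ball t \<theta> \<and> t0 \<in> T \<and> t1 \<in> T \<and> t0 < t1 \<and> 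
        C1_curve A {t0..t1} p \<and> p t0 \<in> B \<and> p t1 \<in> B \<and> action A a b V t0 t1 p < c"
      using m lt by blast
  qed
qed

lemma chart_box_open:
  assumes c: "(U, \<phi>) \<in> A" "q \<in> U" and "t \<in> T" "open B" "q \<in> B"
  obtains \<rho> where "\<rho> > 0" "cball t \<rho> \<subseteq> T" "cball (\<phi> q) \<rho> \<subseteq> \<phi> ` U" 
    "\<And>p. p \<in> U \<Longrightarrow> \<phi> p \<in> cball (\<phi> q) \<rho> \<Longrightarrow> p \<in> B"
proof -
  have "\<phi> q \<in> \<phi> ` (U \<inter> B)"
    using assms by auto
  then obtain r1 where r1: "r1 > 0" "cball (\<phi> q) r1 \<subseteq> \<phi> ` (U \<inter> B)"
    using open_contains_cball open_chart_image[OF c(1) assms(4)] by meson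
  obtain r2 where r2: "r2 > 0" "cball t r2 \<subseteq> T"
    using open_contains_cball T_interval(2) assms(3) by meson
  have "cball (\<phi> q) (min r1 r2) \<subseteq> \<phi> ` (U \<inter> B)" "cball t (min r1 r2) \<subseteq> T"
    using r1(2) r2(2) by auto
  moreover have "p \<in> B" if "p \<in> U" "\<phi> p \<in> \<phi> ` (U \<inter> B)" for p
    using that inj_onD[OF chartD(3)[OF c(1)]] by blast
  ultimately show ?thesis
    using that[of "min r1 r2"] r1(1) r2(1) by (meson Int_lower1 image_mono min_less_iff_conj order_trans subsetD)
qed

text \<open>A curve of short duration \<open>e\<close> and negative action has to leave a fixed ball, which costs at
  least \<open>\<beta> / e\<close>. Replacing its initial part by a slower one, of duration \<open>m e\<close>, costs only
  \<open>D / (m e)\<close>; hence there are short loops with arbitrarily negative action.\<close>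

lemma negative_loops:
  assumes nl: "\<not> lsc_diag t q" and t: "t \<in> T" and \<theta>: "\<theta> > 0"
  obtains s0 s1 p where "s0 \<in> ball t \<theta>" "s1 \<in> ball t \<theta>" "s0 \<in> T" "s1 \<in> T" "s0 < s1"
    "C1_curve A {s0..s1} p" "p s0 = q" "p s1 = q" "action A a b V s0 s1 p \<le> - K"
proof -
  obtain c where c0: "c < 0" and curves: "\<And>\<theta> B. \<theta> > 0 \<Longrightarrow> open B \<Longrightarrow> q \<in> B \<Longrightarrow> \<exists>t0 t1 p. t0 \<in> ball t \<theta> \<and> t1 \<in> ball t \<theta> \<and> 
    t0 \<in> T \<and> t1 \<in> T \<and> t0 < t1 \<and> C1_curve A {t0..t1} p \<and> p t0 \<in> B \<and> p t1 \<in> B \<and> action A a b V t0 t1 p < c"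
    using not_lsc_diagD[OF nl] by metis
  obtain B \<theta>1 D where B: "open B" "q \<in> B" "\<theta>1 > 0"
    "\<And>p p' s0 s1. p \<in> B \<Longrightarrow> p' \<in> B \<Longrightarrow> s0 \<in> ball t \<theta>1 \<Longrightarrow> s1 \<in> ball t \<theta>1 \<Longrightarrow> s0 < s1 \<Longrightarrow> 
       reach s0 p s1 p' (D / (s1 - s0))"
    by (rule reach_local[OF t, of q]) blast
  obtain U \<phi> where c: "(U, \<phi>) \<in> A" "q \<in> U"
    using chart_cover .
  obtain \<rho> where \<rho>: "\<rho> > 0" "cball t \<rho> \<subseteq> T" "cball (\<phi> q) \<rho> \<subseteq> \<phi> ` U" 
    "\<And>p. p \<in> U \<Longrightarrow> \<phi> p \<in> cball (\<phi> q) \<rho> \<Longrightarrow> p \<in> B"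
    by (rule chart_box_open[OF c t B(1,2)]) blast
  let ?K1 = "cball t \<rho>" and ?K2 = "cball (\<phi> q) \<rho>"
  obtain k C where kC: "k > 0" "C \<ge> 0" 
    "\<And>t z u. t \<in> ?K1 \<Longrightarrow> z \<in> ?K2 \<Longrightarrow> k * (norm u)\<^sup>2 \<le> acoord U \<phi> t z u"
    "\<And>t z u. t \<in> ?K1 \<Longrightarrow> z \<in> ?K2 \<Longrightarrow> \<bar>bcoord U \<phi> t z u\<bar> \<le> C * norm u"
    "\<And>t z. t \<in> ?K1 \<Longrightarrow> z \<in> ?K2 \<Longrightarrow> \<bar>Vcoord U \<phi> t z\<bar> \<le> C"
    using coord_bounds[OF c(1) compact_cball \<rho>(2) compact_cball \<rho>(3)] by metis
  \<comment> \<open>With slope \<open>l = L / e\<close> and \<open>C * e \<le> L\<close>, the box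
    estimate over half the radius gives at least \<open>(L * \<rho> / 2 - 2 * L^2 / k) / e\<close>
    up to \<open>C * e\<close>. This \<open>L\<close> maximizes the bracket, and
    \<open>\<beta>\<close> is the maximum.\<close>
  define L where "L = k * \<rho> / 8"
  define \<beta> where "\<beta> = k * \<rho>\<^sup>2 / 32"
  have L: "L > 0" "L * \<rho> / 2 - 2 * L\<^sup>2 / k = \<beta>" and \<beta>: "\<beta> > 0"
    using kC(1) \<rho>(1) by (auto simp: L_def \<beta>_def power2_eq_square field_simps)
  \<comment> \<open>Chosen so that the two connections of duration \<open>m * e\<close> together
    cost at most \<open>(\<beta> / 2) / e\<close>, half of what is saved.\<close>
  define m where "m = 4 * \<bar>D\<bar> / \<beta> + 1"
  have m: "m \<ge> 1" "2 * D / m \<le> \<beta> / 2"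
  proof -
    show m1: "m \<ge> 1"
      using \<beta> by (simp add: m_def)
    have "2 * D \<le> m * (\<beta> / 2)"
    proof -
      have "m * (\<beta> / 2) = 2 * \<bar>D\<bar> + \<beta> / 2"
        using \<beta> by (simp add: m_def field_simps)
      then show ?thesis
        using \<beta> by linarith
    qed
    then show "2 * D / m \<le> \<beta> / 2"
      using m1 by (simp add: pos_divide_le_eq mult.commute)
  qed
  define M where "M = C\<^sup>2 / (2 * k) + C"
  have M: "M \<ge> 0"
    using kC(1,2) by (simp add: M_def)
  \<comment> \<open>The first three entries keep all times involved within the required balls. As
    \<open>e < 2 * \<eta>\<close>, the others give
    \<open>(\<beta> / 2) / e \<ge> \<bar>K\<bar> + 2\<close>, \<open>C * e \<le> 1\<close>,
    \<open>C * e \<le> L\<close> and \<open>M * e < - c\<close>.\<close>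
  let ?S = "{(2 + 2 * m, \<theta>), (2 + 2 * m, \<theta>1), (2 + 2 * m, \<rho>), (4 * (\<bar>K\<bar> + 2), \<beta>), 
     (2 * (C + 1), 1), (2 * (C + 1), L), (2 * (M + 1), - c)}"
  have "\<exists>\<eta>>0. \<forall>(x, y)\<in>?S. \<bar>x\<bar> * \<eta> \<le> y"
    by (rule small_multiple) (use \<theta> B(3) \<rho>(1) \<beta> L(1) c0 in auto)
  then obtain \<eta> where "\<eta> > 0" "\<forall>(x, y)\<in>?S. \<bar>x\<bar> * \<eta> \<le> y"
    by blast
  then have \<eta>: "\<eta> > 0" "(2 + 2 * m) * \<eta> \<le> \<theta>" "(2 + 2 * m) * \<eta> \<le> \<theta>1" "(2 + 2 * m) * \<eta> \<le> \<rho>" 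
    "4 * (\<bar>K\<bar> + 2) * \<eta> \<le> \<beta>" "2 * (C + 1) * \<eta> \<le> 1" "2 * (C + 1) * \<eta> \<le> L" "2 * (M + 1) * \<eta> \<le> - c"
    using m(1) M kC(2) by simp_all
  let ?B = "U \<inter> \<phi> -` ball (\<phi> q) (\<rho>/2)"
  define B' where "B' = ?B"
  have "open B'" "q \<in> B'"
    using continuous_open_preimage[OF chartD(4,1)[OF c(1)] open_ball] c \<rho>(1) by (auto simp: B'_def)
  then obtain t0 t1 p where p0: "t0 \<in> ball t \<eta>" "t1 \<in> ball t \<eta>" 
    "t0 \<in> T" "t1 \<in> T" "t0 < t1" "C1_curve A {t0..t1} p" "p t0 \<in> B'" "p t1 \<in> B'" "action A a b V t0 t1 p < c"
    using curves[OF \<eta>(1)] by metis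
  note p = p0[unfolded B'_def]
  define e where "e = t1 - t0"
  have e: "e > 0" "e < 2 * \<eta>"
    using p by (auto simp: e_def dist_real_def)
  have mg: "m * e \<le> 2 * (m * \<eta>)" "0 < m * e"
    using mult_left_mono[of e "2 * \<eta>" m] e m by auto
  have m\<eta>: "m * \<eta> \<ge> \<eta>"
    using m \<eta>(1) by simp
  have t01: "t - \<eta> < t0" "t1 < t + \<eta>"
    using p(1,2) by (auto simp: dist_real_def)
  have inb: "x \<in> ball t R" if "t0 - m * e \<le> x" "x \<le> t1 + m * e + \<eta>" "(2 + 2 * m) * \<eta> \<le> R" for x R
  proof -
    have "2 * \<eta> + 2 * (m * \<eta>) \<le> R"
      using that(3) by (simp add: distrib_right)
    then have "x - t < R" "t - x < R"
      using that(1,2) t01 mg(1) \<eta>(1) by linarith+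
    then show ?thesis
      by (simp add: dist_real_def abs_less_iff)
  qed
  have Ce: "C * e \<le> 1" "C * e \<le> L" "M * e < - c" "(\<bar>K\<bar> + 2) * (2 * e) \<le> \<beta>"
  proof -
    have "C * e \<le> (C + 1) * (2 * \<eta>)" "M * e \<le> M * (2 * \<eta>)" 
      by (rule mult_mono; use e kC(2) M in linarith)+
    moreover have "(C + 1) * (2 * \<eta>) = 2 * (C + 1) * \<eta>" "M * (2 * \<eta>) < 2 * (M + 1) * \<eta>"
      using \<eta>(1) by (auto simp: algebra_simps)
    moreover have "(\<bar>K\<bar> + 2) * (2 * e) \<le> (\<bar>K\<bar> + 2) * (4 * \<eta>)"
      using e by (intro mult_left_mono) auto
    moreover have "(\<bar>K\<bar> + 2) * (4 * \<eta>) = 4 * (\<bar>K\<bar> + 2) * \<eta>"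
      by simp
    ultimately show "C * e \<le> 1" "C * e \<le> L" "M * e < - c" "(\<bar>K\<bar> + 2) * (2 * e) \<le> \<beta>"
      using \<eta>(5-8) by linarith+
  qed
  have TK: "{t0..t1} \<subseteq> T" "{t0..t1} \<subseteq> ?K1"
  proof -
    show "{t0..t1} \<subseteq> T"
      using Icc_subset_T p(3,4) by blast
    show "{t0..t1} \<subseteq> ?K1"
    proof
      fix x assume "x \<in> {t0..t1}"
      then have "x \<in> ball t \<rho>"
        using mg(2) \<eta>(1) by (intro inb[OF _ _ \<eta>(4)]) auto
      then show "x \<in> ?K1"
        by simp
    qed
  qed
  obtain y \<eta>' where y: "y t0 = 0" "y t1 = 0 + action A a b V t0 t1 p" 
    "causal_data {t0..t1} (\<lambda>s. s) p y (\<lambda>_. 1) \<eta>'"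
    by (rule null_lift[OF p(6,5) TK(1)])
  have nd: "nondeg {t0..t1}"
    using p(5) nondeg_Icc by blast
  have cp: "continuous_on {t0..t1} p"
    using p(6) unfolding C1_curve_def by auto
  \<comment> \<open>Inside the ball the estimate with \<open>l = 0\<close> bounds the action below
    by \<open>- M * e\<close>, which exceeds \<open>c\<close>.\<close>
  have "\<exists>s2\<in>{t0..t1}. \<not> (p s2 \<in> U \<and> \<phi> (p s2) \<in> ball (\<phi> q) \<rho>)"
  proof (rule ccontr)
    assume "\<not> ?thesis"
    then have "s \<in> ?K1 \<and> p s \<in> U \<and> \<phi> (p s) \<in> ?K2" if "s \<in> {t0..t1}" for s
      using that TK(2) by (auto simp: less_imp_le)
    from causal_data_box_estimate[OF y(3) p(5) c(1) this kC(1,3,2,4,5), of 0]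
    show False
      using Ce(3) p(9) y(1,2) by (simp add: M_def e_def)
  qed
  then obtain s2 where s2: "s2 \<in> {t0..t1}" "\<not> (p s2 \<in> U \<and> \<phi> (p s2) \<in> ball (\<phi> q) \<rho>)"
    by blast
  have pt0: "p t0 \<in> U" "\<phi> (p t0) \<in> ball (\<phi> q) \<rho>"
    using p(7) \<rho>(1) by auto
  obtain s where s: "t0 < s" "s \<le> s2" "\<And>u. u \<in> {t0..s} \<Longrightarrow> p u \<in> U \<and> \<phi> (p u) \<in> cball (\<phi> q) \<rho>" 
    "dist (\<phi> q) (\<phi> (p s)) = \<rho>"
    by (rule first_exit[OF c(1) \<rho>(3) cp pt0 s2]) blast
  have st1: "s < t1"
    using s s2 p(8) \<rho>(1) by (cases "s = t1") auto
  have sub: "causal_data {t0..s} (\<lambda>s. s) p y (\<lambda>_. 1) \<eta>'" "causal_data {s..t1} (\<lambda>s. s) p y (\<lambda>_. 1) \<eta>'"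
    using causal_data_subset[OF y(3) nd _ nondeg_Icc] s(1) st1 by auto
  have bx: "u \<in> ?K1 \<and> p u \<in> U \<and> \<phi> (p u) \<in> ?K2" if "u \<in> {t0..s}" for u
    using s(3)[OF that] subsetD[OF TK(2), of u] that st1 by simp
  define l where "l = L / e"
  have l: "l \<ge> 0"
    using L e by (simp add: l_def)
  have le: "l * e = L"
    using e by (simp add: l_def)
  have est: "y s - y t0 \<ge> l * norm (\<phi> (p s) - \<phi> (p t0)) - ((l + C)\<^sup>2 / (2 * k) + C) * (s - t0)"
    using causal_data_box_estimate[OF sub(1) s(1) c(1) bx kC(1,3,2,4,5) l] .
  have far: "norm (\<phi> (p s) - \<phi> (p t0)) \<ge> \<rho> / 2"
    using dist_triangle[of "\<phi> q" "\<phi> (p s)" "\<phi> (p t0)"] s(4) p(7) by (auto simp: dist_norm norm_minus_commute)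
  have first: "y s - y t0 \<ge> \<beta> / e - C * e"
  proof -
    have "(l + C)\<^sup>2 * e\<^sup>2 = (L + C * e)\<^sup>2"
      unfolding power_mult_distrib[symmetric] by (simp add: distrib_right le)
    also have "\<dots> \<le> (2 * L)\<^sup>2"
      using Ce(2) kC(2) e L by (intro power_mono) auto
    finally have sq: "(l + C)\<^sup>2 * e\<^sup>2 \<le> 4 * L\<^sup>2"
      by (simp add: power_mult_distrib)
    have "(l + C)\<^sup>2 / (2 * k) * e = (l + C)\<^sup>2 * e\<^sup>2 / (2 * k * e)"
      using e by (simp add: power2_eq_square)
    also have "\<dots> \<le> 4 * L\<^sup>2 / (2 * k * e)"
      using sq kC(1) e by (intro divide_right_mono) auto
    finally have 1: "(l + C)\<^sup>2 / (2 * k) * e \<le> (2 * L\<^sup>2 / k) / e"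
      by (simp add: mult.commute)
    have 2: "((l + C)\<^sup>2 / (2 * k) + C) * (s - t0) \<le> ((l + C)\<^sup>2 / (2 * k) + C) * e"
      using kC st1 by (intro mult_left_mono) (auto simp: e_def)
    have 3: "l * (\<rho> / 2) \<le> l * norm (\<phi> (p s) - \<phi> (p t0))"
      using far l by (intro mult_left_mono) auto
    have 4: "l * (\<rho> / 2) = (L * \<rho> / 2) / e"
      by (simp add: l_def)
    have "\<beta> / e = (L * \<rho> / 2) / e - (2 * L\<^sup>2 / k) / e"
      unfolding diff_divide_distrib[symmetric] L(2) ..
    then show ?thesis
      using est 1 2 3 4 by (simp add: distrib_right)
  qed
  have ps: "p s \<in> B" "p t1 \<in> B"
    using \<rho>(4)[of "p s"] s(3)[of s] s(1) \<rho>(4)[of "p t1"] p(8) \<rho>(1) by auto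
  have far2: "s - m * e \<in> ball t \<theta>1" "s \<in> ball t \<theta>1" "t1 \<in> ball t \<theta>1" "t1 + m * e \<in> ball t \<theta>1"
    by (rule inb[OF _ _ \<eta>(3)]; use s(1) st1 mg(2) \<eta>(1) in linarith)+
  have "reach (s - m * e) q s (p s) (D / (m * e))" "reach t1 (p t1) (t1 + m * e) q (D / (m * e))"
    using B(4)[OF B(2) ps(1) far2(1,2)] B(4)[OF ps(2) B(2) far2(3,4)] mg(2) by auto
  moreover have "reach s (p s) t1 (p t1) (y t1 - y s)"
    using reach_C1_causal[OF sub(2) st1] .
  ultimately have "reach (s - m * e) q (t1 + m * e) q (D / (m * e) + (y t1 - y s) + D / (m * e))"
    using reach_trans by blast
  \<comment> \<open>The error allowed in \<open>reach\<close> adds at most \<open>1\<close> to the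
    action, as does \<open>C * e\<close>; this accounts for the \<open>2\<close> in
    \<open>\<bar>K\<bar> + 2\<close>.\<close>
  then obtain \<delta> where \<delta>: "\<delta> > 0" "\<forall>t0'\<in>{s - m * e..s - m * e + \<delta>}. \<exists>t1'. t1 + m * e < t1' \<and> 
      t1' < t1 + m * e + min 1 \<eta> \<and> rest_curve t0' q t1' q (D / (m * e) + (y t1 - y s) + D / (m * e) + min 1 \<eta>)"
    unfolding reach_def using \<eta>(1) by (metis min_less_iff_conj zero_less_one)
  then obtain x1 where x1: "t1 + m * e < x1" "x1 < t1 + m * e + min 1 \<eta>"
    "rest_curve (s - m * e) q x1 q (D / (m * e) + (y t1 - y s) + D / (m * e) + min 1 \<eta>)"
    by (metis atLeastAtMost_iff less_eq_real_def order_refl le_add_same_cancel1)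
  obtain p' where p': "s - m * e < x1" "s - m * e \<in> T" "x1 \<in> T" "C1_curve A {s - m * e..x1} p'" 
    "p' (s - m * e) = q" "p' x1 = q" 
    "action A a b V (s - m * e) x1 p' \<le> D / (m * e) + (y t1 - y s) + D / (m * e) + min 1 \<eta>"
    using x1(3) unfolding rest_curve_def by blast
  have "D / (m * e) + D / (m * e) = (2 * D / m) / e"
    by (simp add: field_simps)
  also have "\<dots> \<le> (\<beta> / 2) / e"
    using m(2) e by (intro divide_right_mono) auto
  finally have 5: "D / (m * e) + D / (m * e) \<le> (\<beta> / 2) / e" .
  have "\<beta> / e = (\<beta> / 2) / e + (\<beta> / 2) / e"
    by (simp add: add_divide_distrib[symmetric])
  moreover have "(\<beta> / 2) / e \<ge> \<bar>K\<bar> + 2"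
    using Ce(4) e by (simp add: pos_le_divide_eq)
  moreover have "y t1 - y s \<le> c - (\<beta> / e - C * e)"
    using first y(1,2) p(9) by linarith
  ultimately have act: "action A a b V (s - m * e) x1 p' \<le> - K"
    using p'(7) 5 Ce(1) c0 by linarith
  have "s - m * e \<in> ball t \<theta>" "x1 \<in> ball t \<theta>"
    by (rule inb[OF _ _ \<eta>(2)]; use s(1) st1 mg(2) \<eta>(1) x1(1,2) in linarith)+
  then show ?thesis
    using that p' act by blast
qed

end

subsection \<open>Strong causality\<close>

lemma interval_one_sided:
  fixes s :: real
  assumes "is_interval J" "J \<subseteq> {\<alpha>..\<beta>}" "s \<notin> interior J"
  shows "J \<subseteq> {\<alpha>..s} \<or> J \<subseteq> {s..\<beta>}"
proof (rule ccontr)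
  assume "\<not> ?thesis"
  then obtain x y where "x \<in> J" "y \<in> J" "x \<notin> {s..\<beta>}" "y \<notin> {\<alpha>..s}"
    by blast
  then have xy: "x \<in> J" "y \<in> J" "x < s" "s < y"
    using assms(2) by (auto simp: subset_iff)
  have "{x<..<y} \<subseteq> J"
    using mem_is_interval_1_I[OF assms(1) xy(1,2)] by auto
  then have "{x<..<y} \<subseteq> interior J"
    by (simp add: interior_maximal)
  then show False
    using xy assms(3) by auto
qed

context gravitational_wave
begin

section \<open>Negative loops destroy strong causality\<close>

lemma causal_data_cong:
  assumes cd: "causal_data J t q y \<tau> \<eta>" and nd: "nondeg J"
    and eq: "\<And>s. s \<in> J \<Longrightarrow> t' s = t s" "\<And>s. s \<in> J \<Longrightarrow> q' s = q s" "\<And>s. s \<in> J \<Longrightarrow> y' s = y s"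
  shows "causal_data J t' q' y' \<tau> \<eta>"
proof -
  have q: "C1_curve A J q"
    using cd unfolding causal_data_def by auto
  have hv: "has_velocity J q' (velocity A J q)"
    by (rule has_velocity_cong[OF C1_curve_has_velocity[OF q nd]]) (use eq in auto)
  have vel: "velocity A J q' s = velocity A J q s" if "s \<in> J" for s
    by (rule has_velocity_eq_velocity[OF hv nd that]) (use eq(2)[OF that] in \<open>auto simp: velocity_def\<close>)
  have "(t' has_real_derivative \<tau> s) (at s within J)" "(y' has_real_derivative \<eta> s) (at s within J)" if s: "s \<in> J" for s
  proof -
    have "(t has_real_derivative \<tau> s) (at s within J)" "(y has_real_derivative \<eta> s) (at s within J)"
      using cd s unfolding causal_data_def by auto
    then show "(t' has_real_derivative \<tau> s) (at s within J)" "(y' has_real_derivative \<eta> s) (at s within J)"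
      using has_field_derivative_transform_within[OF _ zero_less_one s] eq by metis+
  qed
  then show ?thesis
    using cd has_velocity_C1_curve[OF hv] eq vel unfolding causal_data_def by (auto simp: image_subset_iff)
qed

text \<open>The vector field along \<open>y\<close> is null and future directed, with
  \<open>\<tau> = 0\<close> and \<open>\<sigma> = 1\<close>, so height can be regained without
  spending time.\<close>

lemma vertical_causal_data:
  assumes "t0 \<in> T" "\<alpha> < \<beta>"
  shows "causal_data {\<alpha>..\<beta>} (\<lambda>_. t0) (\<lambda>_. p) (\<lambda>s. y0 + (s - \<alpha>)) (\<lambda>_. 0) (\<lambda>_. 1)"
proof -
  let ?J = "{\<alpha>..\<beta>}"
  have nd: "nondeg ?J"
    using assms nondeg_Icc by blast
  have hv: "has_velocity ?J (\<lambda>_. p) (\<lambda>_ _. 0)"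
    unfolding has_velocity_def by (auto simp: comp_def)
  have vel: "velocity A ?J (\<lambda>_. p) s = (\<lambda>_. 0)" if "s \<in> ?J" for s
    by (rule has_velocity_eq_velocity[OF hv nd that]) auto
  obtain U \<phi> where c: "(U, \<phi>) \<in> A" "p \<in> U"
    using chart_cover .
  have "\<phi> p \<in> \<phi> ` U"
    using c by auto
  then have "a t0 p (\<lambda>_. 0) (\<lambda>_. 0) = 0" "b t0 p (\<lambda>_. 0) = 0"
    using acoord_scale[OF c(1) assms(1), of "\<phi> p" 0 0] bcoord_scale[OF c(1) assms(1), of "\<phi> p" 0 0] 
      tangent_vector_0[OF c] chartD(6)[OF c] by (simp_all add: acoord_def bcoord_def Let_def)
  moreover have "((\<lambda>s. y0 + (s - \<alpha>)) has_real_derivative 1) (at s within ?J)" for s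
    by (auto intro!: derivative_eq_intros)
  ultimately show ?thesis
    using has_velocity_C1_curve[OF hv] assms unfolding causal_data_def by (auto simp: vel Let_def)
qed

text \<open>The null lift of a loop descends from height \<open>y\<close> to \<open>y - h\<close>
  with \<open>h \<ge> 2\<close>, and a vertical segment at time \<open>s1\<close> returns to
  \<open>y\<close>. A connected trace in \<open>W\<close> would keep the lift above
  \<open>y - 1\<close> at all times before \<open>s1\<close>, hence at least at \<open>y - 1\<close>
  in the limit.\<close>

lemma negative_loop_not_strongly_causal:
  assumes loops: "\<And>\<theta>. \<theta> > 0 \<Longrightarrow> \<exists>s0 s1 p. s0 \<in> ball t \<theta> \<and> s1 \<in> ball t \<theta> \<and> s0 \<in> T \<and> s1 \<in> T \<and> s0 < s1 \<and>
    C1_curve A {s0..s1} p \<and> p s0 = q \<and> p s1 = q \<and> action A a b V s0 s1 p \<le> - 2"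
  shows "\<not> strongly_causal_at A T a b V (t, q, y)"
proof
  assume sc: "strongly_causal_at A T a b V (t, q, y)"
  let ?N = "UNIV \<times> UNIV \<times> {y - 1<..<y + 1} :: (real \<times> 'q \<times> real) set"
  have "open ?N" "(t, q, y) \<in> ?N"
    by (auto intro!: open_Times)
  then obtain W where W: "open W" "(t, q, y) \<in> W" "W \<subseteq> ?N" 
    "\<And>I \<gamma>. causal_curve A T a b V I \<gamma> \<Longrightarrow> connected (\<gamma> ` I \<inter> W)"
    using sc unfolding strongly_causal_at_def by (metis le_inf_iff)
  obtain A1 R where A1: "open A1" "t \<in> A1" "(q, y) \<in> R" "A1 \<times> R \<subseteq> W"
    using open_prod_elim[OF W(1,2)] by (metis SigmaD1 SigmaD2)
  obtain \<theta> where \<theta>: "\<theta> > 0" "ball t \<theta> \<subseteq> A1"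
    using open_contains_ball A1(1,2) by blast
  obtain s0 s1 p where p: "s0 \<in> ball t \<theta>" "s1 \<in> ball t \<theta>" "s0 \<in> T" "s1 \<in> T" "s0 < s1"
    "C1_curve A {s0..s1} p" "p s0 = q" "p s1 = q" "action A a b V s0 s1 p \<le> - 2"
    using loops[OF \<theta>(1)] by blast
  have inW: "(s0, q, y) \<in> W" "(s1, q, y) \<in> W"
    using p(1,2) \<theta>(2) A1(3,4) by auto
  obtain z \<eta> where z: "z s0 = y" "z s1 = y + action A a b V s0 s1 p" 
    "causal_data {s0..s1} (\<lambda>s. s) p z (\<lambda>_. 1) \<eta>"
    by (rule null_lift[OF p(6,5) Icc_subset_T[OF p(3,4)]])
  define h where "h = y - z s1"
  have h: "h \<ge> 2"
    using z(2) p(9) by (simp add: h_def)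
  let ?t = "\<lambda>s. if s \<le> s1 then s else s1"
  let ?q = "\<lambda>s. if s \<le> s1 then p s else q"
  let ?y = "\<lambda>s. if s \<le> s1 then z s else z s1 + (s - s1)"
  let ?\<gamma> = "\<lambda>s. (?t s, ?q s, ?y s)"
  let ?I = "{s0..s1 + h}"
  have nd: "nondeg {s0..s1}" "nondeg {s1..s1 + h}" "nondeg ?I"
    using p(5) h by (auto intro!: nondeg_Icc)
  have cd1: "causal_data {s0..s1} ?t ?q ?y (\<lambda>_. 1) \<eta>"
    by (rule causal_data_cong[OF z(3) nd(1)]) auto
  have cd2: "causal_data {s1..s1 + h} ?t ?q ?y (\<lambda>_. 0) (\<lambda>_. 1)"
    by (rule causal_data_cong[OF vertical_causal_data[OF p(4), of s1 "s1 + h" q "z s1"] nd(2)]) (use h p(8) in auto)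
  have cont: "continuous_on J t'" "continuous_on J q'" "continuous_on J y'" 
    if "causal_data J t' q' y' \<tau>' \<eta>'" for J t' q' y' \<tau>' \<eta>'
    using that unfolding causal_data_def C1_curve_def by (auto intro: DERIV_continuous_on)
  have "{s0..s1 + h} = {s0..s1} \<union> {s1..s1 + h}"
    using p(5) h by auto
  then have cI: "continuous_on ?I ?t" "continuous_on ?I ?q" "continuous_on ?I ?y"
    using cont[OF cd1] cont[OF cd2] by (auto intro!: continuous_on_closed_Un)
  have "causal_curve A T a b V ?I ?\<gamma>"
    unfolding causal_curve_def
  proof (intro conjI exI[of _ "{s1}"] allI impI)
    show "continuous_on ?I ?\<gamma>"
      by (intro continuous_on_Pair cI)
    fix J assume J: "is_interval J \<and> interior J \<noteq> {} \<and> J \<subseteq> ?I \<and> interior J \<inter> {s1} = {}"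
    then have ndJ: "nondeg J"
      by auto
    have "J \<subseteq> {s0..s1} \<or> J \<subseteq> {s1..s1 + h}"
      by (rule interval_one_sided) (use J in auto)
    then have "\<exists>\<tau>' \<eta>'. causal_data J ?t ?q ?y \<tau>' \<eta>'"
      using causal_data_subset[OF cd1 nd(1) _ ndJ] causal_data_subset[OF cd2 nd(2) _ ndJ] by blast
    then show "C1_causal_curve A T a b V J ?\<gamma>"
      using causal_data_imp_C1_causal_curve[OF _ ndJ] by blast
  qed (use nd in auto)
  then have "connected (?\<gamma> ` ?I \<inter> W)"
    by (rule W(4))
  then have "connected (fst ` (?\<gamma> ` ?I \<inter> W))"
    by (intro connected_continuous_image continuous_on_fst continuous_on_id)
  moreover have "s0 \<in> fst ` (?\<gamma> ` ?I \<inter> W)"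
    using inW(1) z(1) p(5,7) h by (force simp: image_iff intro!: bexI[of _ "(s0, q, y)"] bexI[of _ s0])
  moreover have "s1 \<in> fst ` (?\<gamma> ` ?I \<inter> W)"
    using inW(2) p(5) h by (force simp: image_iff h_def intro!: bexI[of _ "(s1, q, y)"] bexI[of _ "s1 + h"])
  \<comment> \<open>Both ends of the curve lie in \<open>W\<close>, so the times of a connected
    trace fill the whole interval.\<close>
  ultimately have sub: "{s0..s1} \<subseteq> fst ` (?\<gamma> ` ?I \<inter> W)"
    using connected_contains_Icc by blast
  \<comment> \<open>A time before \<open>s1\<close> is attained only once, by the null lift, so that
    point of the lift must lie in \<open>W\<close>.\<close>
  have above: "z s > y - 1" if s: "s0 \<le> s" "s < s1" for s
  proof -
    have "s \<in> fst ` (?\<gamma> ` ?I \<inter> W)"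
      using sub s by auto
    then obtain s' where "s' \<in> ?I" "?\<gamma> s' \<in> W" "s = ?t s'"
      by auto
    then have "(s, p s, z s) \<in> W"
      using s by (auto split: if_splits)
    then show ?thesis
      using W(3) by auto
  qed
  have "continuous_on {s0..s1} z"
    using cont(3)[OF z(3)] .
  then have "(z \<longlongrightarrow> z s1) (at s1 within {s0..s1})"
    using p(5) by (auto simp: continuous_on_def)
  then have "(z \<longlongrightarrow> z s1) (at_left s1)"
    using p(5) by (simp add: at_within_Icc_at_left)
  moreover have "\<forall>\<^sub>F s in at_left s1. y - 1 \<le> z s"
    using eventually_at_left_real[OF p(5)] by eventually_elim (use above in \<open>auto simp: less_imp_le\<close>)
  ultimately have "y - 1 \<le> z s1"
    by (rule tendsto_lowerbound) simp
  then show False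
    using h by (simp add: h_def)
qed

lemma strongly_causal_imp_lsc:
  assumes "t \<in> T" "strongly_causal_at A T a b V (t, q, y)"
  shows "lsc_diag t q"
proof (rule ccontr)
  assume nl: "\<not> lsc_diag t q"
  have "\<not> strongly_causal_at A T a b V (t, q, y)"
  proof (rule negative_loop_not_strongly_causal)
    fix \<theta> :: real assume "\<theta> > 0"
    from negative_loops[OF nl assms(1) this, of 2]
    show "\<exists>s0 s1 p. s0 \<in> ball t \<theta> \<and> s1 \<in> ball t \<theta> \<and> s0 \<in> T \<and> s1 \<in> T \<and> s0 < s1 \<and>
      C1_curve A {s0..s1} p \<and> p s0 = q \<and> p s1 = q \<and> action A a b V s0 s1 p \<le> - 2"
      by metis
  qed
  then show False
    using assms(2) by simp
qed

text \<open>The neighborhoods are cut out by \<open>\<bar>w\<bar> + l \<bar>z\<bar> < \<eta>\<close>, where \<open>w\<close> is \<open>y\<close> plus a large multiple of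
  \<open>t\<close> and \<open>z\<close> are coordinates on \<open>Q\<close>: along causal curves in the chart, \<open>w\<close> grows at least as
  fast as \<open>l \<bar>z\<bar>\<close>. A causal curve which leaves the chart gains more \<open>y\<close> than the neighborhood
  allows, since its remaining part has action bounded below by lower semi-continuity.\<close>

lemma lsc_imp_strongly_causal:
  assumes lsc: "lsc_diag t0 q0" and t0: "t0 \<in> T"
  shows "strongly_causal_at A T a b V (t0, q1, y1)"
  unfolding strongly_causal_at_def
proof (intro allI impI; elim conjE)
  fix N assume N: "open N" "(t0, q1, y1) \<in> N"
  obtain AN R where AN: "open AN" "t0 \<in> AN" "open R" "(q1, y1) \<in> R" "AN \<times> R \<subseteq> N"
    using open_prod_elim[OF N] by (metis SigmaD1 SigmaD2)
  obtain BN CN where BN: "open BN" "q1 \<in> BN" "open CN" "y1 \<in> CN" "BN \<times> CN \<subseteq> R"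
    using open_prod_elim[OF AN(3,4)] by (metis SigmaD1 SigmaD2)
  obtain rA where rA: "rA > 0" "ball t0 rA \<subseteq> AN"
    using open_contains_ball AN(1,2) by blast
  obtain rC where rC: "rC > 0" "ball y1 rC \<subseteq> CN"
    using open_contains_ball BN(3,4) by blast
  obtain \<theta>0 where \<theta>0: "\<theta>0 > 0" "\<And>x0 x1. x0 \<in> ball t0 \<theta>0 \<Longrightarrow> x1 \<in> ball t0 \<theta>0 \<Longrightarrow> x0 \<in> T \<Longrightarrow> x1 \<in> T \<Longrightarrow> x0 < x1 \<Longrightarrow> 
     Sact (x0, q0) (x1, q0) > -1"
    using lsc_diagD[OF lsc] by metis
  obtain B \<theta>1 D where B: "open B" "q1 \<in> B" "\<theta>1 > 0" 
    "\<And>p s0 s1. p\<in>B \<Longrightarrow> s0 \<in> ball t0 \<theta>1 \<Longrightarrow> s1 \<in> ball t0 \<theta>1 \<Longrightarrow> s0 < s1 \<Longrightarrow> 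
       reach s0 q0 s1 p (D / (s1 - s0)) \<and> reach s0 p s1 q0 (D / (s1 - s0))"
    using reach_global[OF t0, of q1 q0] by blast
  obtain U \<phi> where c: "(U, \<phi>) \<in> A" "q1 \<in> U"
    using chart_cover .
  define z1 where "z1 = \<phi> q1"
  have BBN: "open (B \<inter> BN)" "q1 \<in> B \<inter> BN"
    using B BN by auto
  obtain \<rho> where \<rho>: "\<rho> > 0" "cball t0 \<rho> \<subseteq> T" "cball z1 \<rho> \<subseteq> \<phi> ` U" 
    "\<And>p. p \<in> U \<Longrightarrow> \<phi> p \<in> cball z1 \<rho> \<Longrightarrow> p \<in> B \<inter> BN"
    unfolding z1_def by (rule chart_box_open[OF c t0 BBN]) blast
  let ?K1 = "cball t0 \<rho>" and ?K2 = "cball z1 \<rho>"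
  obtain k C where kC: "k > 0" "C \<ge> 0" 
    "\<And>t z u. t \<in> ?K1 \<Longrightarrow> z \<in> ?K2 \<Longrightarrow> k * (norm u)\<^sup>2 \<le> acoord U \<phi> t z u"
    "\<And>t z u. t \<in> ?K1 \<Longrightarrow> z \<in> ?K2 \<Longrightarrow> \<bar>bcoord U \<phi> t z u\<bar> \<le> C * norm u"
    "\<And>t z. t \<in> ?K1 \<Longrightarrow> z \<in> ?K2 \<Longrightarrow> \<bar>Vcoord U \<phi> t z\<bar> \<le> C"
    using coord_bounds[OF c(1) compact_cball \<rho>(2) compact_cball \<rho>(3)] by metis
  \<comment> \<open>The quarter leaves room for times within \<open>\<theta>\<close> of
    \<open>t0\<close>, shifted by \<open>\<theta>\<close> for a connection and by less than another
    \<open>\<theta>\<close> for the delay.\<close>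
  define \<theta> where "\<theta> = min (min \<theta>0 \<theta>1) \<rho> / 4"
  have \<theta>: "\<theta> > 0" "4 * \<theta> \<le> \<theta>0" "4 * \<theta> \<le> \<theta>1" "4 * \<theta> \<le> \<rho>"
    using \<theta>0(1) B(3) \<rho>(1) by (auto simp: \<theta>_def)
  \<comment> \<open>Escaping across half the radius then gains
    \<open>2 * \<bar>D\<bar> / \<theta> + 5\<close> in \<open>y\<close>, up to an error of
    \<open>2 * \<eta>\<close>: enough to pay for two connections of duration \<open>\<theta>\<close>
    and to leave a definite surplus.\<close>
  define l where "l = 2 * (2 * \<bar>D\<bar> / \<theta> + 5) / \<rho>"
  have l\<rho>: "l * (\<rho> / 2) = 2 * \<bar>D\<bar> / \<theta> + 5"
    using \<rho>(1) by (simp add: l_def)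
  have l: "l > 0"
    using \<rho>(1) \<theta>(1) unfolding l_def by (intro divide_pos_pos mult_pos_pos add_nonneg_pos) auto
  define M where "M = (l + C)\<^sup>2 / (2 * k) + C"
  have M: "M \<ge> 0"
    using kC(1,2) by (simp add: M_def)
  \<comment> \<open>Two points of \<open>W\<close> differ in \<open>y\<close> by less than
    \<open>4 * \<eta> \<le> 1\<close>, while an escape would gain more than
    \<open>3 - 2 * \<eta>\<close>. The bound by \<open>rC\<close> keeps \<open>W\<close> inside
    \<open>N\<close>.\<close>
  define \<eta> where "\<eta> = min (1/4) (rC / 2)"
  have \<eta>: "\<eta> > 0" "\<eta> \<le> 1/4" "2 * \<eta> \<le> rC" "\<eta> < l * (\<rho> / 2)"
  proof -
    show "\<eta> > 0" "\<eta> \<le> 1/4" "2 * \<eta> \<le> rC"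
      using rC(1) by (auto simp: \<eta>_def)
    have "2 * \<bar>D\<bar> / \<theta> \<ge> 0"
      using \<theta>(1) by simp
    then show "\<eta> < l * (\<rho> / 2)"
      unfolding l\<rho> using \<open>\<eta> \<le> 1/4\<close> by linarith
  qed
  \<comment> \<open>By \<open>M * \<delta> \<le> \<eta>\<close> the time term in \<open>w\<close>
    changes \<open>y - y1\<close> by at most \<open>\<eta>\<close>.\<close>
  obtain \<delta> where \<delta>: "\<delta> > 0" "M * \<delta> \<le> \<eta>" "\<delta> \<le> rA" "\<delta> \<le> \<theta>"
  proof -
    have "\<exists>d>0. \<forall>(x, y)\<in>{(M, \<eta>), (1, rA), (1, \<theta>)}. \<bar>x\<bar> * d \<le> y"
      by (rule small_multiple) (use \<eta>(1) rA(1) \<theta>(1) in auto)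
    then show ?thesis
      using that M by auto
  qed
  define w where "w t y = y - y1 + M * (t - t0)" for t y
  define W where "W = {x \<in> ball t0 \<delta> \<times> U \<times> UNIV. 
     \<bar>w (fst x) (snd (snd x))\<bar> + l * norm (\<phi> (fst (snd x)) - z1) < \<eta>}"
  have W_iff: "(t, p, y) \<in> W \<longleftrightarrow> t \<in> ball t0 \<delta> \<and> p \<in> U \<and> \<bar>w t y\<bar> + l * norm (\<phi> p - z1) < \<eta>" for t p y
    unfolding W_def by auto
  have W_near: "t \<in> ball t0 \<delta>" "p \<in> U" "norm (\<phi> p - z1) < \<rho> / 2" "\<bar>y - y1\<bar> < 2 * \<eta>" if x: "(t, p, y) \<in> W" for t p y
  proof -
    show t: "t \<in> ball t0 \<delta>" and p: "p \<in> U"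
      using x W_iff by auto
    have less: "\<bar>w t y\<bar> + l * norm (\<phi> p - z1) < \<eta>"
      using x W_iff by auto
    then have "l * norm (\<phi> p - z1) < l * (\<rho> / 2)"
      using \<eta>(4) abs_ge_zero[of "w t y"] by linarith
    then show "norm (\<phi> p - z1) < \<rho> / 2"
      using l by (rule mult_left_less_imp_less[OF _ less_imp_le])
    have "\<bar>M * (t - t0)\<bar> \<le> M * \<delta>"
      using t M by (auto simp: abs_mult dist_real_def intro!: mult_left_mono)
    moreover have "l * norm (\<phi> p - z1) \<ge> 0"
      using l by simp
    ultimately show "\<bar>y - y1\<bar> < 2 * \<eta>"
      using less \<delta>(2) unfolding w_def by linarith
  qed
  have W_open: "open W"
  proof -
    have op: "open (ball t0 \<delta> \<times> U \<times> (UNIV :: real set))"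
      using chartD(1)[OF c(1)] by (intro open_Times) auto
    have "continuous_on (ball t0 \<delta> \<times> U \<times> UNIV) (\<lambda>x :: real \<times> 'q \<times> real. \<phi> (fst (snd x)))"
      by (rule continuous_on_compose2[OF chartD(4)[OF c(1)]]) (auto intro!: continuous_intros)
    then have "continuous_on (ball t0 \<delta> \<times> U \<times> UNIV) 
        (\<lambda>x. \<bar>w (fst x) (snd (snd x))\<bar> + l * norm (\<phi> (fst (snd x)) - z1))"
      unfolding w_def by (intro continuous_intros)
    from continuous_open_preimage[OF this op open_lessThan[of \<eta>]]
    have "open (ball t0 \<delta> \<times> U \<times> UNIV \<inter> 
        (\<lambda>x. \<bar>w (fst x) (snd (snd x))\<bar> + l * norm (\<phi> (fst (snd x)) - z1)) -` {..<\<eta>})" .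
    moreover have "W = ball t0 \<delta> \<times> U \<times> UNIV \<inter> 
        (\<lambda>x. \<bar>w (fst x) (snd (snd x))\<bar> + l * norm (\<phi> (fst (snd x)) - z1)) -` {..<\<eta>}"
      by (auto simp only: W_def vimage_def lessThan_iff mem_Collect_eq Int_iff)
    ultimately show ?thesis
      by simp
  qed
  have x1W: "(t0, q1, y1) \<in> W"
    using \<delta>(1) c \<eta>(1) by (simp add: W_iff w_def z1_def)
  have W_sub: "W \<subseteq> N \<inter> spacetime T"
  proof
    fix x assume "x \<in> W"
    moreover obtain t p y where x: "x = (t, p, y)"
      by (rule prod_cases3)
    ultimately have xW: "(t, p, y) \<in> W"
      by simp
    note n = W_near[OF xW]
    have "t \<in> AN"
      using n(1) \<delta>(3) rA(2) by auto
    moreover have "t \<in> T"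
      using n(1) \<delta>(4) \<theta>(1,4) \<rho>(2) by (auto simp: subset_iff)
    moreover have "p \<in> BN"
      using \<rho>(4)[OF n(2)] n(3) \<rho>(1) by (auto simp: dist_norm norm_minus_commute)
    moreover have "y \<in> CN"
      using n(4) \<eta>(3) rC(2) by (auto simp: dist_real_def abs_minus_commute subset_iff)
    ultimately show "x \<in> N \<inter> spacetime T"
      using AN(5) BN(5) unfolding x spacetime_def by blast
  qed
  \<comment> \<open>Causal convexity of \<open>W\<close>: a causal curve that has left
    \<open>W\<close> never returns. Hence the parameters of its points in \<open>W\<close> form an
    interval.\<close>
  have convex: "\<gamma> u \<in> W" if \<gamma>: "causal_curve A T a b V I \<gamma>" and s: "s0 \<in> I" "s1 \<in> I" "\<gamma> s0 \<in> W" "\<gamma> s1 \<in> W" 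
    and u: "s0 < u" "u < s1" for I \<gamma> s0 s1 u
  proof -
    let ?t = "\<lambda>s. fst (\<gamma> s)" and ?q = "\<lambda>s. fst (snd (\<gamma> s))" and ?y = "\<lambda>s. snd (snd (\<gamma> s))"
    have s01: "s0 < s1"
      using u by simp
    have I: "x \<in> I" if "x \<in> {s0..s1}" for x
      using \<gamma> mem_is_interval_1_I[of I s0 s1 x] s that unfolding causal_curve_def by auto
    have ends: "(?t s0, ?q s0, ?y s0) \<in> W" "(?t s1, ?q s1, ?y s1) \<in> W"
      using s by auto
    note n0 = W_near[OF ends(1)] and n1 = W_near[OF ends(2)]
    have mono: "?t x \<le> ?t x'" if "x \<in> {s0..s1}" "x' \<in> {s0..s1}" "x \<le> x'" for x x'
      using causal_curve_time_mono[OF \<gamma> I[OF that(1)] I[OF that(2)] that(3)] .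
    have tb: "?t x \<in> ball t0 \<delta>" if "x \<in> {s0..s1}" for x
      using mono[of s0 x] mono[of x s1] that n0(1) n1(1) by (auto simp: dist_real_def)
    have tK: "?t x \<in> ?K1" if "x \<in> {s0..s1}" for x
      using tb[OF that] \<delta>(4) \<theta>(1,4) by auto
    have cq: "continuous_on {s0..s1} ?q"
    proof -
      have "continuous_on I \<gamma>" "{s0..s1} \<subseteq> I"
        using \<gamma> I unfolding causal_curve_def by auto
      then have "continuous_on {s0..s1} \<gamma>"
        by (rule continuous_on_subset)
      then show ?thesis
        by (intro continuous_intros)
    qed
    have est: "?y x' - ?y x \<ge> l * norm (\<phi> (?q x') - \<phi> (?q x)) - M * (?t x' - ?t x)" 
      if x: "x \<in> {s0..s1}" "x' \<in> {s0..s1}" "x < x'" 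
        and in_box: "\<And>s. s \<in> {x..x'} \<Longrightarrow> ?q s \<in> U \<and> \<phi> (?q s) \<in> ?K2" for x x'
    proof -
      have "?t s \<in> ?K1 \<and> ?q s \<in> U \<and> \<phi> (?q s) \<in> ?K2" if "s \<in> {x..x'}" for s
        using that tK[of s] x in_box[OF that] by auto
      from causal_curve_box_estimate[OF \<gamma> I[OF x(1)] I[OF x(2)] x(3) c(1) this kC(1,3,2,4,5) less_imp_le[OF l]]
      show ?thesis
        by (simp add: M_def)
    qed
    have all_in: "?q x \<in> U \<and> \<phi> (?q x) \<in> ball z1 \<rho>" if x: "x \<in> {s0..s1}" for x
    proof (rule ccontr)
      assume out: "\<not> ?thesis"
      have "?q s0 \<in> U" "\<phi> (?q s0) \<in> ball z1 \<rho>"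
        using n0 \<rho>(1) by (auto simp: dist_norm norm_minus_commute)
      then obtain s where s': "s0 < s" "s \<le> x" "\<And>u. u \<in> {s0..s} \<Longrightarrow> ?q u \<in> U \<and> \<phi> (?q u) \<in> ?K2" 
        "dist z1 (\<phi> (?q s)) = \<rho>"
        by (rule first_exit[OF c(1) \<rho>(3) cq _ _ x out]) blast
      have ss1: "s < s1"
        using s' x n1(3) \<rho>(1) by (cases "s = s1") (auto simp: dist_norm norm_minus_commute)
      have sm: "s0 \<in> {s0..s1}" "s \<in> {s0..s1}" "s1 \<in> {s0..s1}"
        using s' ss1 by auto
      have far: "norm (\<phi> (?q s) - \<phi> (?q s0)) \<ge> \<rho> / 2"
        using dist_triangle[of z1 "\<phi> (?q s)" "\<phi> (?q s0)"] s'(4) n0(3) by (auto simp: dist_norm norm_minus_commute)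
      have "l * (\<rho> / 2) \<le> l * norm (\<phi> (?q s) - \<phi> (?q s0))"
        using far l by (intro mult_left_mono) auto
      moreover have "M * (?t s - ?t s0) \<le> M * (2 * \<delta>)"
        using tb[OF sm(1)] tb[OF sm(2)] M by (intro mult_left_mono) (auto simp: dist_real_def)
      moreover have "M * (2 * \<delta>) \<le> 2 * \<eta>"
        using \<delta>(2) by simp
      ultimately have first: "?y s - ?y s0 \<ge> 2 * \<bar>D\<bar> / \<theta> + 5 - 2 * \<eta>"
        using est[OF sm(1,2) s'(1,3)] l\<rho> by linarith
      have inB: "?q s \<in> B" "?q s1 \<in> B"
        using \<rho>(4)[of "?q s"] s'(3)[of s] s'(1) \<rho>(4)[of "?q s1"] n1(2,3) \<rho>(1) 
        by (auto simp: dist_norm norm_minus_commute)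
      have bs: "?t s - \<theta> \<in> ball t0 \<theta>1" "?t s \<in> ball t0 \<theta>1" "?t s1 \<in> ball t0 \<theta>1" "?t s1 + \<theta> \<in> ball t0 \<theta>1"
        using tb[OF sm(2)] tb[OF sm(3)] \<delta>(4) \<theta>(1,3) by (auto simp: dist_real_def)
      have "reach (?t s - \<theta>) q0 (?t s) (?q s) (D / \<theta>)" "reach (?t s1) (?q s1) (?t s1 + \<theta>) q0 (D / \<theta>)"
        using B(4)[OF inB(1) bs(1,2)] B(4)[OF inB(2) bs(3,4)] \<theta>(1) by auto
      \<comment> \<open>The piece after the exit is closed up to a loop at \<open>q0\<close>, the
        only point at which semi-continuity is given.\<close>
      then have "reach (?t s - \<theta>) q0 (?t s1 + \<theta>) q0 (D / \<theta> + (?y s1 - ?y s) + D / \<theta>)"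
        using reach_trans causal_curve_reach[OF \<gamma> I[OF sm(2)] I[OF sm(3)] ss1] by blast
      moreover have m1: "min 1 \<theta> > 0"
        using \<theta>(1) by simp
      ultimately obtain \<delta>' where \<delta>': "\<delta>' > 0" "\<forall>t0'\<in>{?t s - \<theta>..?t s - \<theta> + \<delta>'}. \<exists>t1'. ?t s1 + \<theta> < t1' \<and> 
        t1' < ?t s1 + \<theta> + min 1 \<theta> \<and> rest_curve t0' q0 t1' q0 (D / \<theta> + (?y s1 - ?y s) + D / \<theta> + min 1 \<theta>)"
        unfolding reach_def by meson
      have "?t s - \<theta> \<in> {?t s - \<theta>..?t s - \<theta> + \<delta>'}"
        using \<delta>'(1) by simp
      then obtain x1 where x1: "?t s1 + \<theta> < x1" "x1 < ?t s1 + \<theta> + min 1 \<theta>" 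
        "rest_curve (?t s - \<theta>) q0 x1 q0 (D / \<theta> + (?y s1 - ?y s) + D / \<theta> + min 1 \<theta>)"
        using \<delta>'(2) by blast
      have xb: "?t s - \<theta> \<in> ball t0 \<theta>0" "x1 \<in> ball t0 \<theta>0"
        using tb[OF sm(2)] tb[OF sm(3)] \<delta>(4) \<theta>(1,2) x1(1,2) by (auto simp: dist_real_def)
      have "?t s - \<theta> < x1" "?t s - \<theta> \<in> T" "x1 \<in> T"
        using x1(3) unfolding rest_curve_def by auto
      from \<theta>0(2)[OF xb this(2,3,1)] rest_curve_least_action[OF x1(3)]
      have "- 1 < ereal (D / \<theta> + (?y s1 - ?y s) + D / \<theta> + min 1 \<theta>)"
        by (rule less_le_trans)
      then have "- 1 < D / \<theta> + (?y s1 - ?y s) + D / \<theta> + min 1 \<theta>"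
        by (simp add: one_ereal_def del: ereal_min)
      then have "- 1 < 2 * (D / \<theta>) + (?y s1 - ?y s) + 1"
        by simp
      moreover have "2 * (D / \<theta>) \<le> 2 * \<bar>D\<bar> / \<theta>"
        using \<theta>(1) by (simp add: divide_right_mono)
      ultimately have "?y s1 - ?y s0 > 3 - 2 * \<eta>"
        using first by linarith
      then show False
        using n0(4) n1(4) \<eta>(2) by linarith
    qed
    have in_box: "?q x \<in> U \<and> \<phi> (?q x) \<in> ?K2" if "x \<in> {s0..s1}" for x
      using all_in[OF that] by (auto simp: less_imp_le)
    have um: "s0 \<in> {s0..s1}" "u \<in> {s0..s1}" "s1 \<in> {s0..s1}"
      using u by auto
    have w_mono: "w (?t x') (?y x') - w (?t x) (?y x) \<ge> l * norm (\<phi> (?q x') - \<phi> (?q x))" 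
      if "x \<in> {s0..s1}" "x' \<in> {s0..s1}" "x < x'" for x x'
      using est[OF that] in_box that unfolding w_def by (auto simp: algebra_simps)
    have tri: "l * norm (\<phi> (?q u) - z1) \<le> l * norm (\<phi> (?q u) - \<phi> (?q x)) + l * norm (\<phi> (?q x) - z1)" for x
      unfolding distrib_left[symmetric] 
      using l norm_triangle_ineq[of "\<phi> (?q u) - \<phi> (?q x)" "\<phi> (?q x) - z1"] by (intro mult_left_mono) auto
    have e0: "\<bar>w (?t s0) (?y s0)\<bar> + l * norm (\<phi> (?q s0) - z1) < \<eta>" and e1: "\<bar>w (?t s1) (?y s1)\<bar> + l * norm (\<phi> (?q s1) - z1) < \<eta>"
      using ends unfolding W_iff by blast+
    \<comment> \<open>Comparison with the later end bounds \<open>w\<close> from above, and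
      comparison with the earlier end bounds it from below; each uses the triangle inequality
      \<open>tri\<close>.\<close>
    have "w (?t u) (?y u) + l * norm (\<phi> (?q u) - z1) < \<eta>"
      using w_mono[OF um(2,3) u(2)] tri[of s1] e1 by (simp add: norm_minus_commute)
    moreover have "- w (?t u) (?y u) + l * norm (\<phi> (?q u) - z1) < \<eta>"
      using w_mono[OF um(1,2) u(1)] tri[of s0] e0 by simp
    ultimately have "\<bar>w (?t u) (?y u)\<bar> + l * norm (\<phi> (?q u) - z1) < \<eta>"
      by linarith
    then have "(?t u, ?q u, ?y u) \<in> W"
      unfolding W_iff using tb[OF um(2)] all_in[OF um(2)] by blast
    then show ?thesis
      by simp
  qed
  have "connected (\<gamma> ` I \<inter> W)" if \<gamma>: "causal_curve A T a b V I \<gamma>" for I \<gamma>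
  proof -
    let ?J = "{s \<in> I. \<gamma> s \<in> W}"
    have I: "is_interval I" "continuous_on I \<gamma>"
      using \<gamma> unfolding causal_curve_def by auto
    have "is_interval ?J"
      unfolding is_interval_1
    proof (intro ballI allI impI)
      fix s0 s1 u assume "s0 \<in> ?J" "s1 \<in> ?J" "s0 \<le> u \<and> u \<le> s1"
      then show "u \<in> ?J"
        using convex[OF \<gamma>, of s0 s1 u] mem_is_interval_1_I[OF I(1), of s0 s1 u] 
        by (cases "u = s0 \<or> u = s1") auto
    qed
    then have "connected ?J"
      using is_interval_connected_1 by blast
    then have "connected (\<gamma> ` ?J)"
      by (rule connected_continuous_image[rotated]) (auto intro: continuous_on_subset[OF I(2)])
    moreover have "\<gamma> ` ?J = \<gamma> ` I \<inter> W"
      by auto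
    ultimately show ?thesis
      by simp
  qed
  then show "\<exists>U. open U \<and> (t0, q1, y1) \<in> U \<and> U \<subseteq> N \<inter> spacetime T \<and>
             (\<forall>I \<gamma>. causal_curve A T a b V I \<gamma> \<longrightarrow> connected (\<gamma> ` I \<inter> U))"
    using W_open x1W W_sub by blast
qed

end

section \<open>The equivalences on a time slice\<close>

theorem theorem4p8:
  fixes r :: nat
    and A :: "('q::t2_space, 'm::euclidean_space) chart set"
    and T :: "real set"
    and a :: "('q, 'm) tmetric"
    and b :: "('q, 'm) tform"
    and V :: "real \<Rightarrow> 'q \<Rightarrow> real"
  assumes "gravitational_wave r A T a b V"
  shows "(\<forall>(t, q, y) \<in> spacetime T.
            (strongly_causal_at A T a b V (t, q, y) \<longleftrightarrow>
              (\<forall>z \<in> spacetime T. fst z = t \<longrightarrow> strongly_causal_at A T a b V z)) \<and>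
            ((\<forall>z \<in> spacetime T. fst z = t \<longrightarrow> strongly_causal_at A T a b V z) \<longleftrightarrow>
              lsc_at_within ((t, q), (t, q)) (classical_spacetime T \<times> classical_spacetime T)
                (\<lambda>(e\<^sub>0, e\<^sub>1). least_action A a b V e\<^sub>0 e\<^sub>1))) \<and>
         (strongly_causal A T a b V \<longleftrightarrow>
            (\<forall>e \<in> classical_spacetime T.
              lsc_at_within (e, e) (classical_spacetime T \<times> classical_spacetime T)
                (\<lambda>(e\<^sub>0, e\<^sub>1). least_action A a b V e\<^sub>0 e\<^sub>1)))"
proof -
  interpret gravitational_wave r A T a b V
    by fact
  \<comment> \<open>Semi-continuity over \<open>q\<close> gives strong causality over every
    \<open>q'\<close> and \<open>y\<close> at time \<open>t\<close>. This closes the circle of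
    implications and makes \<open>lsc_diag t q\<close> independent of \<open>q\<close>.\<close>
  have sc: "strongly_causal_at A T a b V (t, q', y)" if "t \<in> T" "lsc_diag t q" for t q q' y
    using lsc_imp_strongly_causal that by blast
  have all_iff: "(\<forall>z \<in> spacetime T. fst z = t \<longrightarrow> strongly_causal_at A T a b V z) \<longleftrightarrow> lsc_diag t q"
    if "t \<in> T" for t q
  proof
    assume *: "\<forall>z \<in> spacetime T. fst z = t \<longrightarrow> strongly_causal_at A T a b V z"
    have "(t, q, 0) \<in> spacetime T"
      using that by (simp add: spacetime_def)
    then show "lsc_diag t q"
      using * strongly_causal_imp_lsc[OF that] by fastforce
  qed (use sc[OF that] in auto)
  have one_iff: "strongly_causal_at A T a b V (t, q, y) \<longleftrightarrow> lsc_diag t q" if "t \<in> T" for t q y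
    using sc strongly_causal_imp_lsc that by blast
  have slice: "(strongly_causal_at A T a b V (t, q, y) \<longleftrightarrow>
      (\<forall>z \<in> spacetime T. fst z = t \<longrightarrow> strongly_causal_at A T a b V z)) \<and>
    ((\<forall>z \<in> spacetime T. fst z = t \<longrightarrow> strongly_causal_at A T a b V z) \<longleftrightarrow> lsc_diag t q)" if "t \<in> T" for t q y
    unfolding all_iff[OF that, of q] one_iff[OF that] by simp
  have "strongly_causal A T a b V \<longleftrightarrow> (\<forall>t\<in>T. \<forall>q. lsc_diag t q)"
    using one_iff unfolding strongly_causal_def spacetime_def by auto
  then have global: "strongly_causal A T a b V \<longleftrightarrow> (\<forall>e \<in> classical_spacetime T.
      lsc_at_within (e, e) (classical_spacetime T \<times> classical_spacetime T) (\<lambda>(e\<^sub>0, e\<^sub>1). Sact e\<^sub>0 e\<^sub>1))"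
    by (simp add: classical_spacetime_def)
  have ball: "(\<forall>(t, q, y) \<in> spacetime T. P t q y) \<longleftrightarrow> (\<forall>t\<in>T. \<forall>q y. P t q y)" 
    for P :: "real \<Rightarrow> 'q \<Rightarrow> real \<Rightarrow> bool"
    by (auto simp: spacetime_def)
  show ?thesis
    unfolding ball using slice global by blast
qed

end
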